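(* Let $n\geq 2$ be an integer. Then there exists a rank-one convex $C^1$ function $f\colon\mathbb{R}^{n\times n}_{\rm sym}\to\mathbb{R}$ with locally Hölder continuous first derivative, but whose distributional Hessian $D^2f$ is not a bounded measure in any nonempty open subset $O$ of $\mathbb{R}^{n\times n}_{\rm sym}$, in the sense that for some $e\in\mathbb{R}^{n\times n}_{\rm sym}$ we have $$\sup\left\{\int_O f(x)\,D^2\varphi(x)(e,e)\,dx\;:\;\varphi\in C^\infty_c(O),\ \sup|\varphi|\leq 1\right\}=\infty.$$ In particular, the function $f$ cannot be locally polyconvex at any $\xi\in\mathbb{R}^{n\times n}_{\rm sym}$.
   Context: $\mathbb{R}^{n\times n}_{\rm sym}$ is the space of symmetric real $n\times n$ matrices, with Lebesgue measure $dx$. Rank-one convex for a function on $\mathbb{R}^{n\times n}_{\rm sym}$ means that its restriction to every segment $[x,y]$ with $x-y\in\{t\,a\otimes a:t\in\mathbb{R},\ a\in\mathbb{R}^n\}$ is convex. Locally Hölder continuous first derivative means: for every compact $K$ and every $\alpha\in(0,1)$ there is $c>0$ such that $\|Df(x)-Df(y)\|\leq c|x-y|^\alpha$ for all $x,y\in K$. $C^\infty_c(O)$ denotes real-valued smooth functions with compact support in $O$. The function $f$ is locally polyconvex at $\xi$ if there are an open neighbourhood $U$ of $\xi$ in $\mathbb{R}^{n\times n}_{\rm sym}$ and a convex function $g\colon\mathbb{R}^{\tau}\to(-\infty,\infty]$ such that $f(x)=g(M(x))$ for all $x\in U$, where $M(x)\in\mathbb{R}^\tau$ is the vector of all minors (of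 all orders) of $x$. *)

theory Defs
  imports "HOL-Analysis.Analysis"
begin

section \<open>The Euclidean space of symmetric matrices\<close>

text \<open>
  The space of symmetric matrices is made a type of its own, with the Frobenius inner product
  inherited from \<^typ>\<open>real ^ 'n ^ 'n\<close>. Then \<^const>\<open>lborel\<close> on this type is Lebesgue measure, normalised
  so that the unit cube of a Frobenius-orthonormal basis has measure one; the normalisation in
  the coordinates $x_{ij}$, $i \le j$, differs from it by a constant positive factor.
\<close>

typedef 'n sym_mat = "{A :: real ^ 'n ^ 'n::finite. transpose A = A}"
  morphisms mat_of Abs_sym_mat
proof
  show "0 \<in> {A :: real ^ 'n ^ 'n. transpose A = A}"
    by (simp add: transpose_def vec_eq_iff)
qed

setup_lifting type_definition_sym_mat

instantiation sym_mat :: (finite) real_vector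
begin

lift_definition zero_sym_mat :: "'a sym_mat" is 0
  by (simp add: transpose_def vec_eq_iff)
lift_definition plus_sym_mat :: "'a sym_mat \<Rightarrow> 'a sym_mat \<Rightarrow> 'a sym_mat" is "(+)"
  by (simp add: transpose_def vec_eq_iff)
lift_definition minus_sym_mat :: "'a sym_mat \<Rightarrow> 'a sym_mat \<Rightarrow> 'a sym_mat" is "(-)"
  by (simp add: transpose_def vec_eq_iff)
lift_definition uminus_sym_mat :: "'a sym_mat \<Rightarrow> 'a sym_mat" is "uminus"
  by (simp add: transpose_def vec_eq_iff)
lift_definition scaleR_sym_mat :: "real \<Rightarrow> 'a sym_mat \<Rightarrow> 'a sym_mat" is "(*\<^sub>R)"
  by (simp add: transpose_def vec_eq_iff)
instance
proof
  fix x y z :: "'a sym_mat" and r s :: real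
  show "x + y + z = x + (y + z)" by transfer (rule add.assoc)
  show "x + y = y + x" by transfer (rule add.commute)
  show "0 + x = x" by transfer simp
  show "- x + x = 0" by transfer simp
  show "x - y = x + - y" by transfer simp
  show "r *\<^sub>R (x + y) = r *\<^sub>R x + r *\<^sub>R y" by transfer (rule scaleR_add_right)
  show "(r + s) *\<^sub>R x = r *\<^sub>R x + s *\<^sub>R x" by transfer (rule scaleR_add_left)
  show "r *\<^sub>R s *\<^sub>R x = (r * s) *\<^sub>R x" by transfer simp
  show "1 *\<^sub>R x = x" by transfer simp
qed

end

instantiation sym_mat :: (finite) real_inner
begin

lift_definition inner_sym_mat :: "'a sym_mat \<Rightarrow> 'a sym_mat \<Rightarrow> real" is "(\<bullet>)" .
lift_definition norm_sym_mat :: "'a sym_mat \<Rightarrow> real" is norm .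
lift_definition dist_sym_mat :: "'a sym_mat \<Rightarrow> 'a sym_mat \<Rightarrow> real" is dist .

definition "sgn (x :: 'a sym_mat) = x /\<^sub>R norm x"
definition [code del]:
  "(uniformity :: ('a sym_mat \<times> 'a sym_mat) filter) =
     (INF e\<in>{0 <..}. principal {(x, y). dist x y < e})"
definition [code del]:
  "open (U :: 'a sym_mat set) \<longleftrightarrow>
     (\<forall>x\<in>U. eventually (\<lambda>(x', y). x' = x \<longrightarrow> y \<in> U) uniformity)"

instance
proof
  fix x y z :: "'a sym_mat" and r :: real and U :: "'a sym_mat set"
  show "sgn x = x /\<^sub>R norm x" by (rule sgn_sym_mat_def)
  show "dist x y = norm (x - y)" by transfer (rule dist_norm)
  show "(uniformity :: ('a sym_mat \<times> 'a sym_mat) filter) =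
     (INF e\<in>{0 <..}. principal {(x, y). dist x y < e})" by (rule uniformity_sym_mat_def)
  show "open U \<longleftrightarrow> (\<forall>x\<in>U. eventually (\<lambda>(x', y). x' = x \<longrightarrow> y \<in> U) uniformity)"
    by (rule open_sym_mat_def)
  show "x \<bullet> y = y \<bullet> x" by transfer (rule inner_commute)
  show "(x + y) \<bullet> z = x \<bullet> z + y \<bullet> z" by transfer (rule inner_add_left)
  show "(r *\<^sub>R x) \<bullet> y = r * (x \<bullet> y)" by transfer simp
  show "0 \<le> x \<bullet> x" by transfer simp
  show "(x \<bullet> x = 0) = (x = 0)" by transfer simp
  show "norm x = sqrt (x \<bullet> x)" by transfer (rule norm_eq_sqrt_inner)
qed

end

lemma subspace_symmetric: "subspace {A :: real ^ 'n ^ 'n::finite. transpose A = A}"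
  by (auto simp: subspace_def transpose_def vec_eq_iff)

lemma ex_orthonormal_basis_sym_mat:
  "\<exists>B :: 'n::finite sym_mat set. B \<noteq> {} \<and> finite B \<and>
     (\<forall>u\<in>B. \<forall>v\<in>B. u \<bullet> v = (if u = v then 1 else 0)) \<and>
     (\<forall>x. (\<forall>u\<in>B. x \<bullet> u = 0) \<longleftrightarrow> x = 0)"
proof -
  let ?S = "{A :: real ^ 'n ^ 'n. transpose A = A}"
  have S: "subspace ?S" by (rule subspace_symmetric)
  have "\<exists>B. B \<subseteq> ?S \<and> pairwise orthogonal B \<and> (\<forall>x\<in>B. norm x = 1) \<and> independent B \<and> span B = ?S"
  proof (rule orthonormal_basis_subspace[OF S])
    fix B
    assume "B \<subseteq> ?S" "pairwise orthogonal B" "\<And>x. x \<in> B \<Longrightarrow> norm x = 1"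
      "independent B" "card B = dim ?S" "span B = ?S"
    then show ?thesis by (intro exI[of _ B] conjI ballI)
  qed
  then obtain B where B: "B \<subseteq> ?S" "pairwise orthogonal B" "\<forall>x\<in>B. norm x = 1"
    "independent B" "span B = ?S"
    by (elim exE conjE)
  have finB: "finite B" using B(4) by (simp add: independent_imp_finite)
  define C where "C = Abs_sym_mat ` B"
  have mat_C: "mat_of (Abs_sym_mat b) = b" if "b \<in> B" for b
    using that B(1) by (auto intro: Abs_sym_mat_inverse)
  have one: "(mat 1 :: real ^ 'n ^ 'n) \<in> ?S" by (simp add: transpose_mat)
  have "(mat 1 :: real ^ 'n ^ 'n) \<noteq> 0" by (auto simp: mat_def vec_eq_iff)
  then have "B \<noteq> {}" using one B(5) by auto
  then have C_ne: "C \<noteq> {}" by (simp add: C_def)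
  have C_orth: "u \<bullet> v = (if u = v then 1 else 0)" if uv: "u \<in> C" "v \<in> C" for u v
  proof -
    obtain a b where ab: "a \<in> B" "b \<in> B" and u: "u = Abs_sym_mat a" and v: "v = Abs_sym_mat b"
      using uv unfolding C_def by blast
    have uv_ab: "u \<bullet> v = a \<bullet> b" unfolding u v inner_sym_mat.rep_eq by (simp add: mat_C ab)
    show ?thesis
    proof (cases "a = b")
      case True
      then show ?thesis using B(3) ab(1) uv_ab by (simp add: u v norm_eq_1)
    next
      case False
      then have "u \<noteq> v" using mat_C[OF ab(1)] mat_C[OF ab(2)] u v by metis
      moreover have "a \<bullet> b = 0"
        using pairwiseD[OF B(2) ab False] by (simp add: orthogonal_def)
      ultimately show ?thesis using uv_ab by simp
    qed
  qed
  have C_zero: "x = 0" if x: "\<forall>u\<in>C. x \<bullet> u = 0" for x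
  proof -
    have "orthogonal (mat_of x) b" if b: "b \<in> B" for b
    proof -
      have "x \<bullet> Abs_sym_mat b = 0" using x b unfolding C_def by blast
      then show ?thesis by (simp add: orthogonal_def inner_sym_mat.rep_eq mat_C[OF b])
    qed
    moreover have "mat_of x \<in> span B" using mat_of[of x] B(5) by simp
    ultimately have "orthogonal (mat_of x) (mat_of x)"
      using orthogonal_to_span by blast
    then have "x \<bullet> x = 0" by (simp add: orthogonal_def inner_sym_mat.rep_eq)
    then show ?thesis by (simp only: inner_eq_zero_iff)
  qed
  show ?thesis
  proof (intro exI[of _ C] conjI ballI allI iffI)
    show "finite C" using finB by (simp add: C_def)
  qed (use C_ne C_orth C_zero in \<open>simp_all\<close>)
qed

instantiation sym_mat :: (finite) euclidean_space
begin

text \<open>No particular basis is canonical; any Frobenius-orthonormal one will do.\<close>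

definition Basis_sym_mat :: "'a sym_mat set" where
  "Basis_sym_mat = (SOME B. B \<noteq> {} \<and> finite B \<and>
     (\<forall>u\<in>B. \<forall>v\<in>B. u \<bullet> v = (if u = v then 1 else 0)) \<and>
     (\<forall>x. (\<forall>u\<in>B. x \<bullet> u = 0) \<longleftrightarrow> x = 0))"

instance
proof
  have *: "(Basis :: 'a sym_mat set) \<noteq> {} \<and> finite (Basis :: 'a sym_mat set) \<and>
     (\<forall>u\<in>Basis. \<forall>v\<in>Basis. (u :: 'a sym_mat) \<bullet> v = (if u = v then 1 else 0)) \<and>
     (\<forall>x :: 'a sym_mat. (\<forall>u\<in>Basis. x \<bullet> u = 0) \<longleftrightarrow> x = 0)"
    unfolding Basis_sym_mat_def by (rule someI_ex[OF ex_orthonormal_basis_sym_mat])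
  show "(Basis :: 'a sym_mat set) \<noteq> {}" using * by (rule conjunct1)
  show "finite (Basis :: 'a sym_mat set)" using * by (elim conjE)
  show "u \<bullet> v = (if u = v then 1 else 0)" if "u \<in> Basis" "v \<in> Basis" for u v :: "'a sym_mat"
    using *[THEN conjunct2, THEN conjunct2, THEN conjunct1] that by blast
  show "(\<forall>u\<in>Basis. x \<bullet> u = 0) \<longleftrightarrow> x = 0" for x :: "'a sym_mat"
    by (rule *[THEN conjunct2, THEN conjunct2, THEN conjunct2, THEN spec])
qed

end

section \<open>Rank-one convexity\<close>

lift_definition tensor_square :: "real ^ 'n \<Rightarrow> 'n::finite sym_mat" is
  "\<lambda>a. \<chi> i j. a $ i * a $ j"
  by (simp add: transpose_def vec_eq_iff mult.commute)

definition rank_one_convex :: "('n::finite sym_mat \<Rightarrow> real) \<Rightarrow> bool" where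
  "rank_one_convex f \<longleftrightarrow>
     (\<forall>x y. x - y \<in> {t *\<^sub>R tensor_square a | t a. True} \<longrightarrow> convex_on (closed_segment x y) f)"

section \<open>Differentiability classes\<close>

definition total_derivative ::
    "('a::euclidean_space \<Rightarrow> real) \<Rightarrow> 'a \<Rightarrow> 'a \<Rightarrow>\<^sub>L real" where
  "total_derivative f x = Blinfun (frechet_derivative f (at x))"

definition C1_function :: "('a::euclidean_space \<Rightarrow> real) \<Rightarrow> bool" where
  "C1_function f \<longleftrightarrow> (\<forall>x. f differentiable (at x)) \<and> continuous_on UNIV (total_derivative f)"

definition locally_Holder :: "('a::real_normed_vector \<Rightarrow> 'b::real_normed_vector) \<Rightarrow> bool" where
  "locally_Holder F \<longleftrightarrow>
     (\<forall>K \<alpha>. compact K \<and> 0 < \<alpha> \<and> \<alpha> < 1 \<longrightarrow>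
        (\<exists>c>0. \<forall>x\<in>K. \<forall>y\<in>K. norm (F x - F y) \<le> c * norm (x - y) powr \<alpha>))"

text \<open>
  On a finite-dimensional space, being of class $C^{k+1}$ amounts to being differentiable with all
  directional derivatives of class $C^k$.
\<close>

primrec Ck_function :: "nat \<Rightarrow> ('a::euclidean_space \<Rightarrow> real) \<Rightarrow> bool" where
  "Ck_function 0 f \<longleftrightarrow> continuous_on UNIV f"
| "Ck_function (Suc k) f \<longleftrightarrow>
     (\<forall>x. f differentiable (at x)) \<and> (\<forall>v. Ck_function k (\<lambda>x. frechet_derivative f (at x) v))"

definition smooth_function :: "('a::euclidean_space \<Rightarrow> real) \<Rightarrow> bool" where
  "smooth_function f \<longleftrightarrow> (\<forall>k. Ck_function k f)"

text \<open>Test functions on an open set, extended by zero to the whole space.\<close>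

definition test_functions :: "'a::euclidean_space set \<Rightarrow> ('a \<Rightarrow> real) set" where
  "test_functions \<Omega> =
     {\<phi>. smooth_function \<phi> \<and> compact (closure {x. \<phi> x \<noteq> 0}) \<and> closure {x. \<phi> x \<noteq> 0} \<subseteq> \<Omega>}"

definition second_derivative :: "('a::euclidean_space \<Rightarrow> real) \<Rightarrow> 'a \<Rightarrow> 'a \<Rightarrow> 'a \<Rightarrow> real" where
  "second_derivative \<phi> x u v = frechet_derivative (\<lambda>y. frechet_derivative \<phi> (at y) u) (at x) v"

section \<open>Local polyconvexity\<close>

text \<open>
  One index for each minor of an $n \times n$ matrix: a set of rows and a set of columns, nonempty
  and of the same size. Hence $\tau$ is the cardinality of this type.
\<close>

typedef 'n minor_index = "{(I :: 'n::finite set, J :: 'n set). I \<noteq> {} \<and> card I = card J}"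
  morphisms rows_cols Abs_minor_index
proof
  show "({undefined}, {undefined}) \<in> {(I :: 'n set, J :: 'n set). I \<noteq> {} \<and> card I = card J}"
    by simp
qed

instance minor_index :: (finite) finite
proof
  have "inj (rows_cols :: 'a minor_index \<Rightarrow> _)" by (meson injI rows_cols_inject)
  then show "finite (UNIV :: 'a minor_index set)"
    using finite_imageD[of rows_cols UNIV] by simp
qed

text \<open>
  The determinant of the submatrix with rows \<open>I\<close> and columns \<open>J\<close>, each listed in increasing order,
  by the Leibniz formula. The determinant of the library is indexed by a type and so
  does not apply to submatrices of varying size.
\<close>

definition minor :: "real ^ 'n::{finite,linorder} ^ 'n::{finite,linorder} \<Rightarrow> 'n set \<Rightarrow> 'n set \<Rightarrow> real" where
  "minor A I J =
     (\<Sum>p | p permutes {..<card I}.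
        of_int (sign p) *
        (\<Prod>k<card I. A $ (sorted_list_of_set I ! k) $ (sorted_list_of_set J ! p k)))"

definition minors :: "'n::{finite,linorder} sym_mat \<Rightarrow> real ^ 'n minor_index" where
  "minors x = (\<chi> m. case rows_cols m of (I, J) \<Rightarrow> minor (mat_of x) I J)"

text \<open>Convex functions with values in $(-\infty,\infty]$; recall that $0 \cdot \infty = 0$ in
  \<^typ>\<open>ereal\<close>, so the weights $0$ and $1$ are harmless.\<close>

definition ereal_convex :: "('a::real_vector \<Rightarrow> ereal) \<Rightarrow> bool" where
  "ereal_convex g \<longleftrightarrow> (\<forall>v. g v \<noteq> - \<infinity>) \<and>
     (\<forall>v w. \<forall>s\<ge>0. \<forall>t\<ge>0. s + t = 1 \<longrightarrow>
        g (s *\<^sub>R v + t *\<^sub>R w) \<le> ereal s * g v + ereal t * g w)"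

definition locally_polyconvex_at ::
    "('n::{finite,linorder} sym_mat \<Rightarrow> real) \<Rightarrow> 'n sym_mat \<Rightarrow> bool" where
  "locally_polyconvex_at f \<xi> \<longleftrightarrow>
     (\<exists>U (g :: real ^ 'n minor_index \<Rightarrow> ereal).
        open U \<and> \<xi> \<in> U \<and> ereal_convex g \<and> (\<forall>x\<in>U. ereal (f x) = g (minors x)))"

end

theory Submission
  imports Defs
begin

text \<open>
  Only three coordinates of the space matter. Let $E_1$, $E_2$ be the squares of two coordinate
  vectors and let $b_0$, $b_1$, $b_2$ be $E_1 + E_2$, $E_1 - E_2$ and the off-diagonal unit of the same
  $2 \times 2$ block, each divided by $\sqrt 2$. These are orthonormal, and since $2 \times 2$ minors of
  a rank-one matrix vanish, every rank-one direction $e$ is null: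
  $(e \cdot b_0)^2 = (e \cdot b_1)^2 + (e \cdot b_2)^2$. So it suffices to build a function that is convex
  along null vectors and whose second derivative in direction $b_1$ is not a measure on any open set.

  A diagonal form $Q_H(e) = \sum_i H_i (e \cdot b_i)^2$ is positive on the null cone as soon as
  $H_0 + H_1 > 0$ and $H_0 + H_2 > 0$. The question is how large, on average, the absolute value of
  $H_1 + \partial_{11} \varphi$ can be made by a bounded smooth perturbation $\varphi$ that keeps
  $Q_H + D^2 \varphi$ positive on the null cone. Let $B(H)$ be the supremum of these averages. The
  Hessian of a function of $x \cdot b_i$ alone is a multiple of $b_i \otimes b_i$; hence $H$ and $H'$
  differing in one entry can be laminated, and finely scaled perturbations for $H$ and for $H'$ can be
  pasted into the two families of layers (\<open>attains_midpoint\<close>). This makes $B$ midpoint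
  concave in each entry separately. Moreover $B$ is positively homogeneous and $B(H) \ge |H_1|$. No finite
  function has all these properties (\<open>no_finite_separately_concave_majorant\<close>; this is a consequence
  of the theorem of Kirchheim and Kristensen that homogeneous rank-one convex functions are convex at
  points of the rank-one cone). Hence for some $H$ the averages are unbounded
  (\<open>unbounded_hessian_mean\<close>).

  Fix such an $H$ and add to $Q_H$ a series $\sum_n F_n$, where $F_n(x) = 2^{-n} M_n^{-2} \varphi_n(M_n x)$.
  The factor $2^{-n}$ lets the quadratic form pay for all concavity along null directions; it is
  beaten by the averages of $\varphi_n$, which can be as large as needed. Taking $M_n$
  large makes $F_n$ as small in $C^1$ as desired without changing the size of its second derivatives, and interpolation
  yields Hoelder continuity of the derivative for every exponent (\<open>series_Holder_derivative\<close>).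
  At stage $n$ a test function below each bump of index at most $n$ in a fixed sequence detects the Hessian
  of the partial sum up to $n$; the later terms are chosen too small to disturb this. As every nonempty
  open set contains the support of some bump of the sequence, the Hessian is unbounded everywhere
  (\<open>wild_null_convex_function\<close>).

  Finally, minors are affine along rank-one directions, hence biaffine in $(s, t)$ on
  $x + s E_1 + t E_2$. A convex function of the minors that is bounded nearby is therefore semiconvex along
  $E_1 - E_2$ (\<open>polyconvex_second_difference_ge\<close>), and then its second derivative along
  $b_1$ is a measure near the given point. So a polyconvex function cannot have the Hessian just constructed.
\<close>

section \<open>Smooth functions\<close>

abbreviation (input) "smooth \<equiv> smooth_function"

abbreviation (input) D1 :: "('a::euclidean_space \<Rightarrow> real) \<Rightarrow> 'a \<Rightarrow> 'a \<Rightarrow> real"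
  where "D1 f x \<equiv> frechet_derivative f (at x)"

abbreviation (input) "D2 \<equiv> second_derivative"

lemma Ck_function_imp_continuous: "Ck_function k f \<Longrightarrow> continuous_on UNIV f"
  by (cases k) (auto simp: continuous_on_eq_continuous_at differentiable_imp_continuous_within)

lemma Ck_function_SucI:
  assumes "\<And>x. (f has_derivative f' x) (at x)" "\<And>v. Ck_function k (\<lambda>x. f' x v)"
  shows "Ck_function (Suc k) f"
proof -
  have "D1 f x = f' x" for x
    using frechet_derivative_at[OF assms(1)[of x]] by simp
  then show ?thesis using assms by (auto simp: differentiable_def)
qed

lemma Ck_function_SucD: "Ck_function (Suc k) f \<Longrightarrow> Ck_function k f"
proof (induction k arbitrary: f)
  case 0
  then show ?case using Ck_function_imp_continuous[of "Suc 0" f] by simp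
next
  case (Suc k)
  show ?case using Suc.prems Suc.IH by simp
qed

lemma Ck_function_has_derivative:
  "Ck_function (Suc k) f \<Longrightarrow> (f has_derivative D1 f x) (at x)"
  by (simp add: frechet_derivative_works)

lemma Ck_function_const: "Ck_function k (\<lambda>x. c)"
proof (induction k arbitrary: c)
  case (Suc k)
  show ?case by (rule Ck_function_SucI[where f'="\<lambda>x v. 0"]) (use Suc in auto)
qed simp

lemma Ck_function_inner: "Ck_function k (\<lambda>x. x \<bullet> b)"
proof (cases k)
  case (Suc j)
  show ?thesis unfolding Suc
    by (rule Ck_function_SucI[where f'="\<lambda>x v. v \<bullet> b"]) (auto intro!: derivative_eq_intros Ck_function_const)
qed (auto intro!: continuous_intros)

lemma Ck_function_add:
  "Ck_function k f \<Longrightarrow> Ck_function k g \<Longrightarrow> Ck_function k (\<lambda>x. f x + g x)"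
proof (induction k arbitrary: f g)
  case (Suc k)
  show ?case
    by (rule Ck_function_SucI[OF has_derivative_add[OF Suc.prems[THEN Ck_function_has_derivative]]])
       (use Suc in auto)
qed (auto intro!: continuous_intros)

lemma Ck_function_mult:
  "Ck_function k f \<Longrightarrow> Ck_function k g \<Longrightarrow> Ck_function k (\<lambda>x. f x * g x)"
proof (induction k arbitrary: f g)
  case (Suc k)
  show ?case
    by (rule Ck_function_SucI[OF has_derivative_mult[OF Suc.prems[THEN Ck_function_has_derivative]]])
       (use Suc Ck_function_SucD[of k] in \<open>auto intro!: Ck_function_add Suc.IH\<close>)
qed (auto intro!: continuous_intros)

lemma Ck_function_compose_real:
  fixes F :: "real \<Rightarrow> real"
  shows "Ck_function k F \<Longrightarrow> Ck_function k f \<Longrightarrow> Ck_function k (\<lambda>x. F (f x))"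
proof (induction k arbitrary: F f)
  case 0
  then show ?case by (auto intro: continuous_on_compose2)
next
  case (Suc k)
  let ?F' = "\<lambda>y. D1 F y"
  have lin: "?F' y v = v * ?F' y 1" for y v
    using linear_scale[OF linear_frechet_derivative, of F "at y" v 1] Suc.prems(1) by simp
  show ?case
  proof (rule Ck_function_SucI)
    show "((\<lambda>x. F (f x)) has_derivative (\<lambda>v. ?F' (f x) (D1 f x v))) (at x)" for x
      using has_derivative_compose[OF Ck_function_has_derivative[OF Suc.prems(2)] Ck_function_has_derivative[OF Suc.prems(1)]] .
    have "Ck_function k (\<lambda>x. ?F' (f x) 1)"
      by (rule Suc.IH) (use Suc.prems Ck_function_SucD[of k f] in auto)
    then have "Ck_function k (\<lambda>x. D1 f x v * ?F' (f x) 1)" for v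
      using Suc.prems by (intro Ck_function_mult) auto
    then show "Ck_function k (\<lambda>x. ?F' (f x) (D1 f x v))" for v
      by (subst lin)
  qed
qed

lemma Ck_function_scaleR_arg:
  "Ck_function k f \<Longrightarrow> Ck_function k (\<lambda>x. f (c *\<^sub>R x))"
proof (induction k arbitrary: f)
  case 0
  then show ?case by (auto intro!: continuous_on_compose2[of UNIV f UNIV "\<lambda>x. c *\<^sub>R x"] continuous_intros)
next
  case (Suc k)
  have lin: "D1 f y (c *\<^sub>R v) = c * D1 f y v" for y v
    using linear_scale[OF linear_frechet_derivative, of f "at y" c v] Suc.prems(1) by simp
  show ?case
  proof (rule Ck_function_SucI)
    show "((\<lambda>x. f (c *\<^sub>R x)) has_derivative (\<lambda>v. D1 f (c *\<^sub>R x) (c *\<^sub>R v))) (at x)" for x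
      by (rule has_derivative_compose[OF _ Ck_function_has_derivative[OF Suc.prems]]) (auto intro!: derivative_eq_intros)
    show "Ck_function k (\<lambda>x. D1 f (c *\<^sub>R x) (c *\<^sub>R v))" for v
      unfolding lin using Suc.prems by (intro Ck_function_mult Ck_function_const Suc.IH) auto
  qed
qed

lemma Ck_function_SucI_real:
  fixes f :: "real \<Rightarrow> real"
  assumes "\<And>s. (f has_real_derivative f' s) (at s)" "Ck_function k f'"
  shows "Ck_function (Suc k) f"
  by (rule Ck_function_SucI[OF assms(1)[unfolded has_field_derivative_def]])
     (intro Ck_function_mult Ck_function_const assms)

subsection \<open>Closure properties and derivatives of smooth functions\<close>

lemma smooth_const: "smooth (\<lambda>x. c)"
  by (simp add: smooth_function_def Ck_function_const)

lemma smooth_inner: "smooth (\<lambda>x. x \<bullet> b)"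
  by (simp add: smooth_function_def Ck_function_inner)

lemma smooth_add:
  "smooth f \<Longrightarrow> smooth g \<Longrightarrow> smooth (\<lambda>x. f x + g x)"
  by (simp add: smooth_function_def Ck_function_add)

lemma smooth_mult:
  "smooth f \<Longrightarrow> smooth g \<Longrightarrow> smooth (\<lambda>x. f x * g x)"
  by (simp add: smooth_function_def Ck_function_mult)

lemma smooth_diff:
  "smooth f \<Longrightarrow> smooth g \<Longrightarrow> smooth (\<lambda>x. f x - g x)"
  using smooth_add[of f "\<lambda>x. (-1) * g x"] smooth_mult[OF smooth_const[of "-1"], of g] by simp

lemma smooth_sum:
  "(\<And>i. i \<in> I \<Longrightarrow> smooth (f i)) \<Longrightarrow> smooth (\<lambda>x. \<Sum>i\<in>I. f i x)"
  by (induction I rule: infinite_finite_induct) (auto intro: smooth_const smooth_add)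

lemma smooth_compose_real:
  fixes F :: "real \<Rightarrow> real"
  shows "smooth F \<Longrightarrow> smooth f \<Longrightarrow> smooth (\<lambda>x. F (f x))"
  unfolding smooth_function_def using Ck_function_compose_real by blast

lemma smooth_scaleR_arg: "smooth f \<Longrightarrow> smooth (\<lambda>x. f (c *\<^sub>R x))"
  by (simp add: smooth_function_def Ck_function_scaleR_arg)

lemmas smooth_intros = smooth_const smooth_inner smooth_add smooth_mult
  smooth_diff smooth_scaleR_arg smooth_sum

lemma smooth_has_derivative:
  "smooth f \<Longrightarrow> (f has_derivative D1 f x) (at x)"
  unfolding smooth_function_def using Ck_function_has_derivative by blast

lemma smooth_continuous: "smooth f \<Longrightarrow> continuous_on UNIV f"
  unfolding smooth_function_def using Ck_function_imp_continuous by blast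

lemma smooth_D1:
  "smooth f \<Longrightarrow> smooth (\<lambda>x. D1 f x v)"
  unfolding smooth_function_def by (metis Ck_function.simps(2))

lemma smooth_D2:
  "smooth f \<Longrightarrow> smooth (\<lambda>x. D2 f x u v)"
  unfolding second_derivative_def by (intro smooth_D1)

lemma smooth_D1_has_derivative:
  "smooth f \<Longrightarrow> ((\<lambda>y. D1 f y u) has_derivative D2 f x u) (at x)"
  unfolding second_derivative_def by (intro smooth_has_derivative smooth_D1)

lemma D2_eqI:
  assumes "\<And>x. (f has_derivative f' x) (at x)" "\<And>u x. ((\<lambda>x. f' x u) has_derivative f'' x u) (at x)"
  shows "D1 f x = f' x" "D2 f x u v = f'' x u v"
proof -
  have *: "D1 f x = f' x" for x
    using frechet_derivative_at[OF assms(1)[of x]] by simp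
  then show "D1 f x = f' x" .
  show "D2 f x u v = f'' x u v"
    unfolding second_derivative_def * using frechet_derivative_at[OF assms(2)[where u=u and x=x]] by simp
qed

lemma smooth_real_antiderivative:
  fixes f :: "real \<Rightarrow> real"
  assumes "\<And>s. (f has_real_derivative f' s) (at s)" "smooth f'"
  shows "smooth f"
  unfolding smooth_function_def
proof
  fix k
  have "Ck_function (Suc k) f" by (rule Ck_function_SucI_real[OF assms(1)]) (use assms(2) in \<open>simp add: smooth_function_def\<close>)
  then show "Ck_function k f" by (rule Ck_function_SucD)
qed

lemma smooth_sin_cos: "smooth (sin :: real \<Rightarrow> real)" "smooth (cos :: real \<Rightarrow> real)"
proof -
  have "Ck_function k (sin :: real \<Rightarrow> real) \<and> Ck_function k (cos :: real \<Rightarrow> real)" for k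
  proof (induction k)
    case (Suc k)
    have "Ck_function k (\<lambda>s :: real. (-1) * sin s)" using Suc by (intro Ck_function_mult Ck_function_const) auto
    then have "Ck_function k (\<lambda>s :: real. - sin s)" by simp
    then have "Ck_function (Suc k) (cos :: real \<Rightarrow> real)"
      by (rule Ck_function_SucI_real[OF DERIV_cos])
    moreover have "Ck_function (Suc k) (sin :: real \<Rightarrow> real)"
      by (rule Ck_function_SucI_real[OF DERIV_sin]) (use Suc in auto)
    ultimately show ?case by blast
  qed (auto intro!: continuous_intros)
  then show "smooth (sin :: real \<Rightarrow> real)" "smooth (cos :: real \<Rightarrow> real)"
    by (auto simp: smooth_function_def)
qed

definition logistic :: "real \<Rightarrow> real" where
  "logistic s = 1 / (1 + exp (- s))"

lemma logistic_bounds: "0 < logistic s" "logistic s < 1"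
  by (auto simp: logistic_def field_simps add_pos_pos)

lemma logistic_minus: "logistic (- s) = 1 - logistic s"
proof -
  have "1 + exp s \<noteq> 0" "1 + exp (- s) \<noteq> 0" using exp_gt_zero[of s] exp_gt_zero[of "-s"] by linarith+
  then show ?thesis by (simp add: logistic_def field_simps flip: exp_add)
qed

lemma DERIV_logistic: "(logistic has_real_derivative logistic s * (1 - logistic s)) (at s)"
proof -
  have nz: "1 + exp (- s) \<noteq> 0" using exp_gt_zero[of "-s"] by linarith
  have "((\<lambda>s. 1 / (1 + exp (- s))) has_real_derivative exp (- s) / (1 + exp (- s))^2) (at s)"
    using nz by (auto intro!: derivative_eq_intros simp: power2_eq_square)
  moreover have "exp (- s) / (1 + exp (- s))^2 = logistic s * (1 - logistic s)"
    using nz by (simp add: logistic_def field_simps power2_eq_square)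
  ultimately show ?thesis by (simp add: logistic_def[abs_def])
qed

lemma smooth_logistic: "smooth logistic"
proof -
  have "Ck_function k logistic" for k
  proof (induction k)
    case 0
    show ?case unfolding Ck_function.simps by (rule DERIV_continuous_on[OF DERIV_logistic])
  next
    case (Suc k)
    have "Ck_function k (\<lambda>s. logistic s * (1 + (-1) * logistic s))"
      by (intro Ck_function_mult Ck_function_add Ck_function_const Suc)
    moreover have "(\<lambda>s. logistic s * (1 + (-1) * logistic s)) = (\<lambda>s. logistic s * (1 - logistic s))" by simp
    ultimately show ?case by (intro Ck_function_SucI_real[OF DERIV_logistic]) metis
  qed
  then show ?thesis by (simp add: smooth_function_def)
qed

subsection \<open>Bump functions\<close>

text \<open>
  The derivatives of $\exp(-1/t)$ are combinations of the functions $\exp(-1/t)\, t^{-p}$, so treating all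
  $p$ at once turns smoothness at the origin into an induction.
\<close>

definition flat_exp :: "nat \<Rightarrow> real \<Rightarrow> real" where
  "flat_exp p t = (if t \<le> 0 then 0 else exp (- 1 / t) / t ^ p)"

text \<open>
  One term of the exponential series at $1/t$ gives $\exp(1/t) \ge t^{-p-1} / (p+1)!$. The linear decay at the
  origin makes \<open>flat_exp p\<close> continuous there and, applied with $p + 1$, differentiable.
\<close>

lemma flat_exp_bound: "\<bar>flat_exp p t\<bar> \<le> fact (p + 1) * \<bar>t\<bar>"
proof (cases "t \<le> 0")
  case False
  then have t: "0 < t" by simp
  have "(1 / t) ^ (p + 1) / fact (p + 1) \<le> exp (1 / t)"
  proof -
    have s: "(\<lambda>n. (1 / t) ^ n /\<^sub>R fact n) sums exp (1 / t)" by (rule exp_converges)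
    have "(\<Sum>n\<in>{p + 1}. (1 / t) ^ n /\<^sub>R fact n) \<le> (\<Sum>n. (1 / t) ^ n /\<^sub>R fact n)"
      using t by (intro sum_le_suminf[OF sums_summable[OF s]]) auto
    then show ?thesis unfolding sums_unique[OF s, symmetric] by (simp add: field_simps)
  qed
  then have "1 \<le> exp (1 / t) * (fact (p + 1) * t ^ (p + 1))"
    using t by (simp add: field_simps power_divide del: fact_Suc)
  then have "exp (- 1 / t) * 1 \<le> exp (- 1 / t) * (exp (1 / t) * (fact (p + 1) * t ^ (p + 1)))"
    by (intro mult_left_mono) auto
  also have "\<dots> = (exp (- 1 / t) * exp (1 / t)) * (fact (p + 1) * t ^ (p + 1))" by (simp only: mult.assoc)
  also have "\<dots> = fact (p + 1) * t ^ (p + 1)" by (simp flip: exp_add del: fact_Suc)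
  finally have "exp (- 1 / t) \<le> fact (p + 1) * t ^ (p + 1)" by simp
  then show ?thesis using t by (simp add: flat_exp_def field_simps del: fact_Suc)
next
  case True
  then show ?thesis by (auto simp: flat_exp_def simp del: fact_Suc intro: mult_nonneg_nonpos)
qed

lemma DERIV_flat_exp:
  "(flat_exp p has_real_derivative flat_exp (p + 2) t + - real p * flat_exp (p + 1) t) (at t)"
proof -
  consider "t < 0" | "0 < t" | "t = 0" by linarith
  then show ?thesis
  proof cases
    case 1
    have "((\<lambda>t. 0 :: real) has_real_derivative 0) (at t)" by simp
    then have "(flat_exp p has_real_derivative 0) (at t)"
      by (rule DERIV_cong_ev[THEN iffD1, rotated 3, OF _ refl _ refl])
        (use 1 eventually_nhds_in_open[of "{..<0}" t] in \<open>auto elim!: eventually_mono simp: flat_exp_def\<close>)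
    then show ?thesis using 1 by (simp add: flat_exp_def)
  next
    case 2
    have "((\<lambda>t. exp (- 1 / t) / t ^ p) has_real_derivative
       exp (- 1 / t) / t ^ (p + 2) + - real p * (exp (- 1 / t) / t ^ (p + 1))) (at t)"
    proof (cases p)
      case (Suc q)
      have "((\<lambda>t. exp (- 1 / t) / t ^ p) has_real_derivative
         (exp (- 1 / t) * (1 / t\<^sup>2) * t ^ p - exp (- 1 / t) * (real p * t ^ (p - Suc 0))) / (t ^ p * t ^ p)) (at t)"
        using 2 by (auto intro!: derivative_eq_intros simp: power2_eq_square)
      also have "(exp (- 1 / t) * (1 / t\<^sup>2) * t ^ p - exp (- 1 / t) * (real p * t ^ (p - Suc 0))) / (t ^ p * t ^ p)
        = exp (- 1 / t) / t ^ (p + 2) + - real p * (exp (- 1 / t) / t ^ (p + 1))"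
        using 2 by (simp add: Suc field_simps power2_eq_square)
      finally show ?thesis .
    qed (use 2 in \<open>auto intro!: derivative_eq_intros simp: power2_eq_square\<close>)
    then have "(flat_exp p has_real_derivative
       exp (- 1 / t) / t ^ (p + 2) + - real p * (exp (- 1 / t) / t ^ (p + 1))) (at t)"
      by (rule DERIV_cong_ev[THEN iffD1, rotated 3, OF _ refl _ refl])
        (use 2 eventually_nhds_in_open[of "{0<..}" t] in \<open>auto elim!: eventually_mono simp: flat_exp_def\<close>)
    then show ?thesis using 2 by (simp add: flat_exp_def)
  next
    case 3
    have "((\<lambda>h. flat_exp (p + 1) h) \<longlongrightarrow> 0) (at 0)"
    proof (rule Lim_null_comparison)
      show "\<forall>\<^sub>F h in at 0. norm (flat_exp (p + 1) h) \<le> fact (p + 1 + 1) * \<bar>h\<bar>"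
        using flat_exp_bound by (intro always_eventually allI) (metis real_norm_def)
      show "((\<lambda>h. fact (p + 1 + 1) * \<bar>h\<bar>) \<longlongrightarrow> (0::real)) (at 0)" by (auto intro!: tendsto_eq_intros)
    qed
    moreover have "(flat_exp p (0 + h) - flat_exp p 0) / h = flat_exp (p + 1) h" for h
      by (simp add: flat_exp_def)
    ultimately have "(flat_exp p has_real_derivative 0) (at 0)" unfolding DERIV_def by simp
    then show ?thesis using 3 by (simp add: flat_exp_def)
  qed
qed

lemma smooth_flat_exp: "smooth (flat_exp p)"
proof -
  have "Ck_function k (flat_exp p)" for k
  proof (induction k arbitrary: p)
    case 0
    show ?case unfolding Ck_function.simps by (rule DERIV_continuous_on[OF DERIV_flat_exp])
  next
    case (Suc k)
    have "Ck_function k (\<lambda>t. flat_exp (p + 2) t + (- real p) * flat_exp (p + 1) t)"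
      by (intro Ck_function_mult Ck_function_add Ck_function_const Suc)
    then show ?case by (rule Ck_function_SucI_real[OF DERIV_flat_exp])
  qed
  then show ?thesis by (simp add: smooth_function_def)
qed

definition bump :: "'a::euclidean_space \<Rightarrow> real \<Rightarrow> 'a \<Rightarrow> real" where
  "bump c \<rho> x = flat_exp 0 (\<rho>\<^sup>2 - (norm (x - c))\<^sup>2)"

lemma smooth_bump: "smooth (bump c \<rho>)"
proof -
  have "smooth (\<lambda>x :: 'a. \<Sum>b\<in>Basis. (x \<bullet> b - c \<bullet> b) * (x \<bullet> b - c \<bullet> b))"
    by (intro smooth_intros)
  moreover have "(\<Sum>b\<in>Basis. (x \<bullet> b - c \<bullet> b) * (x \<bullet> b - c \<bullet> b)) = (norm (x - c))\<^sup>2" for x :: 'a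
    by (simp add: power2_norm_eq_inner euclidean_inner[of "x - c" "x - c"] flip: inner_diff_left)
  ultimately have "smooth (\<lambda>x. (norm (x - c))\<^sup>2)" by simp
  then show ?thesis unfolding bump_def[abs_def]
    by (intro smooth_compose_real[OF smooth_flat_exp] smooth_intros)
qed

lemma bump_bounds: "0 \<le> bump c \<rho> x" "bump c \<rho> x \<le> 1"
  by (auto simp: bump_def flat_exp_def)

lemma bump_pos_iff: "0 < \<rho> \<Longrightarrow> 0 < bump c \<rho> x \<longleftrightarrow> dist x c < \<rho>"
  using power_mono_iff[of \<rho> "norm (x - c)" 2] by (auto simp: bump_def flat_exp_def dist_norm not_le)

lemma bump_eq_0: "0 < \<rho> \<Longrightarrow> x \<notin> ball c \<rho> \<Longrightarrow> bump c \<rho> x = 0"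
  using bump_pos_iff[of \<rho> c x] bump_bounds(1)[of c \<rho> x] by (simp add: dist_commute)

section \<open>Homogeneous separately concave functions\<close>

text \<open>
  Midpoint concavity only yields concavity at dyadic points without some regularity; chords issuing from one end
  point, at the parameters $2^{-n}$, are all that is needed below.
\<close>

lemma dyadic_midpoint_concave:
  fixes f :: "real \<Rightarrow> real"
  assumes mid: "\<And>s. 0 < s \<Longrightarrow> s \<le> T \<Longrightarrow> (f 0 + f s) / 2 \<le> f (s / 2)" and "0 < T"
  shows "(1 - 1 / 2 ^ n) * f 0 + 1 / 2 ^ n * f T \<le> f (1 / 2 ^ n * T)"
proof (induction n)
  case (Suc n)
  define r :: real where "r = 1 / 2 ^ n"
  have r: "0 < r" "r \<le> 1" by (simp_all add: r_def)
  have "r * T \<le> 1 * T" using r \<open>0 < T\<close> by (intro mult_right_mono) auto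
  then have *: "(f 0 + f (r * T)) / 2 \<le> f (r / 2 * T)"
    using mid[of "r * T"] r \<open>0 < T\<close> by simp
  have "(1 - r / 2) * f 0 + r / 2 * f T = (f 0 + ((1 - r) * f 0 + r * f T)) / 2"
    by (simp add: field_simps)
  also have "\<dots> \<le> (f 0 + f (r * T)) / 2"
    using Suc by (intro divide_right_mono add_left_mono) (simp_all add: r_def)
  also note *
  finally have "(1 - r / 2) * f 0 + r / 2 * f T \<le> f (r / 2 * T)" .
  then show ?case by (simp add: r_def mult_ac)
qed simp

text \<open>
  Let $\beta = B(1,0,0)$. Concavity and homogeneity give $B(p + t e_0) \ge B(p) + t \beta$ for $t > 0$, because
  $B(x + T, y, z) = T\, B(1 + x/T, y/T, z/T)$ grows at least like $T \beta$. Hence $B(R,u,v) - R \beta$ increases with $R$;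
  its limit $G(u,v)$ is finite, defined for all real $u$, $v$, separately midpoint concave, and satisfies
  $G(1,1) \ge 1 + \beta$ (let $R \downarrow -1$ in $B(R,1,1) \ge 1$) and $G(-1,-1) \ge 1 - \beta$
  (let $R \downarrow 1$). Put $\alpha = G(1,0)$. By homogeneity $G(X,0) \ge X \alpha$, and concavity in $v$ transfers
  this growth to $v = -1$. A concave function of $u$ with growth $\alpha$ at infinity has slope at least $\alpha$ everywhere, so
  $G(1,-1) \ge G(-1,-1) + 2 \alpha \ge 1 - \beta + 2 \alpha$. Averaging with $G(1,1)$ gives
  $\alpha \ge 1 + \alpha$, which is absurd.
\<close>

lemma no_finite_separately_concave_majorant:
  fixes B :: "real \<Rightarrow> real \<Rightarrow> real \<Rightarrow> real"
  assumes lower: "\<And>x y z. 0 < x + y \<Longrightarrow> 0 < x + z \<Longrightarrow> \<bar>y\<bar> \<le> B x y z"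
    and homog: "\<And>t x y z. 0 < t \<Longrightarrow> 0 < x + y \<Longrightarrow> 0 < x + z \<Longrightarrow> B (t * x) (t * y) (t * z) = t * B x y z"
    and mid0: "\<And>x x' y z. 0 < x + y \<Longrightarrow> 0 < x + z \<Longrightarrow> 0 < x' + y \<Longrightarrow> 0 < x' + z \<Longrightarrow>
       (B x y z + B x' y z) / 2 \<le> B ((x + x') / 2) y z"
    and mid1: "\<And>x y y' z. 0 < x + y \<Longrightarrow> 0 < x + z \<Longrightarrow> 0 < x + y' \<Longrightarrow>
       (B x y z + B x y' z) / 2 \<le> B x ((y + y') / 2) z"
    and mid2: "\<And>x y z z'. 0 < x + y \<Longrightarrow> 0 < x + z \<Longrightarrow> 0 < x + z' \<Longrightarrow>
       (B x y z + B x y z') / 2 \<le> B x y ((z + z') / 2)"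
  shows False
proof -
  define \<beta> where "\<beta> = B 1 0 0"
  have pos: "0 \<le> B x y z" if "0 < x + y" "0 < x + z" for x y z
    using lower[OF that] by linarith
  have p2: "0 < (1::real) / 2 ^ n" "(1::real) / 2 ^ n \<le> 1" for n :: nat
    by (simp_all add: field_simps)
  have small: "\<bar>s * w\<bar> \<le> 1/4" if "\<bar>w\<bar> \<le> 1/4" "0 < s" "s \<le> 1" for s w :: real
    using mult_mono[of "\<bar>s\<bar>" 1 "\<bar>w\<bar>" "1/4"] that by (simp add: abs_mult)
  have grow: "(1 - 1 / 2 ^ m) * f 0 \<le> f (1 / 2 ^ m * w)"
    if "\<bar>w\<bar> \<le> 1/4" and mid: "\<And>s. \<bar>s\<bar> \<le> 1/4 \<Longrightarrow> (f 0 + f s) / 2 \<le> f (s / 2)"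
      and nn: "\<And>s. \<bar>s\<bar> \<le> 1/4 \<Longrightarrow> 0 \<le> f s" for f :: "real \<Rightarrow> real" and m :: nat and w :: real
  proof -
    have "(1 - 1 / 2 ^ m) * f (0 * w) + 1 / 2 ^ m * f (1 * w) \<le> f (1 / 2 ^ m * 1 * w)"
    proof (rule dyadic_midpoint_concave[of 1 "\<lambda>s. f (s * w)"])
      fix s :: real assume "0 < s" "s \<le> 1"
      then have "\<bar>s * w\<bar> \<le> 1/4" using small[of w s] that(1) by simp
      from mid[OF this] show "(f (0 * w) + f (s * w)) / 2 \<le> f (s / 2 * w)" by simp
    qed simp
    moreover have "0 \<le> 1 / 2 ^ m * f (1 * w)" using nn[of w] that(1) by simp
    ultimately show ?thesis by simp
  qed
  \<comment> \<open>\<open>near1\<close> and \<open>near2\<close> replace continuity of \<open>B\<close> at \<open>(1, 0, 0)\<close>: lower bounds by following the axes one after another, upper bounds by reflection.\<close>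
  have near1: "(1 - 1 / 2 ^ m) ^ 3 * \<beta> \<le> B (1 + 1 / 2 ^ m * a) (1 / 2 ^ m * b) (1 / 2 ^ m * c)"
    if abc: "\<bar>a\<bar> \<le> 1/4" "\<bar>b\<bar> \<le> 1/4" "\<bar>c\<bar> \<le> 1/4" for a b c :: real and m :: nat
  proof -
    define r :: real where "r = 1 / 2 ^ m"
    have r: "0 < r" "r \<le> 1" by (simp_all add: r_def)
    have sm: "\<bar>r * a\<bar> \<le> 1/4" "\<bar>r * b\<bar> \<le> 1/4" "\<bar>r * c\<bar> \<le> 1/4"
      using small abc r by auto
    have 1: "(1 - r) * B (1 + 0) 0 0 \<le> B (1 + r * a) 0 0"
    proof (rule grow[of a "\<lambda>s. B (1 + s) 0 0" m, folded r_def])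
      fix s :: real assume "\<bar>s\<bar> \<le> 1/4"
      moreover have "(1 + (1 + s)) / 2 = 1 + s / 2" by (simp add: field_simps)
      ultimately show "(B (1 + 0) 0 0 + B (1 + s) 0 0) / 2 \<le> B (1 + s / 2) 0 0"
        using mid0[of 1 0 0 "1 + s"] unfolding \<open>(1 + (1 + s)) / 2 = 1 + s / 2\<close> by (simp add: abs_le_iff)
    qed (use abc pos in \<open>auto simp: abs_le_iff\<close>)
    have 2: "(1 - r) * B (1 + r * a) 0 0 \<le> B (1 + r * a) (r * b) 0"
      unfolding r_def[symmetric]
      by (rule grow[of b "\<lambda>s. B (1 + r * a) s 0" m, folded r_def])
        (use abc pos mid1[of "1 + r * a" 0 0] sm in \<open>auto simp: abs_le_iff\<close>)
    have 3: "(1 - r) * B (1 + r * a) (r * b) 0 \<le> B (1 + r * a) (r * b) (r * c)"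
      by (rule grow[of c "\<lambda>s. B (1 + r * a) (r * b) s" m, folded r_def])
        (use abc pos mid2[of "1 + r * a" "r * b" 0] sm in \<open>auto simp: abs_le_iff\<close>)
    have "(1 - r) ^ 3 * \<beta> = (1 - r) * ((1 - r) * ((1 - r) * B (1 + 0) 0 0))"
      by (simp add: power3_eq_cube \<beta>_def)
    also have "\<dots> \<le> (1 - r) * ((1 - r) * B (1 + r * a) 0 0)" using 1 r by (intro mult_left_mono) auto
    also have "\<dots> \<le> (1 - r) * B (1 + r * a) (r * b) 0" using 2 r by (intro mult_left_mono) auto
    also note 3
    finally show ?thesis by (simp add: r_def)
  qed
  have reflect: "f \<delta> \<le> (1 + r) * f 0"
    if "(f \<delta> + f (-\<delta>)) / 2 \<le> f 0" "(1 - r) * f 0 \<le> f (-\<delta>)" for f :: "real \<Rightarrow> real" and r \<delta> :: real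
    using that by (simp add: field_simps)
  have near2: "B 1 (1 / 2 ^ m * b) (1 / 2 ^ m * c) \<le> (1 + 1 / 2 ^ m) ^ 2 * \<beta>"
    if bc: "\<bar>b\<bar> \<le> 1/4" "\<bar>c\<bar> \<le> 1/4" for b c :: real and m :: nat
  proof -
    define r :: real where "r = 1 / 2 ^ m"
    have r: "0 < r" "r \<le> 1" by (simp_all add: r_def)
    have sm: "\<bar>r * b\<bar> \<le> 1/4" "\<bar>r * c\<bar> \<le> 1/4" using small bc r by auto
    have 1: "B 1 (r * b) 0 \<le> (1 + r) * B 1 0 0"
    proof (rule reflect[of "\<lambda>s. B 1 s 0"])
      show "(B 1 (r * b) 0 + B 1 (- (r * b)) 0) / 2 \<le> B 1 0 0"
        using mid1[of 1 "r * b" 0 "- (r * b)"] sm by (auto simp: abs_le_iff)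
      have "(1 - r) * B 1 0 0 \<le> B 1 (r * (- b)) 0"
        by (rule grow[of "- b" "\<lambda>s. B 1 s 0" m, folded r_def])
          (use bc pos mid1[of 1 0 0] in \<open>auto simp: abs_le_iff\<close>)
      then show "(1 - r) * B 1 0 0 \<le> B 1 (- (r * b)) 0" by simp
    qed
    have 2: "B 1 (r * b) (r * c) \<le> (1 + r) * B 1 (r * b) 0"
    proof (rule reflect[of "\<lambda>s. B 1 (r * b) s"])
      show "(B 1 (r * b) (r * c) + B 1 (r * b) (- (r * c))) / 2 \<le> B 1 (r * b) 0"
        using mid2[of 1 "r * b" "r * c" "- (r * c)"] sm by (auto simp: abs_le_iff)
      have "(1 - r) * B 1 (r * b) 0 \<le> B 1 (r * b) (r * (- c))"
        by (rule grow[of "- c" "\<lambda>s. B 1 (r * b) s" m, folded r_def])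
          (use bc pos mid2[of 1 "r * b" 0] sm in \<open>auto simp: abs_le_iff\<close>)
      then show "(1 - r) * B 1 (r * b) 0 \<le> B 1 (r * b) (- (r * c))" by simp
    qed
    note 2
    also have "(1 + r) * B 1 (r * b) 0 \<le> (1 + r) * ((1 + r) * B 1 0 0)"
      using 1 r by (intro mult_left_mono) auto
    finally show ?thesis by (simp add: power2_eq_square \<beta>_def mult.assoc r_def)
  qed
  have p2lim: "(\<lambda>m. 1 / 2 ^ m :: real) \<longlonglongrightarrow> 0"
    using LIMSEQ_divide_realpow_zero[of 2 1] by simp
  \<comment> \<open>The chord from \<open>x\<close> to \<open>x + t * 2 ^ (m + k)\<close> passes over \<open>x + t\<close>; the far end is controlled by \<open>near1\<close> after rescaling.\<close>
  have super: "B x y z + t * \<beta> \<le> B (x + t) y z" if xyz: "0 < x + y" "0 < x + z" and t: "0 < t" for x y z t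
  proof -
    obtain k :: nat where k: "4 * (\<bar>x\<bar> + \<bar>y\<bar> + \<bar>z\<bar>) / t < 2 ^ k"
      using real_arch_pow[of 2] by auto
    define q where "q = t * 2 ^ k"
    have q: "0 < q" using t by (simp add: q_def)
    have sm: "\<bar>w / q\<bar> \<le> 1/4" if "\<bar>w\<bar> \<le> \<bar>x\<bar> + \<bar>y\<bar> + \<bar>z\<bar>" for w
    proof -
      have "4 * (\<bar>x\<bar> + \<bar>y\<bar> + \<bar>z\<bar>) < q" using k t by (simp add: q_def field_simps)
      with that have "4 * \<bar>w\<bar> \<le> q" by simp
      then show ?thesis using q by (simp add: field_simps)
    qed
    have "(1 - 1 / 2 ^ (m + k)) * B x y z + t * ((1 - 1 / 2 ^ m) ^ 3 * \<beta>) \<le> B (x + t) y z" for m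
    proof -
      let ?s = "t * 2 ^ (m + k)"
      have s: "?s = q * 2 ^ m" by (simp add: q_def power_add)
      have "(1 - 1 / 2 ^ (m + k)) * B (x + 0) y z + 1 / 2 ^ (m + k) * B (x + ?s) y z
        \<le> B (x + 1 / 2 ^ (m + k) * ?s) y z"
      proof (rule dyadic_midpoint_concave[of _ "\<lambda>s. B (x + s) y z"])
        fix s :: real assume "0 < s"
        moreover have "(x + (x + s)) / 2 = x + s / 2" by (simp add: field_simps)
        ultimately show "(B (x + 0) y z + B (x + s) y z) / 2 \<le> B (x + s / 2) y z"
          using mid0[of x y z "x + s"] xyz unfolding \<open>(x + (x + s)) / 2 = x + s / 2\<close> by simp
      qed (use t in auto)
      moreover have "t * ((1 - 1 / 2 ^ m) ^ 3 * \<beta>) \<le> 1 / 2 ^ (m + k) * B (x + ?s) y z"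
      proof -
        define r :: real where "r = 1 / 2 ^ m"
        have r: "0 < r" "r \<le> 1" "q * 2 ^ m * r = q" by (simp_all add: r_def)
        have b: "\<bar>r * (x / q)\<bar> \<le> 1/4" "\<bar>r * (y / q)\<bar> \<le> 1/4" "\<bar>r * (z / q)\<bar> \<le> 1/4"
          by (rule small[OF sm r(1,2)], simp)+
        have "B (q * 2 ^ m * (1 + r * (x / q))) (q * 2 ^ m * (r * (y / q))) (q * 2 ^ m * (r * (z / q)))
          = q * 2 ^ m * B (1 + r * (x / q)) (r * (y / q)) (r * (z / q))"
        proof (rule homog)
          show "0 < 1 + r * (x / q) + r * (y / q)" "0 < 1 + r * (x / q) + r * (z / q)"
            using b[unfolded abs_le_iff] by linarith+
        qed (use q in simp)
        moreover have "q * 2 ^ m * (r * (w / q)) = w" for w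
          using q r by (metis mult.assoc nonzero_mult_div_cancel_left order_less_irrefl times_divide_eq_right)
        ultimately have h: "B (x + ?s) y z = ?s * B (1 + r * (x / q)) (r * (y / q)) (r * (z / q))"
          using s by (simp add: distrib_left add.commute)
        have "(1 - r) ^ 3 * \<beta> \<le> B (1 + r * (x / q)) (r * (y / q)) (r * (z / q))"
          unfolding r_def by (intro near1 sm) auto
        then have "t * ((1 - r) ^ 3 * \<beta>) \<le> t * B (1 + r * (x / q)) (r * (y / q)) (r * (z / q))"
          using t by simp
        also have "\<dots> = 1 / 2 ^ (m + k) * B (x + ?s) y z" unfolding h by simp
        finally show ?thesis by (simp add: r_def)
      qed
      ultimately show ?thesis by simp
    qed
    moreover have "(\<lambda>m. (1 - 1 / 2 ^ (m + k)) * B x y z + t * ((1 - 1 / 2 ^ m) ^ 3 * \<beta>))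
      \<longlonglongrightarrow> (1 - 0) * B x y z + t * ((1 - 0) ^ 3 * \<beta>)"
      by (intro tendsto_intros p2lim LIMSEQ_ignore_initial_segment[OF p2lim])
    ultimately have "(1 - 0) * B x y z + t * ((1 - 0) ^ 3 * \<beta>) \<le> B (x + t) y z"
      by (intro LIMSEQ_le_const2) auto
    then show ?thesis by simp
  qed
  define \<G> where "\<G> u v = (SUP R\<in>{R. 0 < R + u \<and> 0 < R + v}. B R u v - R * \<beta>)" for u v
  have mono: "B R u v - R * \<beta> \<le> B R' u v - R' * \<beta>" if "0 < R + u" "0 < R + v" "R \<le> R'" for R R' u v
    using super[of R u v "R' - R"] that by (cases "R = R'") (auto simp: algebra_simps)
  have bdd: "bdd_above ((\<lambda>R. B R u v - R * \<beta>) ` {R. 0 < R + u \<and> 0 < R + v})" for u v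
  proof -
    define c where "c = 4 * (\<bar>u\<bar> + \<bar>v\<bar>) + 1"
    have c: "0 < c" "\<bar>u / c\<bar> \<le> 1/4" "\<bar>v / c\<bar> \<le> 1/4" by (auto simp: c_def field_simps abs_mult)
    have "B R u v - R * \<beta> \<le> c * (3 * \<beta>)" if R: "0 < R + u" "0 < R + v" for R
    proof -
      obtain m :: nat where "R / c < 2 ^ m" using real_arch_pow[of 2] by auto
      then have m: "R \<le> c * 2 ^ m" using c by (simp add: field_simps)
      have sm: "\<bar>1 / 2 ^ m * (u / c)\<bar> \<le> 1/4" "\<bar>1 / 2 ^ m * (v / c)\<bar> \<le> 1/4"
        using c(2,3) p2[of m] small by blast+
      have "B R u v - R * \<beta> \<le> B (c * 2 ^ m) u v - c * 2 ^ m * \<beta>"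
        using mono[OF R m] by simp
      also have "B (c * 2 ^ m) u v = B (c * 2 ^ m * 1) (c * 2 ^ m * (1 / 2 ^ m * (u / c))) (c * 2 ^ m * (1 / 2 ^ m * (v / c)))"
        using c by simp
      also have "\<dots> = c * 2 ^ m * B 1 (1 / 2 ^ m * (u / c)) (1 / 2 ^ m * (v / c))"
      proof (rule homog)
        show "0 < 1 + 1 / 2 ^ m * (u / c)" "0 < 1 + 1 / 2 ^ m * (v / c)"
          using sm[unfolded abs_le_iff] by linarith+
      qed (use c in simp)
      also have "\<dots> \<le> c * 2 ^ m * ((1 + 1 / 2 ^ m) ^ 2 * \<beta>)"
        using c by (intro mult_left_mono near2) auto
      also have "c * 2 ^ m * ((1 + 1 / 2 ^ m) ^ 2 * \<beta>) - c * 2 ^ m * \<beta> = c * \<beta> * (2 + 1 / 2 ^ m)"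
        by (simp add: field_simps power2_eq_square)
      also have "\<dots> \<le> c * \<beta> * 3"
        using c pos[of 1 0 0] p2[of m] by (intro mult_left_mono) (auto simp: \<beta>_def)
      finally show ?thesis by (simp add: mult_ac)
    qed
    then show ?thesis by (intro bdd_aboveI2) auto
  qed
  have G_ge: "B R u v - R * \<beta> \<le> \<G> u v" if "0 < R + u" "0 < R + v" for R u v
    unfolding \<G>_def using that by (intro cSUP_upper bdd) auto
  have ne: "{R :: real. 0 < R + u \<and> 0 < R + v} \<noteq> {}" for u v
  proof -
    have "\<bar>u\<bar> + \<bar>v\<bar> + 1 \<in> {R :: real. 0 < R + u \<and> 0 < R + v}" by auto
    then show ?thesis by blast
  qed
  have G_le: "\<G> u v \<le> a" if "\<And>R. 0 < R + u \<Longrightarrow> 0 < R + v \<Longrightarrow> B R u v - R * \<beta> \<le> a" for u v a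
    unfolding \<G>_def using that ne by (intro cSUP_least) auto
  have G_mid: "(\<G> u v + \<G> u' v') / 2 \<le> \<G> ((u + u') / 2) ((v + v') / 2)"
    if step: "\<And>R. 0 < R + u \<Longrightarrow> 0 < R + v \<Longrightarrow> 0 < R + u' \<Longrightarrow> 0 < R + v' \<Longrightarrow>
      (B R u v + B R u' v') / 2 \<le> B R ((u + u') / 2) ((v + v') / 2)" for u v u' v'
  proof -
    let ?g = "\<G> ((u + u') / 2) ((v + v') / 2)"
    have *: "(B R u v - R * \<beta>) + (B R' u' v' - R' * \<beta>) \<le> 2 * ?g"
      if R: "0 < R + u" "0 < R + v" "0 < R' + u'" "0 < R' + v'" for R R'
    proof -
      let ?M = "max R R'"
      have "(B R u v - R * \<beta>) \<le> B ?M u v - ?M * \<beta>" "(B R' u' v' - R' * \<beta>) \<le> B ?M u' v' - ?M * \<beta>"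
        using R by (auto intro!: mono)
      moreover have "(B ?M u v + B ?M u' v') / 2 \<le> B ?M ((u + u') / 2) ((v + v') / 2)"
        using R by (intro step) auto
      moreover have "B ?M ((u + u') / 2) ((v + v') / 2) - ?M * \<beta> \<le> ?g"
        using R by (intro G_ge) (auto simp: field_simps)
      ultimately show ?thesis by simp
    qed
    have "\<G> u v \<le> 2 * ?g - \<G> u' v'"
    proof (rule G_le)
      fix R assume R: "0 < R + u" "0 < R + v"
      have "\<G> u' v' \<le> 2 * ?g - (B R u v - R * \<beta>)"
        by (rule G_le) (use *[OF R] in fastforce)
      then show "B R u v - R * \<beta> \<le> 2 * ?g - \<G> u' v'" by simp
    qed
    then show ?thesis by simp
  qed
  have G_mid1: "(\<G> u v + \<G> u' v) / 2 \<le> \<G> ((u + u') / 2) v" for u u' v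
    using G_mid[of u v u' v] mid1 by simp
  have G_mid2: "(\<G> u v + \<G> u v') / 2 \<le> \<G> u ((v + v') / 2)" for u v v'
    using G_mid[of u v u v'] mid2 by simp
  define \<alpha> where "\<alpha> = \<G> 1 0"
  have G_hom: "X * \<alpha> \<le> \<G> X 0" if X: "0 < X" for X
  proof -
    have "\<alpha> \<le> \<G> X 0 / X"
      unfolding \<alpha>_def
    proof (rule G_le)
      fix R :: real assume R: "0 < R + 1" "0 < R + 0"
      have "X * (B R 1 0 - R * \<beta>) = B (X * R) (X * 1) (X * 0) - (X * R) * \<beta>"
        using homog[of X R 1 0] X R by (simp add: algebra_simps)
      also have "\<dots> \<le> \<G> (X * 1) (X * 0)"
        using X R by (intro G_ge) (auto intro!: add_pos_pos)
      finally show "B R 1 0 - R * \<beta> \<le> \<G> X 0 / X" using X by (simp add: field_simps)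
    qed
    then show ?thesis using X by (simp add: field_simps)
  qed
  have b0: "0 \<le> \<beta>" using pos[of 1 0 0] by (simp add: \<beta>_def)
  have G11: "1 + \<beta> \<le> \<G> 1 1"
  proof (rule field_le_epsilon)
    fix e :: real assume e: "0 < e"
    define d where "d = e / (\<beta> + 1)"
    have d: "0 < d" "d * \<beta> \<le> e" using e b0 by (auto simp: d_def field_simps)
    have "1 \<le> B (d - 1) 1 1" using lower[of "d - 1" 1 1] d by simp
    moreover have "B (d - 1) 1 1 - (d - 1) * \<beta> \<le> \<G> 1 1" using d by (intro G_ge) auto
    ultimately show "1 + \<beta> \<le> \<G> 1 1 + e" using d by (simp add: algebra_simps)
  qed
  have Gm: "1 - \<beta> \<le> \<G> (-1) (-1)"
  proof (rule field_le_epsilon)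
    fix e :: real assume e: "0 < e"
    define d where "d = e / (\<beta> + 1)"
    have d: "0 < d" "d * \<beta> \<le> e" using e b0 by (auto simp: d_def field_simps)
    have "1 \<le> B (d + 1) (-1) (-1)" using lower[of "d + 1" "-1" "-1"] d by simp
    moreover have "B (d + 1) (-1) (-1) - (d + 1) * \<beta> \<le> \<G> (-1) (-1)" using d by (intro G_ge) auto
    ultimately show "1 - \<beta> \<le> \<G> (-1) (-1) + e" using d by (simp add: algebra_simps)
  qed
  \<comment> \<open>Growth in the first variable at \<open>v = - 1\<close>, from the chord between \<open>v = 0\<close> and \<open>v = - (2 ^ n)\<close>.\<close>
  have far: "(1 - 1 / 2 ^ n) * ((2 - 1 / 2 ^ n) * \<alpha>) - (1 + 1 / 2 ^ n) * (1 / 2 ^ n) * \<beta> \<le> 1 / 2 ^ n * \<G> (2 * 2 ^ n - 1) (-1)" for n :: nat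
  proof -
    let ?X = "2 * 2 ^ n - 1 :: real"
    define r :: real where "r = 1 / 2 ^ n"
    have r: "0 < r" "r \<le> 1" "r * ?X = 2 - r" "r * (2 ^ n + 1) = 1 + r" by (simp_all add: r_def field_simps)
    have X: "0 < ?X" using one_le_power[of "2::real" n] by linarith
    have "(1 - r) * \<G> ?X (- 0) + r * \<G> ?X (- (2 ^ n)) \<le> \<G> ?X (- (r * 2 ^ n))"
      unfolding r_def
      by (rule dyadic_midpoint_concave[of _ "\<lambda>s. \<G> ?X (- s)"]) (use G_mid2[of ?X 0 "- s" for s] in auto)
    then have 1: "(1 - r) * \<G> ?X 0 + r * \<G> ?X (- (2 ^ n)) \<le> \<G> ?X (- 1)" by (simp add: r_def)
    have 2: "(1 - r) * (?X * \<alpha>) \<le> (1 - r) * \<G> ?X 0"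
      using r G_hom[OF X] by (intro mult_left_mono) auto
    have 3: "- ((1 + r) * \<beta>) \<le> r * \<G> ?X (- (2 ^ n))"
    proof -
      have "B (2 ^ n + 1) ?X (- (2 ^ n)) - (2 ^ n + 1) * \<beta> \<le> \<G> ?X (- (2 ^ n))"
        using X by (intro G_ge) (auto intro: add_pos_pos)
      moreover have "0 \<le> B (2 ^ n + 1) ?X (- (2 ^ n))" using X by (intro pos) auto
      ultimately have "- ((2 ^ n + 1) * \<beta>) \<le> \<G> ?X (- (2 ^ n))" by linarith
      then have "r * (- ((2 ^ n + 1) * \<beta>)) \<le> r * \<G> ?X (- (2 ^ n))" using r by (intro mult_left_mono) auto
      then show ?thesis using r(4) by (metis mult.assoc mult_minus_right)
    qed
    have "r * ((1 - r) * (?X * \<alpha>) - (1 + r) * \<beta>) \<le> r * \<G> ?X (-1)"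
      using 1 2 3 r by (intro mult_left_mono) auto
    moreover have "r * ((1 - r) * (?X * \<alpha>) - (1 + r) * \<beta>) = (1 - r) * ((r * ?X) * \<alpha>) - (1 + r) * r * \<beta>"
      by (simp add: algebra_simps)
    ultimately show ?thesis unfolding r(3) by (fold r_def) simp
  qed
  have "\<G> (-1) (-1) + 2 * \<alpha> \<le> \<G> 1 (-1)"
  proof -
    have "(1 - 1 / 2 ^ n) * \<G> (-1) (-1) + ((1 - 1 / 2 ^ n) * ((2 - 1 / 2 ^ n) * \<alpha>) - (1 + 1 / 2 ^ n) * (1 / 2 ^ n) * \<beta>) \<le> \<G> 1 (-1)" for n :: nat
    proof -
      have m: "(\<G> (0 - 1) (-1) + \<G> (s - 1) (-1)) / 2 \<le> \<G> (s / 2 - 1) (-1)" for s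
      proof -
        have "(- 1 + (s - 1)) / 2 = s / 2 - 1" by (simp add: field_simps)
        then show ?thesis using G_mid1[of "-1" "-1" "s - 1"] unfolding \<open>(- 1 + (s - 1)) / 2 = s / 2 - 1\<close> by simp
      qed
      have "(1 - 1 / 2 ^ n) * \<G> (0 - 1) (-1) + 1 / 2 ^ n * \<G> (2 * 2 ^ n - 1) (-1) \<le> \<G> (1 / 2 ^ n * (2 * 2 ^ n) - 1) (-1)"
        by (rule dyadic_midpoint_concave[of _ "\<lambda>s. \<G> (s - 1) (-1)"]) (use m in auto)
      then show ?thesis using far[of n] by simp
    qed
    moreover have "(\<lambda>n. (1 - 1 / 2 ^ n) * \<G> (-1) (-1) + ((1 - 1 / 2 ^ n) * ((2 - 1 / 2 ^ n) * \<alpha>) - (1 + 1 / 2 ^ n) * (1 / 2 ^ n) * \<beta>))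
      \<longlonglongrightarrow> (1 - 0) * \<G> (-1) (-1) + ((1 - 0) * ((2 - 0) * \<alpha>) - (1 + 0) * 0 * \<beta>)"
      by (intro tendsto_intros p2lim)
    ultimately have "(1 - 0) * \<G> (-1) (-1) + ((1 - 0) * ((2 - 0) * \<alpha>) - (1 + 0) * 0 * \<beta>) \<le> \<G> 1 (-1)"
      by (intro LIMSEQ_le_const2) auto
    then show ?thesis by simp
  qed
  moreover have "(\<G> 1 1 + \<G> 1 (-1)) / 2 \<le> \<alpha>"
    using G_mid2[of 1 1 "-1"] by (simp add: \<alpha>_def)
  ultimately show False using G11 Gm by simp
qed

section \<open>Averages against slowly varying weights\<close>

lemma lborel_integral_translation:
  fixes f :: "'a::euclidean_space \<Rightarrow> real"
  shows "(LBINT x. f (x + c)) = (LBINT x. f x)"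
proof (cases "f \<in> borel_measurable borel")
  case True
  have "(LBINT x. f x) = (\<integral>x. f x \<partial>distr lborel borel ((+) c))" by (simp add: lborel_distr_plus)
  also have "\<dots> = (LBINT x. f (c + x))" using True by (intro integral_distr) auto
  finally show ?thesis by (simp add: add.commute)
next
  case False
  have "(\<lambda>x. f (x + c)) \<notin> borel_measurable borel"
  proof
    assume "(\<lambda>x. f (x + c)) \<in> borel_measurable borel"
    then have "(\<lambda>x. f ((x - c) + c)) \<in> borel_measurable borel" by measurable
    with False show False by simp
  qed
  then have "\<not> integrable lborel (\<lambda>x. f (x + c))" "\<not> integrable lborel f"
    using False borel_measurable_integrable[of lborel f] borel_measurable_integrable[of lborel "\<lambda>x. f (x + c)"] by auto
  then show ?thesis by (simp add: not_integrable_integral_eq)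
qed

lemma lborel_integrable_translation:
  fixes f :: "'a::euclidean_space \<Rightarrow> real"
  assumes "integrable lborel f"
  shows "integrable lborel (\<lambda>x. f (x + c))"
proof -
  have "integrable (distr lborel borel ((+) c)) f" using assms by (simp add: lborel_distr_plus)
  then have "integrable lborel (\<lambda>x. f (c + x))" using assms by (subst (asm) integrable_distr_eq) auto
  then show ?thesis by (simp add: add.commute)
qed

lemma lborel_scaleR:
  fixes f :: "'a::euclidean_space \<Rightarrow> real"
  assumes "c \<noteq> 0" and f: "f \<in> borel_measurable borel"
  shows "(LBINT x. f x) = \<bar>c\<bar> ^ DIM('a) * (LBINT x. f (c *\<^sub>R x))"
    and "integrable lborel f \<longleftrightarrow> integrable lborel (\<lambda>x. f (c *\<^sub>R x))"
proof -
  have eq: "lborel = density (distr lborel borel (\<lambda>x :: 'a. c *\<^sub>R x)) (\<lambda>_. \<bar>c\<bar> ^ DIM('a))"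
    using lborel_affine[OF assms(1), of "0::'a"] by simp
  have "(LBINT x. f x) = (\<integral>x. f x \<partial>density (distr lborel borel (\<lambda>x :: 'a. c *\<^sub>R x)) (\<lambda>_. \<bar>c\<bar> ^ DIM('a)))"
    by (subst eq) simp
  also have "\<dots> = (\<integral>x. \<bar>c\<bar> ^ DIM('a) * f x \<partial>distr lborel borel (\<lambda>x :: 'a. c *\<^sub>R x))"
    using f by (subst integral_density) (auto simp: ennreal_power[symmetric])
  also have "\<dots> = (LBINT x. \<bar>c\<bar> ^ DIM('a) * f (c *\<^sub>R x))"
    using f by (intro integral_distr) auto
  finally show "(LBINT x. f x) = \<bar>c\<bar> ^ DIM('a) * (LBINT x. f (c *\<^sub>R x))" by simp
  have "integrable lborel f \<longleftrightarrow> integrable (density (distr lborel borel (\<lambda>x :: 'a. c *\<^sub>R x)) (\<lambda>_. \<bar>c\<bar> ^ DIM('a))) f"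
    by (subst eq) simp
  also have "\<dots> \<longleftrightarrow> integrable (distr lborel borel (\<lambda>x :: 'a. c *\<^sub>R x)) (\<lambda>x. \<bar>c\<bar> ^ DIM('a) * f x)"
    using f by (subst integrable_density) (auto simp: ennreal_power[symmetric])
  also have "\<dots> \<longleftrightarrow> integrable lborel (\<lambda>x. \<bar>c\<bar> ^ DIM('a) * f (c *\<^sub>R x))"
    using f by (intro integrable_distr_eq) auto
  finally show "integrable lborel f \<longleftrightarrow> integrable lborel (\<lambda>x. f (c *\<^sub>R x))" using assms(1) by simp
qed

lemma integrable_mult_bounded_continuous:
  fixes \<psi> G :: "'a::euclidean_space \<Rightarrow> real"
  assumes "integrable lborel \<psi>" "continuous_on UNIV G" "\<And>x. \<bar>G x\<bar> \<le> C"
  shows "integrable lborel (\<lambda>x. \<psi> x * G x)"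
proof (rule Bochner_Integration.integrable_bound)
  show "integrable lborel (\<lambda>x. C * \<bar>\<psi> x\<bar>)" using assms(1) by auto
  show "(\<lambda>x. \<psi> x * G x) \<in> borel_measurable lborel"
    using assms borel_measurable_continuous_onI[of G] by measurable
  show "AE x in lborel. norm (\<psi> x * G x) \<le> norm (C * \<bar>\<psi> x\<bar>)"
  proof (rule AE_I2)
    fix x
    have "\<bar>\<psi> x\<bar> * \<bar>G x\<bar> \<le> \<bar>\<psi> x\<bar> * \<bar>C\<bar>" using assms(3)[of x] by (intro mult_left_mono) auto
    then show "norm (\<psi> x * G x) \<le> norm (C * \<bar>\<psi> x\<bar>)" by (simp add: abs_mult mult.commute)
  qed
qed

text \<open>
  The function $D$ bounds the decrease of $\psi$ near each point: a one-sided Lipschitz bound with an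
  integrable constant depending on the point. It survives rescaling and multiplication by
  Lipschitz functions with values in $[0,1]$, with explicit control of $\int D$.
\<close>

definition weight :: "('a::euclidean_space \<Rightarrow> real) \<Rightarrow> ('a \<Rightarrow> real) \<Rightarrow> bool" where
  "weight \<psi> D \<longleftrightarrow> integrable lborel \<psi> \<and> integrable lborel D \<and> (\<forall>x. 0 \<le> \<psi> x) \<and> (\<forall>x. 0 \<le> D x) \<and>
     (\<forall>x y. \<psi> x - norm y * D x \<le> \<psi> (x + y))"

text \<open>
  This expresses that the mean of $G$ over large sets is at least $m$. Replacing $G(x)$ by $G(M x)$ divides
  $r$ by $M$ (\<open>mean_ge_scaleR_arg\<close>), so in the limit of fine scales the weak limit of $G(M x)$ is
  at least $m$. Stating the bound for all weights at once avoids periodicity and limits.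
\<close>

definition mean_ge :: "real \<Rightarrow> ('a::euclidean_space \<Rightarrow> real) \<Rightarrow> real \<Rightarrow> bool" where
  "mean_ge r G m \<longleftrightarrow> 0 \<le> r \<and>
     (\<forall>\<psi> D. weight \<psi> D \<longrightarrow> m * (LBINT x. \<psi> x) - r * (LBINT x. D x) \<le> (LBINT x. \<psi> x * G x))"

lemma weightD:
  assumes "weight \<psi> D"
  shows "integrable lborel \<psi>" "integrable lborel D" "0 \<le> \<psi> x" "0 \<le> D x" "\<psi> x - norm y * D x \<le> \<psi> (x + y)"
  using assms by (auto simp: weight_def)

lemma weight_integral_nonneg:
  "weight \<psi> D \<Longrightarrow> 0 \<le> (LBINT x. \<psi> x)" "weight \<psi> D \<Longrightarrow> 0 \<le> (LBINT x. D x)"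
  by (auto simp: weight_def)

lemma mean_geD:
  "mean_ge r G m \<Longrightarrow> weight \<psi> D \<Longrightarrow>
    m * (LBINT x. \<psi> x) - r * (LBINT x. D x) \<le> (LBINT x. \<psi> x * G x)"
  by (auto simp: mean_ge_def)

lemma mean_ge_const: "mean_ge 0 (\<lambda>x. m) m"
  by (simp add: mean_ge_def)

lemma mean_ge_mono:
  assumes "mean_ge r G m" "m' \<le> m" "r \<le> r'"
    "continuous_on UNIV G" "\<And>x. \<bar>G x\<bar> \<le> C" "continuous_on UNIV G'" "\<And>x. \<bar>G' x\<bar> \<le> C'" "\<And>x. G x \<le> G' x"
  shows "mean_ge r' G' m'"
  unfolding mean_ge_def
proof (intro conjI allI impI)
  show "0 \<le> r'" using assms(1,3) by (simp add: mean_ge_def)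
  fix \<psi> D :: "'a \<Rightarrow> real" assume w: "weight \<psi> D"
  have "m' * (LBINT x. \<psi> x) - r' * (LBINT x. D x) \<le> m * (LBINT x. \<psi> x) - r * (LBINT x. D x)"
    using assms(2,3) weight_integral_nonneg[OF w] by (intro diff_mono mult_right_mono) auto
  also have "\<dots> \<le> (LBINT x. \<psi> x * G x)" by (rule mean_geD[OF assms(1) w])
  also have "\<dots> \<le> (LBINT x. \<psi> x * G' x)"
    by (intro integral_mono mult_left_mono integrable_mult_bounded_continuous[where C=C] integrable_mult_bounded_continuous[where C=C'])
       (use weightD[OF w] assms in auto)
  finally show "m' * (LBINT x. \<psi> x) - r' * (LBINT x. D x) \<le> (LBINT x. \<psi> x * G' x)" .
qed

lemma mean_ge_cmult: "mean_ge r G m \<Longrightarrow> 0 \<le> t \<Longrightarrow> mean_ge (t * r) (\<lambda>x. t * G x) (t * m)"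
  unfolding mean_ge_def
proof (intro conjI allI impI; (elim conjE)?)
  fix \<psi> D :: "'a \<Rightarrow> real"
  assume t: "0 \<le> t" and w: "weight \<psi> D" and
    *: "\<forall>\<psi> D. weight \<psi> D \<longrightarrow> m * (LBINT x. \<psi> x) - r * (LBINT x. D x) \<le> (LBINT x. \<psi> x * G x)"
  have "t * (m * (LBINT x. \<psi> x) - r * (LBINT x. D x)) \<le> t * (LBINT x. \<psi> x * G x)"
    using * w t by (intro mult_left_mono) auto
  also have "\<dots> = (LBINT x. \<psi> x * (t * G x))"
    by (subst integral_mult_right_zero[symmetric]) (simp add: mult_ac)
  finally show "t * m * (LBINT x. \<psi> x) - t * r * (LBINT x. D x) \<le> (LBINT x. \<psi> x * (t * G x))"
    by (simp add: algebra_simps)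
qed simp

lemma mean_ge_affine:
  assumes "mean_ge r G m" "0 \<le> t" "continuous_on UNIV G" "\<And>x. \<bar>G x\<bar> \<le> C"
  shows "mean_ge (t * r) (\<lambda>x. a + t * G x) (a + t * m)"
  unfolding mean_ge_def
proof (intro conjI allI impI)
  fix \<psi> D :: "'a \<Rightarrow> real"
  assume w: "weight \<psi> D"
  have "integrable lborel (\<lambda>x. \<psi> x * (t * G x))"
  proof (rule integrable_mult_bounded_continuous[OF weightD(1)[OF w], where C="t * C"])
    show "\<bar>t * G x\<bar> \<le> t * C" for x
      using mult_left_mono[OF assms(4)[of x] assms(2)] assms(2) by (simp add: abs_mult)
  qed (intro continuous_intros assms)
  then have "(LBINT x. \<psi> x * (a + t * G x)) = a * (LBINT x. \<psi> x) + (LBINT x. \<psi> x * (t * G x))"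
    using w by (simp add: weight_def distrib_left mult.commute[of _ a])
  then show "(a + t * m) * (LBINT x. \<psi> x) - t * r * (LBINT x. D x) \<le> (LBINT x. \<psi> x * (a + t * G x))"
    using mean_geD[OF mean_ge_cmult[OF assms(1,2)] w] by (simp add: algebra_simps)
qed (use assms in \<open>simp add: mean_ge_def\<close>)

lemma mean_ge_scaleR_arg:
  fixes G :: "'a::euclidean_space \<Rightarrow> real"
  assumes "mean_ge r G m" "0 < M" "continuous_on UNIV G"
  shows "mean_ge (r / M) (\<lambda>x. G (M *\<^sub>R x)) m"
  unfolding mean_ge_def
proof (intro conjI allI impI)
  show "0 \<le> r / M" using assms by (simp add: mean_ge_def)
  fix \<psi> D :: "'a \<Rightarrow> real" assume w: "weight \<psi> D"
  define n where "n = DIM('a)"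
  define \<psi>' where "\<psi>' = (\<lambda>x. \<psi> ((1 / M) *\<^sub>R x))"
  define D' where "D' = (\<lambda>x. D ((1 / M) *\<^sub>R x) / M)"
  have m[measurable]: "\<psi> \<in> borel_measurable borel" "D \<in> borel_measurable borel" "G \<in> borel_measurable borel"
    using w assms(3) by (auto simp: weight_def borel_measurable_continuous_onI dest: borel_measurable_integrable)
  have "weight \<psi>' D'"
    unfolding weight_def
  proof (intro conjI allI)
    show "integrable lborel \<psi>'" "integrable lborel D'"
      using w lborel_scaleR(2)[of "1/M" \<psi>] lborel_scaleR(2)[of "1/M" D] assms(2)
      by (auto simp: weight_def \<psi>'_def D'_def)
    show "0 \<le> \<psi>' x" "0 \<le> D' x" for x using w assms(2) by (auto simp: weight_def \<psi>'_def D'_def)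
    show "\<psi>' x - norm y * D' x \<le> \<psi>' (x + y)" for x y
    proof -
      have "\<psi> ((1 / M) *\<^sub>R x) - norm ((1 / M) *\<^sub>R y) * D ((1 / M) *\<^sub>R x) \<le> \<psi> ((1 / M) *\<^sub>R x + (1 / M) *\<^sub>R y)"
        by (rule weightD(5)[OF w])
      then show ?thesis using assms(2) by (simp add: \<psi>'_def D'_def scaleR_add_right)
    qed
  qed
  from mean_geD[OF assms(1) this]
  have "m * (LBINT x. \<psi>' x) - r * (LBINT x. D' x) \<le> (LBINT x. \<psi>' x * G x)" .
  moreover have "(LBINT x. \<psi>' x) = M ^ n * (LBINT x. \<psi> x)"
    using lborel_scaleR(1)[of M \<psi>'] assms(2) by (simp add: \<psi>'_def n_def)
  moreover have "(LBINT x. D' x) = M ^ n * ((LBINT x. D x) / M)"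
    using lborel_scaleR(1)[of M D'] assms(2) by (simp add: D'_def n_def)
  moreover have "(LBINT x. \<psi>' x * G x) = M ^ n * (LBINT x. \<psi> x * G (M *\<^sub>R x))"
    using lborel_scaleR(1)[of M "\<lambda>x. \<psi>' x * G x"] assms(2) by (simp add: \<psi>'_def n_def)
  ultimately have "M ^ n * (m * (LBINT x. \<psi> x) - r / M * (LBINT x. D x)) \<le> M ^ n * (LBINT x. \<psi> x * G (M *\<^sub>R x))"
    by (simp add: algebra_simps)
  then show "m * (LBINT x. \<psi> x) - r / M * (LBINT x. D x) \<le> (LBINT x. \<psi> x * G (M *\<^sub>R x))"
    using assms(2) by simp
qed

text \<open>
  Translating by $s$ changes the integral against a weight by at most $|s| \int D$; only one of the two
  averaged terms is translated, whence $|s|/2$.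
\<close>

lemma mean_ge_average_shift:
  fixes u :: "real \<Rightarrow> real" and b :: "'a::euclidean_space"
  assumes u: "continuous_on UNIV u" "\<And>s. 0 \<le> u s" "\<And>s. u s \<le> 1" and b: "norm b = 1"
    and *: "mean_ge r (\<lambda>x. (u (x \<bullet> b) + u (x \<bullet> b + s)) / 2) m"
  shows "mean_ge (r + \<bar>s\<bar> / 2) (\<lambda>x. u (x \<bullet> b)) m"
  unfolding mean_ge_def
proof (intro conjI allI impI)
  show "0 \<le> r + \<bar>s\<bar> / 2" using * by (simp add: mean_ge_def)
  fix \<psi> D :: "'a \<Rightarrow> real" assume w: "weight \<psi> D"
  let ?v = "\<lambda>x. u (x \<bullet> b)" and ?v' = "\<lambda>x. u (x \<bullet> b + s)"
  have cont: "continuous_on UNIV ?v" "continuous_on UNIV ?v'"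
    by (auto intro!: continuous_on_compose2[OF u(1)] continuous_intros)
  have bd: "\<bar>?v x\<bar> \<le> 1" "\<bar>?v' x\<bar> \<le> 1" for x using u by auto
  have i: "integrable lborel (\<lambda>x. \<psi> x * ?v x)" "integrable lborel (\<lambda>x. \<psi> x * ?v' x)" "integrable lborel D"
    by (rule integrable_mult_bounded_continuous[where C=1, OF weightD(1)[OF w]] weightD(2)[OF w] cont bd)+
  have shift: "(x + s *\<^sub>R b) \<bullet> b = x \<bullet> b + s" for x
    using b by (simp add: inner_add_left norm_eq_1)
  have "(LBINT x. \<psi> x * ?v' x) - \<bar>s\<bar> * (LBINT x. D x) = (LBINT x. \<psi> x * ?v' x - \<bar>s\<bar> * D x)"
    using i by simp
  also have "\<dots> \<le> (LBINT x. \<psi> (x + s *\<^sub>R b) * ?v' x)"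
  proof (rule integral_mono)
    show "integrable lborel (\<lambda>x. \<psi> (x + s *\<^sub>R b) * ?v' x)"
      by (rule integrable_mult_bounded_continuous[where C=1, OF lborel_integrable_translation[OF weightD(1)[OF w]]] cont bd)+
    fix x
    have "\<psi> x - \<bar>s\<bar> * D x \<le> \<psi> (x + s *\<^sub>R b)" using weightD(5)[OF w, of x "s *\<^sub>R b"] b by simp
    then have "(\<psi> x - \<bar>s\<bar> * D x) * ?v' x \<le> \<psi> (x + s *\<^sub>R b) * ?v' x" using u by (intro mult_right_mono) auto
    moreover have "\<bar>s\<bar> * D x * ?v' x \<le> \<bar>s\<bar> * D x * 1" using u weightD(4)[OF w] by (intro mult_left_mono) auto
    ultimately show "\<psi> x * ?v' x - \<bar>s\<bar> * D x \<le> \<psi> (x + s *\<^sub>R b) * ?v' x" by (simp add: algebra_simps)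
  qed (use i in auto)
  also have "\<dots> = (LBINT x. \<psi> x * ?v x)"
    using lborel_integral_translation[of "\<lambda>x. \<psi> x * ?v x" "s *\<^sub>R b"] by (simp add: shift)
  finally have 1: "(LBINT x. \<psi> x * ?v' x) - \<bar>s\<bar> * (LBINT x. D x) \<le> (LBINT x. \<psi> x * ?v x)" .
  have eq: "(LBINT x. \<psi> x * ((?v x + ?v' x) / 2)) = ((LBINT x. \<psi> x * ?v x) + (LBINT x. \<psi> x * ?v' x)) / 2"
  proof -
    have "(LBINT x. \<psi> x * ((?v x + ?v' x) / 2)) = (LBINT x. (\<psi> x * ?v x + \<psi> x * ?v' x) / 2)"
      by (intro Bochner_Integration.integral_cong refl) (simp add: distrib_left)
    also have "\<dots> = (LBINT x. \<psi> x * ?v x + \<psi> x * ?v' x) / 2" by (rule integral_divide_zero)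
    also have "(LBINT x. \<psi> x * ?v x + \<psi> x * ?v' x) = (LBINT x. \<psi> x * ?v x) + (LBINT x. \<psi> x * ?v' x)"
      by (rule Bochner_Integration.integral_add[OF i(1,2)])
    finally show ?thesis .
  qed
  have 2: "m * (LBINT x. \<psi> x) - r * (LBINT x. D x)
    \<le> ((LBINT x. \<psi> x * ?v x) + (LBINT x. \<psi> x * ?v' x)) / 2"
    using mean_geD[OF * w] unfolding eq .
  have half: "M - c / 2 \<le> I" if "M \<le> (I + J) / 2" "J - c \<le> I" for M I J c :: real
    using that by (simp add: field_simps)
  show "m * (LBINT x. \<psi> x) - (r + \<bar>s\<bar> / 2) * (LBINT x. D x) \<le> (LBINT x. \<psi> x * ?v x)"
    using half[OF 2 1] unfolding distrib_right by (simp only: diff_diff_eq times_divide_eq_left)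
qed

text \<open>
  This is what allows averages to be taken inside the layers of a laminate: the cut-off between layers is absorbed in the weight.
\<close>

lemma weight_mult:
  fixes u :: "'a::euclidean_space \<Rightarrow> real"
  assumes w: "weight \<psi> D" and u: "continuous_on UNIV u" "\<And>x. 0 \<le> u x" "\<And>x. u x \<le> 1"
    "\<And>x y. \<bar>u x - u y\<bar> \<le> N * norm (x - y)" and "0 \<le> N"
  shows "weight (\<lambda>x. \<psi> x * u x) (\<lambda>x. D x + N * \<psi> x)"
  unfolding weight_def
proof (intro conjI allI)
  show "integrable lborel (\<lambda>x. \<psi> x * u x)"
    by (rule integrable_mult_bounded_continuous[where C=1, OF weightD(1)[OF w] u(1)]) (use u in auto)
  show "integrable lborel (\<lambda>x. D x + N * \<psi> x)" using weightD[OF w] by auto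
  fix x
  show "0 \<le> \<psi> x * u x" "0 \<le> D x + N * \<psi> x" using weightD[OF w] u \<open>0 \<le> N\<close> by auto
  fix y
  note a = weightD(3)[OF w, of "x + y"] weightD(3,4)[OF w, of x] weightD(5)[OF w, of x y]
  have b: "0 \<le> u (x + y)" "u x - norm y * N \<le> u (x + y)" using u(2)[of "x+y"] u(4)[of x "x + y"] by (auto simp: mult.commute)
  have y: "0 \<le> norm y * D x" "0 \<le> norm y * N" using a \<open>0 \<le> N\<close> by auto
  have "\<psi> x * u x - (norm y * D x + (norm y * N) * \<psi> x) \<le> \<psi> (x + y) * u (x + y)"
  proof -
    have "\<psi> x * u x - \<psi> x * (norm y * N) \<le> \<psi> x * u (x + y)"
      using mult_left_mono[OF b(2) a(2)] by (simp add: right_diff_distrib)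
    moreover have "(\<psi> x - norm y * D x) * u (x + y) \<le> \<psi> (x + y) * u (x + y)" by (rule mult_right_mono[OF a(4) b(1)])
    moreover have "norm y * D x * u (x + y) \<le> norm y * D x * 1" using y u(3) by (intro mult_left_mono) auto
    ultimately show ?thesis by (simp add: algebra_simps)
  qed
  then show "\<psi> x * u x - norm y * (D x + N * \<psi> x) \<le> \<psi> (x + y) * u (x + y)" by (simp add: algebra_simps)
qed

subsection \<open>A smooth and almost two-valued switch\<close>

text \<open>
  For $u_A(s) = (1 + A \sin^2 s)^{-1}$, averaging over a quarter turn reproduces a function of the
  same kind, with argument $2s$, parameter $A^2 / (4 (1 + A)) \ge A/6$ and a prefactor that is at most $2/3$ when $A \ge 2$.
\<close>

lemma inverse_one_plus_sin_doubling:
  fixes A s :: real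
  assumes "0 \<le> A"
  shows "(1 / (1 + A * (sin s)\<^sup>2) + 1 / (1 + A * (sin (s + pi / 2))\<^sup>2)) / 2
    = (2 + A) / (2 * (1 + A)) * (1 / (1 + A\<^sup>2 / (4 * (1 + A)) * (sin (2 * s))\<^sup>2))"
proof -
  define x where "x = (sin s)\<^sup>2"
  have x: "0 \<le> x" "x \<le> 1" by (auto simp: x_def abs_square_le_1)
  have c: "(cos s)\<^sup>2 = 1 - x" by (simp add: x_def cos_squared_eq)
  have c': "(sin (s + pi / 2))\<^sup>2 = 1 - x" using c by (simp add: sin_add)
  have d: "(sin (2 * s))\<^sup>2 = 4 * x * (1 - x)"
    unfolding sin_double power_mult_distrib c by (simp add: x_def)
  have pos: "0 < 1 + A * x" "0 < 1 + A * (1 - x)" "0 < 1 + A" using assms x by (auto intro: add_pos_nonneg)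
  have prod: "(1 + A * x) * (1 + A * (1 - x)) = 1 + A + A\<^sup>2 * x * (1 - x)"
    by (simp add: algebra_simps power2_eq_square)
  have "(1 / (1 + A * x) + 1 / (1 + A * (1 - x))) / 2 = (2 + A) / (2 * ((1 + A * x) * (1 + A * (1 - x))))"
    using pos by (simp add: field_simps)
  also have "\<dots> = (2 + A) / (2 * (1 + A)) * (1 / (1 + A\<^sup>2 / (4 * (1 + A)) * (4 * x * (1 - x))))"
  proof -
    have "(1 + A) * (1 + A\<^sup>2 / (4 * (1 + A)) * (4 * x * (1 - x))) = 1 + A + A\<^sup>2 * x * (1 - x)"
      using pos by (simp add: field_simps)
    then show ?thesis unfolding prod by (metis (no_types, opaque_lifting) mult.assoc mult.right_neutral times_divide_times_eq)
  qed
  finally show ?thesis unfolding c' d x_def[symmetric] .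
qed

text \<open>
  Iterating the doubling identity $k$ times shows that $u_A$ has mean at most $(2/3)^k$ when $A \ge 2 \cdot 6^k$. The
  frequency $q$ doubles at every step, so the shifts stay bounded and each step costs at most $\pi$.
\<close>

lemma mean_ge_inverse_one_plus_sin:
  fixes b :: "'a::euclidean_space"
  assumes "norm b = 1" "1 \<le> q" "2 * 6 ^ k \<le> A"
  shows "mean_ge (real k * pi) (\<lambda>x. 1 - 1 / (1 + A * (sin (q * (x \<bullet> b)))\<^sup>2)) (1 - (2/3) ^ k)"
  using assms(2,3)
proof (induction k arbitrary: A q)
  case (0 A q)
  define u where "u x = 1 + A * (sin (q * (x \<bullet> b)))\<^sup>2" for x
  have u: "1 \<le> u x" for x using 0 by (simp add: u_def)
  have u1: "0 \<le> 1 / u x" "1 / u x \<le> 1" for x using u[of x] by (auto simp: divide_simps)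
  have "continuous_on UNIV u" unfolding u_def by (intro continuous_intros)
  then have c: "continuous_on UNIV (\<lambda>x. 1 - 1 / u x)"
    using u by (intro continuous_intros) (auto, metis not_one_le_zero)
  have "mean_ge 0 (\<lambda>x. 1 - 1 / u x) 0"
  proof (rule mean_ge_mono[OF mean_ge_const[of 0], where C=0 and C'=1])
    show "\<bar>1 - 1 / u x\<bar> \<le> 1" for x using u1[of x] unfolding abs_le_iff by argo
    show "0 \<le> 1 - 1 / u x" for x using u1[of x] by argo
  qed (auto intro: c)
  then show ?case unfolding u_def by simp
next
  case (Suc k A q)
  define A' where "A' = A\<^sup>2 / (4 * (1 + A))"
  have A: "2 \<le> A" "2 * 6 ^ k \<le> A / 6"
    using Suc.prems(2) one_le_power[of "6::real" k] unfolding power_Suc by linarith+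
  have "A / 6 \<le> A'" unfolding A'_def using A(1) by (simp add: field_simps power2_eq_square)
  then have A': "2 * 6 ^ k \<le> A'" "0 \<le> A'" using A by linarith+
  have c: "(2 + A) / (2 * (1 + A)) \<le> 2 / 3" using A(1) by (simp add: field_simps)
  define F where "F = (\<lambda>B s. 1 / (1 + B * (sin s)\<^sup>2) :: real)"
  have pos: "1 \<le> 1 + B * (sin s)\<^sup>2" if "0 \<le> B" for B s :: real using that by simp
  have F: "0 \<le> F B s" "F B s \<le> 1" if "0 \<le> B" for B s using pos[OF that, of s] by (auto simp: F_def divide_simps)
  have Fc: "continuous_on UNIV (\<lambda>x. F B (a * (x \<bullet> b) + c))" if "0 \<le> B" for B a c
  proof -
    have "1 + B * (sin (a * (x \<bullet> b) + c))\<^sup>2 \<noteq> 0" for x using pos[OF that, of "a * (x \<bullet> b) + c"] by linarith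
    then show ?thesis unfolding F_def by (intro continuous_intros) auto
  qed
  have Fc0: "continuous_on UNIV (\<lambda>s. F A (q * s))"
  proof -
    have "1 + A * (sin (q * s))\<^sup>2 \<noteq> 0" for s using pos[of A "q * s"] A(1) by linarith
    then show ?thesis unfolding F_def by (intro continuous_intros) auto
  qed
  have IH: "mean_ge (real k * pi) (\<lambda>x. 1 - F A' (2 * q * (x \<bullet> b))) (1 - (2/3) ^ k)"
    unfolding F_def using Suc.IH[of "2 * q" A'] Suc.prems(1) A' by simp
  let ?u = "\<lambda>s. 1 - F A (q * s)"
  have "mean_ge (2/3 * (real k * pi)) (\<lambda>x. 1/3 + 2/3 * (1 - F A' (2 * q * (x \<bullet> b)))) (1/3 + 2/3 * (1 - (2/3) ^ k))"
  proof (rule mean_ge_affine[OF IH, where C=1])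
    show "continuous_on UNIV (\<lambda>x. 1 - F A' (2 * q * (x \<bullet> b)))"
      using Fc[OF A'(2), of "2 * q" 0] by (auto intro!: continuous_on_diff)
    show "\<bar>1 - F A' (2 * q * (x \<bullet> b))\<bar> \<le> 1" for x
      using F[OF A'(2), of "2 * q * (x \<bullet> b)"] by (simp add: abs_le_iff)
  qed simp
  then have "mean_ge (real k * pi) (\<lambda>x. (?u (x \<bullet> b) + ?u (x \<bullet> b + pi / (2 * q))) / 2) (1 - (2/3) ^ Suc k)"
  proof (rule mean_ge_mono[where C=1 and C'=1])
    fix x
    have e: "q * (x \<bullet> b + pi / (2 * q)) = q * (x \<bullet> b) + pi / 2" using Suc.prems(1) by (simp add: field_simps)
    have "(F A (q * (x \<bullet> b)) + F A (q * (x \<bullet> b) + pi / 2)) / 2 = (2 + A) / (2 * (1 + A)) * F A' (2 * (q * (x \<bullet> b)))"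
      unfolding F_def A'_def using A(1) by (intro inverse_one_plus_sin_doubling) simp
    also have "\<dots> \<le> 2/3 * F A' (2 * (q * (x \<bullet> b)))" by (rule mult_right_mono[OF c F(1)[OF A'(2)]])
    finally show "1/3 + 2/3 * (1 - F A' (2 * q * (x \<bullet> b))) \<le> (?u (x \<bullet> b) + ?u (x \<bullet> b + pi / (2 * q))) / 2"
      unfolding e mult.assoc by argo
  next
    fix x
    show "\<bar>1/3 + 2/3 * (1 - F A' (2 * q * (x \<bullet> b)))\<bar> \<le> 1"
      using F[OF A'(2), of "2 * q * (x \<bullet> b)"] unfolding abs_le_iff by argo
    show "\<bar>(?u (x \<bullet> b) + ?u (x \<bullet> b + pi / (2 * q))) / 2\<bar> \<le> 1"
      using F[of A "q * (x \<bullet> b)"] F[of A "q * (x \<bullet> b + pi / (2 * q))"] A(1) unfolding abs_le_iff by argo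
  next
    show "continuous_on UNIV (\<lambda>x. 1/3 + 2/3 * (1 - F A' (2 * q * (x \<bullet> b))))"
      using Fc[OF A'(2), of "2 * q" 0] by (auto intro!: continuous_intros)
    show "continuous_on UNIV (\<lambda>x. (?u (x \<bullet> b) + ?u (x \<bullet> b + pi / (2 * q))) / 2)"
      using Fc[of A q 0] Fc[of A q "q * (pi / (2 * q))"] A(1)
      by (intro continuous_intros) (simp_all add: distrib_left)
  qed (simp_all add: algebra_simps)
  then have "mean_ge (real k * pi + \<bar>pi / (2 * q)\<bar> / 2) (\<lambda>x. ?u (x \<bullet> b)) (1 - (2/3) ^ Suc k)"
    using F[of A] A(1) assms(1) Fc0 by (intro mean_ge_average_shift continuous_intros) auto
  then have "mean_ge (real (Suc k) * pi) (\<lambda>x. ?u (x \<bullet> b)) (1 - (2/3) ^ Suc k)"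
  proof (rule mean_ge_mono[where C=1 and C'=1])
    have "pi / (4 * q) \<le> pi / 1" using Suc.prems(1) by (intro divide_left_mono) auto
    then show "real k * pi + \<bar>pi / (2 * q)\<bar> / 2 \<le> real (Suc k) * pi"
      using Suc.prems(1) by (simp add: distrib_right)
    show "continuous_on UNIV (\<lambda>x. ?u (x \<bullet> b))" "continuous_on UNIV (\<lambda>x. ?u (x \<bullet> b))"
      using Fc[of A q 0] A(1) by (auto intro!: continuous_on_diff)
    show "\<bar>?u (x \<bullet> b)\<bar> \<le> 1" "\<bar>?u (x \<bullet> b)\<bar> \<le> 1" for x
      using F[of A "q * (x \<bullet> b)"] A(1) by (auto simp: abs_le_iff)
  qed auto
  then show ?case by (simp add: F_def)
qed

text \<open>
  The left side is $1 / \cosh^2 (z/2)$; comparing it with a rational function of $z$ makes it accessible to the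
  doubling argument when $z = N \sin s$.
\<close>

lemma logistic_variance_le: "4 * logistic z * (1 - logistic z) \<le> 1 / (1 + z\<^sup>2 / 8)"
proof -
  have "2 + z\<^sup>2 / 2 \<le> exp \<bar>z\<bar> + exp (- \<bar>z\<bar>)"
    using exp_lower_Taylor_quadratic[of "\<bar>z\<bar>"] exp_ge_add_one_self[of "- \<bar>z\<bar>"] by simp
  then have *: "2 + z\<^sup>2 / 2 \<le> exp z + exp (- z)" by (cases "0 \<le> z") auto
  have nz: "0 < 1 + exp (- z)" "0 < 1 + exp z" by (auto intro: add_pos_pos)
  have "4 * logistic z * (1 - logistic z) = 4 / ((1 + exp (- z)) * (1 + exp z))"
    unfolding logistic_minus[symmetric] by (simp add: logistic_def)
  also have "(1 + exp (- z)) * (1 + exp z) = 2 + exp z + exp (- z)"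
    by (simp add: algebra_simps flip: exp_add)
  also have "4 / (2 + exp z + exp (- z)) \<le> 4 / (4 + z\<^sup>2 / 2)"
  proof (rule divide_left_mono)
    have "0 < 4 + z\<^sup>2 / 2" by (intro add_pos_nonneg) auto
    then show "0 < (2 + exp z + exp (- z)) * (4 + z\<^sup>2 / 2)" using * by (intro mult_pos_pos) linarith+
  qed (use * in auto)
  also have "4 + z\<^sup>2 / 2 = 4 * (1 + z\<^sup>2 / 8)" by simp
  also have "4 / (4 * (1 + z\<^sup>2 / 8)) = 1 / (1 + z\<^sup>2 / 8)" by (rule nonzero_divide_mult_cancel_left) simp
  finally show ?thesis .
qed

text \<open>
  For large $N$ this is close to the indicator function of $\sin s > 0$; the symmetry
  \<open>switch_plus_pi\<close> gives it mean exactly $1/2$ for every $N$.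
\<close>

definition switch :: "real \<Rightarrow> real \<Rightarrow> real" where
  "switch N s = logistic (N * sin s)"

lemma switch_bounds: "0 < switch N s" "switch N s < 1"
  by (simp_all add: switch_def logistic_bounds)

lemma switch_plus_pi: "switch N (s + pi) = 1 - switch N s"
  by (simp add: switch_def flip: logistic_minus)

lemma smooth_switch: "smooth (switch N)"
  unfolding switch_def[abs_def]
  by (intro smooth_compose_real[OF smooth_logistic] smooth_mult smooth_const smooth_sin_cos)

lemma DERIV_switch:
  "(switch N has_real_derivative N * cos s * (switch N s * (1 - switch N s))) (at s)"
  unfolding switch_def[abs_def]
  by (rule DERIV_cong[OF DERIV_chain2[OF DERIV_logistic]]) (auto intro!: derivative_eq_intros)

lemma switch_Lipschitz: "0 \<le> N \<Longrightarrow> \<bar>switch N s - switch N t\<bar> \<le> N * \<bar>s - t\<bar>"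
proof -
  assume N: "0 \<le> N"
  have "norm (switch N s - switch N t) \<le> N * norm (s - t)"
  proof (rule field_differentiable_bound[where S=UNIV])
    fix z
    show "(switch N has_field_derivative N * cos z * (switch N z * (1 - switch N z))) (at z within UNIV)"
      by (rule DERIV_switch)
    have "\<bar>N * cos z * (switch N z * (1 - switch N z))\<bar> = N * (\<bar>cos z\<bar> * (\<bar>switch N z\<bar> * \<bar>1 - switch N z\<bar>))"
      using N by (simp add: abs_mult)
    also have "\<dots> \<le> N * (1 * (1 * 1))"
      using N switch_bounds[of N z] by (intro mult_left_mono mult_mono) auto
    finally show "norm (N * cos z * (switch N z * (1 - switch N z))) \<le> N" by simp
  qed auto
  then show ?thesis by simp
qed

lemma mean_ge_switch:
  fixes b :: "'a::euclidean_space"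
  assumes "norm b = 1"
  shows "mean_ge (pi / 2) (\<lambda>x. switch N (x \<bullet> b)) (1 / 2)" "mean_ge (pi / 2) (\<lambda>x. 1 - switch N (x \<bullet> b)) (1 / 2)"
proof -
  have c: "continuous_on UNIV (switch N)" by (rule smooth_continuous[OF smooth_switch])
  have "mean_ge (0 + \<bar>pi\<bar> / 2) (\<lambda>x. switch N (x \<bullet> b)) (1 / 2)"
    by (rule mean_ge_average_shift[OF c _ _ assms])
       (use switch_bounds[of N] mean_ge_const[of "1/2"] in \<open>auto simp: switch_plus_pi less_imp_le\<close>)
  then show "mean_ge (pi / 2) (\<lambda>x. switch N (x \<bullet> b)) (1 / 2)" by simp
  have "mean_ge (0 + \<bar>pi\<bar> / 2) (\<lambda>x. 1 - switch N (x \<bullet> b)) (1 / 2)"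
    by (rule mean_ge_average_shift[where u="\<lambda>s. 1 - switch N s", OF _ _ _ assms])
       (use switch_bounds[of N] mean_ge_const[of "1/2"] c in \<open>auto simp: switch_plus_pi less_imp_le intro!: continuous_intros\<close>)
  then show "mean_ge (pi / 2) (\<lambda>x. 1 - switch N (x \<bullet> b)) (1 / 2)" by simp
qed

text \<open>
  The transition region between the values $0$ and $1$, measured by $\theta (1 - \theta)$, has arbitrarily small mean.
\<close>

lemma switch_almost_two_valued:
  assumes "0 < \<epsilon>"
  obtains N r where "0 < N"
    "\<And>b :: 'a::euclidean_space. norm b = 1 \<Longrightarrow>
       mean_ge r (\<lambda>x. 1 - 4 * switch N (x \<bullet> b) * (1 - switch N (x \<bullet> b))) (1 - \<epsilon>)"
proof -
  obtain k where k: "(2/3) ^ k < \<epsilon>" using real_arch_pow_inv[of \<epsilon> "2/3"] assms by auto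
  define A :: real where "A = 2 * 6 ^ k"
  define N where "N = sqrt (8 * A)"
  have A: "0 < A" by (simp add: A_def)
  have N: "0 < N" "N\<^sup>2 = 8 * A" using A by (auto simp: N_def)
  show thesis
  proof (rule that[OF N(1)])
    fix b :: 'a assume b: "norm b = 1"
    have sc: "continuous_on UNIV (\<lambda>x. switch N (x \<bullet> b))"
      by (rule continuous_on_compose2[OF smooth_continuous[OF smooth_switch]]) (auto intro!: continuous_intros)
    have pos: "1 \<le> 1 + A * (sin s)\<^sup>2" for s using A by simp
    have *: "mean_ge (real k * pi) (\<lambda>x. 1 - 1 / (1 + A * (sin (1 * (x \<bullet> b)))\<^sup>2)) (1 - (2/3) ^ k)"
      using b by (intro mean_ge_inverse_one_plus_sin) (auto simp: A_def)
    show "mean_ge (real k * pi) (\<lambda>x. 1 - 4 * switch N (x \<bullet> b) * (1 - switch N (x \<bullet> b))) (1 - \<epsilon>)"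
    proof (rule mean_ge_mono[OF *, where C=1 and C'=1])
      fix x
      have "(N * sin (x \<bullet> b))\<^sup>2 / 8 = A * (sin (x \<bullet> b))\<^sup>2" by (simp add: power_mult_distrib N)
      then have "4 * switch N (x \<bullet> b) * (1 - switch N (x \<bullet> b)) \<le> 1 / (1 + A * (sin (x \<bullet> b))\<^sup>2)"
        using logistic_variance_le[of "N * sin (x \<bullet> b)"] by (simp add: switch_def)
      then show "1 - 1 / (1 + A * (sin (1 * (x \<bullet> b)))\<^sup>2) \<le> 1 - 4 * switch N (x \<bullet> b) * (1 - switch N (x \<bullet> b))" by simp
      show "\<bar>1 - 1 / (1 + A * (sin (1 * (x \<bullet> b)))\<^sup>2)\<bar> \<le> 1" using pos[of "x \<bullet> b"] by (auto simp: divide_simps abs_le_iff)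
      have "0 \<le> 4 * switch N (x \<bullet> b) * (1 - switch N (x \<bullet> b))" using switch_bounds[of N "x \<bullet> b"] by simp
      moreover have "1 - 4 * switch N (x \<bullet> b) * (1 - switch N (x \<bullet> b)) = (1 - 2 * switch N (x \<bullet> b))\<^sup>2"
        by (simp add: power2_eq_square algebra_simps)
      ultimately show "\<bar>1 - 4 * switch N (x \<bullet> b) * (1 - switch N (x \<bullet> b))\<bar> \<le> 1"
        by (metis abs_of_nonneg diff_ge_0_iff_ge le_add_same_cancel1 diff_add_cancel diff_le_eq zero_le_power2)
    next
      show "continuous_on UNIV (\<lambda>x. 1 - 1 / (1 + A * (sin (1 * (x \<bullet> b)))\<^sup>2))"
        using pos by (intro continuous_intros) (metis not_one_le_zero mult_1)
    qed (use k in \<open>auto intro!: continuous_intros sc\<close>)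
  qed
qed

text \<open>
  Antiperiodicity forces mean zero over a full period, so an antiderivative stays bounded; the right additive constant
  makes it antiperiodic again, and the construction can be repeated.
\<close>

lemma antiperiodic_antiderivative:
  fixes v :: "real \<Rightarrow> real"
  assumes "continuous_on UNIV v" "\<And>s. v (s + p) = - v s"
  obtains U where "\<And>s. (U has_real_derivative v s) (at s)" "\<And>s. U (s + p) = - U s"
proof -
  have "\<exists>F. \<forall>x::real. (-\<infinity>::ereal) < ereal x \<longrightarrow> ereal x < \<infinity> \<longrightarrow> (F has_vector_derivative v x) (at x)"
    using assms(1) by (intro einterval_antiderivative) (auto simp: continuous_on_eq_continuous_at)
  then obtain F where F: "\<And>x. (F has_real_derivative v x) (at x)"
    by (auto simp: has_real_derivative_iff_has_vector_derivative)
  define U where "U s = F s - (F 0 + F p) / 2" for s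
  have U: "(U has_real_derivative v s) (at s)" for s
    unfolding U_def[abs_def] by (auto intro!: derivative_eq_intros F)
  have "((\<lambda>s. U (s + p) + U s) has_real_derivative 0) (at s)" for s
  proof -
    have "((\<lambda>s. U (s + p) + U s) has_real_derivative v (s + p) * 1 + v s) (at s)"
      by (intro derivative_intros U DERIV_chain2[OF U]) (auto intro!: derivative_eq_intros)
    then show ?thesis by (simp add: assms(2))
  qed
  then have "U (s + p) + U s = U (0 + p) + U 0" for s
    using DERIV_isconst_all[of "\<lambda>s. U (s + p) + U s"] by blast
  moreover have "U (0 + p) + U 0 = 0" by (simp add: U_def field_simps)
  ultimately have "U (s + p) = - U s" for s by (metis add_eq_0_iff2)
  with U that show thesis by blast
qed

lemma antiperiodic_bounded:
  fixes v :: "real \<Rightarrow> real"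
  assumes "continuous_on UNIV v" "\<And>s. v (s + p) = - v s" "0 < p"
  obtains C where "\<And>s. \<bar>v s\<bar> \<le> C"
proof -
  have "compact (v ` {0..p})" using assms(1) by (intro compact_continuous_image) (auto intro: continuous_on_subset)
  then obtain C where "\<forall>y\<in>v ` {0..p}. norm y \<le> C"
    using compact_imp_bounded[of "v ` {0..p}"] unfolding bounded_iff by blast
  then have C: "\<bar>v s\<bar> \<le> C" if "s \<in> {0..p}" for s using that by auto
  have nat: "\<bar>v (s + real n * p)\<bar> = \<bar>v s\<bar>" for s n
    by (induction n) (use assms(2)[of "s + real n * p" for n] in \<open>auto simp: algebra_simps\<close>)
  have int: "\<bar>v (s + real_of_int n * p)\<bar> = \<bar>v s\<bar>" for s n
  proof (cases "0 \<le> n")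
    case True
    then show ?thesis using nat[of s "nat n"] by simp
  next
    case False
    then show ?thesis using nat[of "s + real_of_int n * p" "nat (- n)"] by simp
  qed
  show thesis
  proof (rule that)
    fix s
    define n where "n = \<lfloor>s / p\<rfloor>"
    have "real_of_int n \<le> s / p" "s / p < real_of_int n + 1" unfolding n_def by linarith+
    then have "real_of_int n * p \<le> s" "s \<le> real_of_int n * p + p" using assms(3) by (auto simp: field_simps)
    then have "s - real_of_int n * p \<in> {0..p}" by auto
    then show "\<bar>v s\<bar> \<le> C" using C[of "s - real_of_int n * p"] int[of "s - real_of_int n * p" n] by simp
  qed
qed

text \<open>
  The potential of the laminate: for large $N$ its second derivative is nearly $\pm 1$ on alternating layers, while it and
  its first derivative remain bounded.
\<close>

lemma switch_potential:
  obtains W W' C where "\<And>s. (W has_real_derivative W' s) (at s)" "\<And>s. (W' has_real_derivative 2 * switch N s - 1) (at s)"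
    "smooth W" "\<And>s. \<bar>W s\<bar> \<le> C" "\<And>s. \<bar>W' s\<bar> \<le> C"
proof -
  let ?v = "\<lambda>s. 2 * switch N s - 1"
  have v: "smooth ?v" by (intro smooth_intros smooth_switch)
  have "?v (s + pi) = - ?v s" for s by (simp add: switch_plus_pi)
  then obtain W' where W': "\<And>s. (W' has_real_derivative ?v s) (at s)" "\<And>s. W' (s + pi) = - W' s"
    using antiperiodic_antiderivative[OF smooth_continuous[OF v]] by metis
  have sW': "smooth W'" by (rule smooth_real_antiderivative[OF W'(1) v])
  obtain W where W: "\<And>s. (W has_real_derivative W' s) (at s)" "\<And>s. W (s + pi) = - W s"
    using antiperiodic_antiderivative[OF smooth_continuous[OF sW'] W'(2)] by metis
  have sW: "smooth W" by (rule smooth_real_antiderivative[OF W(1) sW'])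
  obtain C' where C': "\<And>s. \<bar>W' s\<bar> \<le> C'"
    using antiperiodic_bounded[OF smooth_continuous[OF sW'] W'(2) pi_gt_zero] by metis
  obtain C where C: "\<And>s. \<bar>W s\<bar> \<le> C"
    using antiperiodic_bounded[OF smooth_continuous[OF sW] W(2) pi_gt_zero] by metis
  show thesis
    by (rule that[OF W(1) W'(1) sW, of "max C C'"]) (use C C' in \<open>auto simp: le_max_iff_disj\<close>)
qed

section \<open>Perturbations of a quadratic form on the null cone\<close>

lemma
  assumes "smooth f" "smooth g"
  shows D1_add: "D1 (\<lambda>x. f x + g x) x v
      = D1 f x v + D1 g x v" (is ?D1)
    and D2_add: "D2 (\<lambda>x. f x + g x) x u v = D2 f x u v + D2 g x u v" (is ?D2)
proof -
  note f = smooth_has_derivative[OF assms(1)] smooth_D1_has_derivative[OF assms(1)]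
  note g = smooth_has_derivative[OF assms(2)] smooth_D1_has_derivative[OF assms(2)]
  note * = D2_eqI[OF has_derivative_add[OF f(1) g(1)] has_derivative_add[OF f(2) g(2)]]
  show ?D1 by (simp add: *(1))
  show ?D2 by (rule *(2))
qed

lemma
  assumes "smooth f" "smooth g"
  shows D1_mult: "D1 (\<lambda>x. f x * g x) x v
      = f x * D1 g x v + D1 f x v * g x" (is ?D1)
    and D2_mult: "D2 (\<lambda>x. f x * g x) x u v
      = f x * D2 g x u v + D1 f x v * D1 g x u
        + (D1 f x u * D1 g x v + D2 f x u v * g x)" (is ?D2)
proof -
  note f = smooth_has_derivative[OF assms(1)] smooth_D1_has_derivative[OF assms(1)]
  note g = smooth_has_derivative[OF assms(2)] smooth_D1_has_derivative[OF assms(2)]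
  note * = D2_eqI[OF has_derivative_mult[OF f(1) g(1)]
      has_derivative_add[OF has_derivative_mult[OF f(1) g(2)] has_derivative_mult[OF f(2) g(1)]]]
  show ?D1 by (simp add: *(1))
  show ?D2 by (rule *(2))
qed

lemma
  shows D1_const: "D1 (\<lambda>x. c) x v = 0"
    and D2_const: "D2 (\<lambda>x. c) x u v = 0"
  by (simp_all add: second_derivative_def)

lemma
  assumes "smooth f"
  shows D1_cmult: "D1 (\<lambda>x. c * f x) x v = c * D1 f x v"
    and D2_cmult: "D2 (\<lambda>x. c * f x) x u v = c * D2 f x u v"
  using D1_mult[OF smooth_const[of c] assms]
    D2_mult[OF smooth_const[of c] assms]
  by (simp_all add: D1_const D2_const)

lemma
  assumes "smooth f" "smooth g"
  shows D1_diff: "D1 (\<lambda>x. f x - g x) x v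
      = D1 f x v - D1 g x v"
    and D2_diff: "D2 (\<lambda>x. f x - g x) x u v = D2 f x u v - D2 g x u v"
  using D1_add[OF assms(1) smooth_mult[OF smooth_const[of "-1"] assms(2)]]
    D2_add[OF assms(1) smooth_mult[OF smooth_const[of "-1"] assms(2)]]
    D1_cmult[OF assms(2), of "-1"] D2_cmult[OF assms(2), of "-1"]
  by simp_all

lemma
  assumes F: "\<And>s. (F has_real_derivative F' s) (at s)" "\<And>s. (F' has_real_derivative F'' s) (at s)"
  shows D1_ridge: "D1 (\<lambda>x. F (x \<bullet> b)) x v = F' (x \<bullet> b) * (v \<bullet> b)" (is ?D1)
    and D2_ridge: "D2 (\<lambda>x. F (x \<bullet> b)) x u v = F'' (x \<bullet> b) * (v \<bullet> b) * (u \<bullet> b)" (is ?D2)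
proof -
  have 1: "((\<lambda>x. F (x \<bullet> b)) has_derivative (\<lambda>v. F' (x \<bullet> b) * (v \<bullet> b))) (at x)" for x
    by (rule has_derivative_compose[OF _ F(1)[unfolded has_field_derivative_def]]) (auto intro!: derivative_eq_intros)
  have 2: "((\<lambda>x. F' (x \<bullet> b) * (u \<bullet> b)) has_derivative (\<lambda>v. F'' (x \<bullet> b) * (v \<bullet> b) * (u \<bullet> b))) (at x)" for x u
    by (intro has_derivative_mult_left has_derivative_compose[OF _ F(2)[unfolded has_field_derivative_def]]) (auto intro!: derivative_eq_intros)
  note * = D2_eqI[OF 1 2]
  show ?D1 by (simp add: *(1))
  show ?D2 by (rule *(2))
qed

lemma
  assumes "smooth f"
  shows D1_scaleR_arg: "D1 (\<lambda>x. f (M *\<^sub>R x)) x v = M * D1 f (M *\<^sub>R x) v" (is ?D1)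
    and D2_scaleR_arg: "D2 (\<lambda>x. f (M *\<^sub>R x)) x u v = M\<^sup>2 * D2 f (M *\<^sub>R x) u v" (is ?D2)
proof -
  note f = smooth_has_derivative[OF assms] smooth_D1_has_derivative[OF assms]
  have lin: "D1 f y (M *\<^sub>R v) = M * D1 f y v"
    "D2 f y u (M *\<^sub>R v) = M * D2 f y u v" for y u v
    using linear_scale[OF has_derivative_linear[OF f(1)], of _ M] linear_scale[OF has_derivative_linear[OF f(2)], of _ _ M] by auto
  have 1: "((\<lambda>x. f (M *\<^sub>R x)) has_derivative (\<lambda>v. M * D1 f (M *\<^sub>R x) v)) (at x)" for x
  proof -
    have "((\<lambda>x. f (M *\<^sub>R x)) has_derivative (\<lambda>v. D1 f (M *\<^sub>R x) (M *\<^sub>R v))) (at x)"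
      by (rule has_derivative_compose[OF _ f(1)]) (auto intro!: derivative_eq_intros)
    then show ?thesis by (simp add: lin)
  qed
  have 2: "((\<lambda>x. M * D1 f (M *\<^sub>R x) u) has_derivative (\<lambda>v. M\<^sup>2 * D2 f (M *\<^sub>R x) u v)) (at x)" for x u
  proof -
    have "((\<lambda>x. D1 f (M *\<^sub>R x) u) has_derivative (\<lambda>v. D2 f (M *\<^sub>R x) u (M *\<^sub>R v))) (at x)"
      by (rule has_derivative_compose[OF _ f(2)]) (auto intro!: derivative_eq_intros)
    from has_derivative_mult_right[OF this, of M] show ?thesis by (simp add: lin power2_eq_square mult.assoc)
  qed
  note * = D2_eqI[OF 1 2]
  show ?D1 by (simp add: *(1))
  show ?D2 by (rule *(2))
qed

lemma abs_add_le: "\<bar>x\<bar> \<le> a \<Longrightarrow> \<bar>y\<bar> \<le> c \<Longrightarrow> \<bar>x + y\<bar> \<le> a + c" for x y a c :: real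
  by linarith

text \<open>
  The loss in the triangle inequality is at most twice the smaller of the two terms, and the smaller of
  $\theta$, $1 - \theta$ is at most $2 \theta (1 - \theta)$. So the mean of an absolute value is almost
  additive over layers when $\theta$ is almost two-valued.
\<close>

lemma abs_convex_combination_ge:
  fixes a a' \<theta> A :: real
  assumes "0 \<le> \<theta>" "\<theta> \<le> 1" "\<bar>a\<bar> \<le> A" "\<bar>a'\<bar> \<le> A"
  shows "(1 - \<theta>) * \<bar>a\<bar> + \<theta> * \<bar>a'\<bar> - A * (4 * \<theta> * (1 - \<theta>)) \<le> \<bar>(1 - \<theta>) * a + \<theta> * a'\<bar>"
proof -
  define x y where "x = (1 - \<theta>) * \<bar>a\<bar>" and "y = \<theta> * \<bar>a'\<bar>"
  have xy: "\<bar>(1 - \<theta>) * a\<bar> = x" "\<bar>\<theta> * a'\<bar> = y" using assms by (auto simp: x_def y_def abs_mult)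
  have A: "0 \<le> A" using assms by linarith
  have "x \<le> A * (2 * \<theta> * (1 - \<theta>)) \<or> y \<le> A * (2 * \<theta> * (1 - \<theta>))"
  proof (cases "\<theta> \<le> 1/2")
    case True
    have "\<theta> * \<bar>a'\<bar> \<le> \<theta> * A" using assms by (intro mult_left_mono)
    also have "\<dots> \<le> (2 * (1 - \<theta>)) * (\<theta> * A)" using True assms A mult_right_mono[of 1 "2 * (1 - \<theta>)" "\<theta> * A"] by simp
    finally show ?thesis by (simp add: y_def mult_ac)
  next
    case False
    have "(1 - \<theta>) * \<bar>a\<bar> \<le> (1 - \<theta>) * A" using assms by (intro mult_left_mono) auto
    also have "\<dots> \<le> (2 * \<theta>) * ((1 - \<theta>) * A)" using False assms A mult_right_mono[of 1 "2 * \<theta>" "(1 - \<theta>) * A"] by simp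
    finally show ?thesis by (simp add: x_def mult_ac)
  qed
  moreover have "0 \<le> A * (2 * \<theta> * (1 - \<theta>))" using assms A by auto
  moreover have "x - y \<le> \<bar>(1 - \<theta>) * a + \<theta> * a'\<bar>" "y - x \<le> \<bar>(1 - \<theta>) * a + \<theta> * a'\<bar>" using xy by linarith+
  moreover have "A * (4 * \<theta> * (1 - \<theta>)) = 2 * (A * (2 * \<theta> * (1 - \<theta>)))" by simp
  ultimately show ?thesis unfolding x_def[symmetric] y_def[symmetric] by linarith
qed

text \<open>
  In coordinates along $b_0$, $b_1$, $b_2$ the null vectors form the light cone of three-dimensional Minkowski
  space; all other coordinates are free.
\<close>

locale null_frame =
  fixes b :: "nat \<Rightarrow> 'a::euclidean_space"
  assumes orthonormal: "i < 3 \<Longrightarrow> j < 3 \<Longrightarrow> b i \<bullet> b j = (if i = j then 1 else 0)"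
begin

definition frame_norm :: "'a \<Rightarrow> real" where
  "frame_norm v = (\<Sum>i<3. \<bar>v \<bullet> b i\<bar>)"

definition frame_form :: "(nat \<Rightarrow> real) \<Rightarrow> 'a \<Rightarrow> real" where
  "frame_form H v = (\<Sum>i<3. H i * (v \<bullet> b i)\<^sup>2)"

definition null_vector :: "'a \<Rightarrow> bool" where
  "null_vector v \<longleftrightarrow> (v \<bullet> b 0)\<^sup>2 = (v \<bullet> b 1)\<^sup>2 + (v \<bullet> b 2)\<^sup>2"

definition null_positive :: "(nat \<Rightarrow> real) \<Rightarrow> bool" where
  "null_positive H \<longleftrightarrow> 0 < H 0 + H 1 \<and> 0 < H 0 + H 2"

text \<open>
  The Hessian of half the quadratic form plus $\varphi$ is required to be uniformly positive on the null cone, where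
  $|e \cdot b_0|$ is comparable to \<open>frame_norm e\<close> (\<open>frame_norm_null\<close>); the reserve $\eta$ absorbs the error made by pasting.
  The bounds are in terms of \<open>frame_norm\<close> rather than the norm, which forces $\varphi$ to
  depend on the three distinguished coordinates only.
\<close>

definition admissible :: "(nat \<Rightarrow> real) \<Rightarrow> ('a \<Rightarrow> real) \<Rightarrow> bool" where
  "admissible H \<phi> \<longleftrightarrow> smooth \<phi> \<and>
     (\<exists>C. (\<forall>x. \<bar>\<phi> x\<bar> \<le> C) \<and> (\<forall>x v. \<bar>D1 \<phi> x v\<bar> \<le> C * frame_norm v) \<and>
        (\<forall>x u v. \<bar>D2 \<phi> x u v\<bar> \<le> C * (frame_norm u * frame_norm v))) \<and>
     (\<exists>\<eta>>0. \<forall>x e. null_vector e \<longrightarrow> \<eta> * (e \<bullet> b 0)\<^sup>2 \<le> frame_form H e + D2 \<phi> x e e)"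

definition attains :: "(nat \<Rightarrow> real) \<Rightarrow> real \<Rightarrow> bool" where
  "attains H m \<longleftrightarrow> (\<exists>\<phi> r. admissible H \<phi> \<and> mean_ge r (\<lambda>x. \<bar>H 1 + D2 \<phi> x (b 1) (b 1)\<bar>) m)"

lemma norm_frame: "i < 3 \<Longrightarrow> norm (b i) = 1"
  using orthonormal[of i i] by (simp add: norm_eq_1)

lemma frame_norm_nonneg: "0 \<le> frame_norm v"
  by (simp add: frame_norm_def sum_nonneg)

lemma inner_frame_le: "i < 3 \<Longrightarrow> \<bar>v \<bullet> b i\<bar> \<le> frame_norm v"
  unfolding frame_norm_def by (rule member_le_sum) auto

lemma frame_norm_le: "frame_norm v \<le> 3 * norm v"
proof -
  have "frame_norm v \<le> (\<Sum>i<(3::nat). norm v)"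
    unfolding frame_norm_def
  proof (rule sum_mono)
    fix i :: nat assume "i \<in> {..<3}"
    then show "\<bar>v \<bullet> b i\<bar> \<le> norm v"
      using Cauchy_Schwarz_ineq2[of v "b i"] norm_frame[of i] by simp
  qed
  then show ?thesis by simp
qed

lemma frame_norm_frame: "i < 3 \<Longrightarrow> frame_norm (b i) = 1"
proof -
  assume i: "i < 3"
  have "frame_norm (b i) = (\<Sum>j<3. if i = j then 1 else 0)"
    unfolding frame_norm_def by (rule sum.cong) (use i orthonormal in auto)
  then show ?thesis using i by simp
qed

lemma frame_norm_null:
  assumes "null_vector e"
  shows "(frame_norm e)\<^sup>2 \<le> 9 * (e \<bullet> b 0)\<^sup>2"
proof -
  have "\<bar>e \<bullet> b 1\<bar> \<le> \<bar>e \<bullet> b 0\<bar>" "\<bar>e \<bullet> b 2\<bar> \<le> \<bar>e \<bullet> b 0\<bar>"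
    using assms by (auto simp: null_vector_def abs_le_square_iff)
  then have "frame_norm e \<le> 3 * \<bar>e \<bullet> b 0\<bar>"
    by (simp add: frame_norm_def eval_nat_numeral)
  from power_mono[OF this frame_norm_nonneg, of 2] show ?thesis by (simp add: power_mult_distrib)
qed

lemma frame_form_upd: "i < 3 \<Longrightarrow> frame_form (H(i := H i + t)) v = frame_form H v + t * (v \<bullet> b i)\<^sup>2"
proof -
  assume i: "i < 3"
  have "frame_form (H(i := H i + t)) v = (\<Sum>j<3. H j * (v \<bullet> b j)\<^sup>2 + (if j = i then t * (v \<bullet> b i)\<^sup>2 else 0))"
    unfolding frame_form_def by (rule sum.cong) (auto simp: algebra_simps)
  also have "\<dots> = frame_form H v + t * (v \<bullet> b i)\<^sup>2"
    using i by (simp add: sum.distrib frame_form_def)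
  finally show ?thesis .
qed

lemma frame_form_null:
  assumes "null_vector e"
  shows "frame_form H e = (H 0 + H 1) * (e \<bullet> b 1)\<^sup>2 + (H 0 + H 2) * (e \<bullet> b 2)\<^sup>2"
  using assms by (simp add: frame_form_def null_vector_def eval_nat_numeral algebra_simps)

lemma admissibleE:
  assumes "admissible H \<phi>"
  obtains C \<eta> where "smooth \<phi>" "0 \<le> C" "\<And>x. \<bar>\<phi> x\<bar> \<le> C"
    "\<And>x v. \<bar>D1 \<phi> x v\<bar> \<le> C * frame_norm v"
    "\<And>x u v. \<bar>D2 \<phi> x u v\<bar> \<le> C * (frame_norm u * frame_norm v)"
    "0 < \<eta>" "\<And>x e. null_vector e \<Longrightarrow> \<eta> * (e \<bullet> b 0)\<^sup>2 \<le> frame_form H e + D2 \<phi> x e e"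
proof -
  obtain C \<eta> where *: "smooth \<phi>" "\<And>x. \<bar>\<phi> x\<bar> \<le> C"
    "\<And>x v. \<bar>D1 \<phi> x v\<bar> \<le> C * frame_norm v"
    "\<And>x u v. \<bar>D2 \<phi> x u v\<bar> \<le> C * (frame_norm u * frame_norm v)"
    "0 < \<eta>" "\<And>x e. null_vector e \<Longrightarrow> \<eta> * (e \<bullet> b 0)\<^sup>2 \<le> frame_form H e + D2 \<phi> x e e"
    using assms unfolding admissible_def by blast
  have "0 \<le> C" using *(2)[of 0] by linarith
  with * that show thesis by blast
qed

lemma admissibleI:
  assumes "smooth \<phi>" "\<And>x. \<bar>\<phi> x\<bar> \<le> C0"
    "\<And>x v. \<bar>D1 \<phi> x v\<bar> \<le> C1 * frame_norm v"
    "\<And>x u v. \<bar>D2 \<phi> x u v\<bar> \<le> C2 * (frame_norm u * frame_norm v)"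
    "0 < \<eta>" "\<And>x e. null_vector e \<Longrightarrow> \<eta> * (e \<bullet> b 0)\<^sup>2 \<le> frame_form H e + D2 \<phi> x e e"
  shows "admissible H \<phi>"
  unfolding admissible_def
proof (intro conjI exI allI)
  let ?C = "max C0 (max C1 C2)"
  show "\<bar>\<phi> x\<bar> \<le> ?C" for x using assms(2)[of x] by simp
  show "\<bar>D1 \<phi> x v\<bar> \<le> ?C * frame_norm v" for x v
    by (rule order_trans[OF assms(3)]) (intro mult_right_mono frame_norm_nonneg, simp)
  show "\<bar>D2 \<phi> x u v\<bar> \<le> ?C * (frame_norm u * frame_norm v)" for x u v
    by (rule order_trans[OF assms(4)]) (intro mult_right_mono mult_nonneg_nonneg frame_norm_nonneg, simp)
qed (use assms in auto)

lemma attains_self: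
  assumes "null_positive H"
  shows "attains H \<bar>H 1\<bar>"
  unfolding attains_def
proof (intro exI conjI)
  show "mean_ge 0 (\<lambda>x. \<bar>H 1 + D2 (\<lambda>x. 0) x (b 1) (b 1)\<bar>) \<bar>H 1\<bar>"
    by (simp add: D2_const mean_ge_const)
  show "admissible H (\<lambda>x. 0)"
  proof (rule admissibleI[where ?C0.0=0 and ?C1.0=0 and ?C2.0=0])
    show "0 < min (H 0 + H 1) (H 0 + H 2)" using assms by (simp add: null_positive_def)
    fix x e assume e: "null_vector e"
    show "min (H 0 + H 1) (H 0 + H 2) * (e \<bullet> b 0)\<^sup>2 \<le> frame_form H e + D2 (\<lambda>x. 0) x e e"
      using e unfolding frame_form_null[OF e] null_vector_def
      by (simp add: D2_const distrib_left add_mono mult_right_mono)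
  qed (auto simp: smooth_const D1_const D2_const)
qed

lemma attains_mono: "attains H m \<Longrightarrow> m' \<le> m \<Longrightarrow> attains H m'"
proof -
  assume a: "attains H m" and m': "m' \<le> m"
  obtain \<phi> r where *: "admissible H \<phi>" "mean_ge r (\<lambda>x. \<bar>H 1 + D2 \<phi> x (b 1) (b 1)\<bar>) m"
    using a unfolding attains_def by blast
  have "mean_ge r (\<lambda>x. \<bar>H 1 + D2 \<phi> x (b 1) (b 1)\<bar>) m'"
    unfolding mean_ge_def
  proof (intro conjI allI impI)
    fix \<psi> D :: "'a \<Rightarrow> real" assume w: "weight \<psi> D"
    have "m' * (LBINT x. \<psi> x) \<le> m * (LBINT x. \<psi> x)"
      using m' weight_integral_nonneg[OF w] by (intro mult_right_mono)
    then show "m' * (LBINT x. \<psi> x) - r * (LBINT x. D x) \<le> (LBINT x. \<psi> x * \<bar>H 1 + D2 \<phi> x (b 1) (b 1)\<bar>)"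
      using mean_geD[OF *(2) w] by linarith
  qed (use *(2) in \<open>simp add: mean_ge_def\<close>)
  with *(1) show ?thesis unfolding attains_def by blast
qed

lemma attains_scale:
  assumes "attains H m" "0 < t"
  shows "attains (\<lambda>i. t * H i) (t * m)"
proof -
  obtain \<phi> r where *: "admissible H \<phi>" "mean_ge r (\<lambda>x. \<bar>H 1 + D2 \<phi> x (b 1) (b 1)\<bar>) m"
    using assms(1) unfolding attains_def by blast
  from *(1) obtain C \<eta> where \<phi>: "smooth \<phi>" "0 \<le> C" "\<And>x. \<bar>\<phi> x\<bar> \<le> C"
    "\<And>x v. \<bar>D1 \<phi> x v\<bar> \<le> C * frame_norm v"
    "\<And>x u v. \<bar>D2 \<phi> x u v\<bar> \<le> C * (frame_norm u * frame_norm v)"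
    "0 < \<eta>" "\<And>x e. null_vector e \<Longrightarrow> \<eta> * (e \<bullet> b 0)\<^sup>2 \<le> frame_form H e + D2 \<phi> x e e"
    by (rule admissibleE) (rule that)
  have "admissible (\<lambda>i. t * H i) (\<lambda>x. t * \<phi> x)"
  proof (rule admissibleI)
    show "smooth (\<lambda>x. t * \<phi> x)" by (intro smooth_intros \<phi>)
    show "\<bar>t * \<phi> x\<bar> \<le> t * C" for x using \<phi>(3)[of x] assms(2) by (simp add: abs_mult)
    show "\<bar>D1 (\<lambda>x. t * \<phi> x) x v\<bar> \<le> (t * C) * frame_norm v" for x v
      using \<phi>(4)[of x v] assms(2) by (simp add: D1_cmult[OF \<phi>(1)] abs_mult)
    show "\<bar>D2 (\<lambda>x. t * \<phi> x) x u v\<bar> \<le> (t * C) * (frame_norm u * frame_norm v)" for x u v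
      using \<phi>(5)[of x u v] assms(2) by (simp add: D2_cmult[OF \<phi>(1)] abs_mult mult.assoc)
    show "0 < t * \<eta>" using \<phi>(6) assms(2) by simp
    fix x e assume "null_vector e"
    from mult_left_mono[OF \<phi>(7)[OF this, of x], of t] assms(2)
    show "t * \<eta> * (e \<bullet> b 0)\<^sup>2 \<le> frame_form (\<lambda>i. t * H i) e + D2 (\<lambda>x. t * \<phi> x) x e e"
      by (simp add: D2_cmult[OF \<phi>(1)] frame_form_def sum_distrib_left mult.assoc distrib_left)
  qed
  moreover have "mean_ge (t * r) (\<lambda>x. \<bar>t * H 1 + D2 (\<lambda>x. t * \<phi> x) x (b 1) (b 1)\<bar>) (t * m)"
    using mean_ge_cmult[OF *(2), of t] assms(2)
    by (simp add: D2_cmult[OF \<phi>(1)] abs_mult flip: distrib_left)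
  ultimately show ?thesis unfolding attains_def by blast
qed

text \<open>
  Half of the mean of $G$ survives on a family of layers that itself has mean $1/2$, up to an error that
  vanishes as the scale ratio $M$ grows.
\<close>

lemma mean_ge_switched:
  assumes G: "mean_ge r G m" "continuous_on UNIV G" "\<And>x. \<bar>G x\<bar> \<le> A" "0 \<le> m" and M: "1 \<le> M" and N: "0 \<le> N"
    and u: "continuous_on UNIV u" "\<And>x. 0 \<le> u x" "\<And>x. u x \<le> 1" "\<And>x y. \<bar>u x - u y\<bar> \<le> N * norm (x - y)"
    and half: "mean_ge (pi / 2) u (1 / 2)" and w: "weight \<psi> D"
  shows "(m / 2 - r * N / M) * (LBINT x. \<psi> x) - (m * (pi / 2) + r) * (LBINT x. D x)
    \<le> (LBINT x. \<psi> x * (u x * G (M *\<^sub>R x)))"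
proof -
  define I J where "I = (LBINT x. \<psi> x)" and "J = (LBINT x. D x)"
  have IJ: "0 \<le> I" "0 \<le> J" using weight_integral_nonneg[OF w] by (auto simp: I_def J_def)
  have r: "0 \<le> r" using G(1) by (simp add: mean_ge_def)
  have iD: "(LBINT x. D x + N * \<psi> x) = J + N * I"
    using weightD[OF w] by (simp add: I_def J_def)
  have sc: "mean_ge (r / M) (\<lambda>x. G (M *\<^sub>R x)) m" using M by (intro mean_ge_scaleR_arg G) auto
  have "m * (1 / 2 * I - pi / 2 * J) \<le> m * (LBINT x. \<psi> x * u x)"
    using mean_geD[OF half w] G(4) by (intro mult_left_mono) (auto simp: I_def J_def)
  moreover have "m * (LBINT x. \<psi> x * u x) - r / M * (J + N * I) \<le> (LBINT x. \<psi> x * u x * G (M *\<^sub>R x))"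
    using mean_geD[OF sc weight_mult[OF w u N]] iD by simp
  moreover have "r / M * J \<le> r * J"
  proof -
    have "r / M \<le> r / 1" using M r by (intro divide_left_mono) auto
    then show ?thesis using IJ by (intro mult_right_mono) auto
  qed
  moreover have "r / M * (J + N * I) = r / M * J + r * N / M * I" by (simp add: algebra_simps)
  moreover have "m * (1 / 2 * I - pi / 2 * J) = m / 2 * I - m * (pi / 2) * J" by (simp add: algebra_simps)
  ultimately have "m / 2 * I - m * (pi / 2) * J - r * J - r * N / M * I \<le> (LBINT x. \<psi> x * u x * G (M *\<^sub>R x))"
    by linarith
  then have "(m / 2 - r * N / M) * I - (m * (pi / 2) + r) * J \<le> (LBINT x. \<psi> x * u x * G (M *\<^sub>R x))"
    by (simp add: left_diff_distrib distrib_right)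
  then show ?thesis by (simp add: I_def J_def mult.assoc)
qed

text \<open>
  Let $\theta$ be the switch in direction $b_i$. The laminate potential $(t/2) W(x \cdot b_i)$ changes the coefficient
  $H_i + t/2$ into $H_i + t \theta$, that is, into $H$ on the layers $\theta \approx 0$ and into
  $H'$ on the layers $\theta \approx 1$. Adding $M^{-2} (1 - \theta) \varphi_0(M x) + M^{-2} \theta\, \varphi_1(M x)$
  makes the total Hessian a convex combination of the two given ones up to an error of order $1/M$, because the
  rescaled perturbations are of order $M^{-2}$ and their gradients of order $M^{-1}$. So positivity
  on the null cone is inherited, and the mean tends to the average of the two means.
\<close>

lemma attains_midpoint:
  assumes i: "i < 3" and at0: "attains H m" and at1: "attains (H(i := H i + t)) m'" and m: "0 \<le> m" "0 \<le> m'" and \<epsilon>: "0 < \<epsilon>"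
  shows "attains (H(i := H i + t / 2)) ((m + m') / 2 - \<epsilon>)"
proof -
  define H' where "H' = H(i := H i + t)"
  obtain \<phi>0 r0 where a0: "admissible H \<phi>0" and V0: "mean_ge r0 (\<lambda>x. \<bar>H 1 + D2 \<phi>0 x (b 1) (b 1)\<bar>) m"
    using at0 unfolding attains_def by blast
  obtain \<phi>1 r1 where a1: "admissible H' \<phi>1" and V1: "mean_ge r1 (\<lambda>x. \<bar>H' 1 + D2 \<phi>1 x (b 1) (b 1)\<bar>) m'"
    using at1 unfolding attains_def H'_def by blast
  from a0 obtain C0 \<eta>0 where \<phi>0: "smooth \<phi>0" "0 \<le> C0" "\<And>x. \<bar>\<phi>0 x\<bar> \<le> C0"
    "\<And>x v. \<bar>D1 \<phi>0 x v\<bar> \<le> C0 * frame_norm v"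
    "\<And>x u v. \<bar>D2 \<phi>0 x u v\<bar> \<le> C0 * (frame_norm u * frame_norm v)"
    "0 < \<eta>0" "\<And>x e. null_vector e \<Longrightarrow> \<eta>0 * (e \<bullet> b 0)\<^sup>2 \<le> frame_form H e + D2 \<phi>0 x e e"
    by (rule admissibleE) (rule that)
  from a1 obtain C1 \<eta>1 where \<phi>1: "smooth \<phi>1" "0 \<le> C1" "\<And>x. \<bar>\<phi>1 x\<bar> \<le> C1"
    "\<And>x v. \<bar>D1 \<phi>1 x v\<bar> \<le> C1 * frame_norm v"
    "\<And>x u v. \<bar>D2 \<phi>1 x u v\<bar> \<le> C1 * (frame_norm u * frame_norm v)"
    "0 < \<eta>1" "\<And>x e. null_vector e \<Longrightarrow> \<eta>1 * (e \<bullet> b 0)\<^sup>2 \<le> frame_form H' e + D2 \<phi>1 x e e"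
    by (rule admissibleE) (rule that)
  define A where "A = \<bar>H 1\<bar> + \<bar>H' 1\<bar> + C0 + C1"
  have A: "0 \<le> A" using \<phi>0(2) \<phi>1(2) by (simp add: A_def)
  \<comment> \<open>Half of the admissible loss is spent on the transition region, the other half on the error terms of order \<open>1 / M\<close>.\<close>
  define \<epsilon>' where "\<epsilon>' = \<epsilon> / (2 * (A + 1))"
  have \<epsilon>': "0 < \<epsilon>'" "A * \<epsilon>' \<le> \<epsilon> / 2" using \<epsilon> A by (auto simp: \<epsilon>'_def field_simps)
  obtain N rN where N: "0 < N" and two: "\<And>c :: 'a. norm c = 1 \<Longrightarrow>
       mean_ge rN (\<lambda>x. 1 - 4 * switch N (x \<bullet> c) * (1 - switch N (x \<bullet> c))) (1 - \<epsilon>')"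
    using switch_almost_two_valued[OF \<epsilon>'(1), where 'a='a] by blast
  obtain W W' CW where W: "\<And>s. (W has_real_derivative W' s) (at s)" "\<And>s. (W' has_real_derivative 2 * switch N s - 1) (at s)"
    "smooth W" "\<And>s. \<bar>W s\<bar> \<le> CW" "\<And>s. \<bar>W' s\<bar> \<le> CW"
    using switch_potential[of N] by metis
  define \<theta>1 where "\<theta>1 s = N * cos s * (switch N s * (1 - switch N s))" for s
  define \<theta>2 where "\<theta>2 s = - N * sin s * (switch N s * (1 - switch N s)) + N * cos s * (\<theta>1 s * (1 - 2 * switch N s))" for s
  have d\<theta>: "(switch N has_real_derivative \<theta>1 s) (at s)" "(\<theta>1 has_real_derivative \<theta>2 s) (at s)" for s
  proof -
    show 1: "(switch N has_real_derivative \<theta>1 s) (at s)" unfolding \<theta>1_def by (rule DERIV_switch)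
    show "(\<theta>1 has_real_derivative \<theta>2 s) (at s)" unfolding \<theta>1_def[abs_def]
      by (rule DERIV_cong, (rule derivative_intros 1)+) (simp add: \<theta>2_def algebra_simps)
  qed
  have pq: "0 \<le> switch N s * (1 - switch N s)" "switch N s * (1 - switch N s) \<le> 1" "\<bar>1 - 2 * switch N s\<bar> \<le> 1" for s
    using switch_bounds[of N s] by (auto intro!: mult_le_one simp: abs_le_iff)
  have \<theta>1: "\<bar>\<theta>1 s\<bar> \<le> N" for s
  proof -
    have "\<bar>\<theta>1 s\<bar> = N * (\<bar>cos s\<bar> * (switch N s * (1 - switch N s)))" using N switch_bounds[of N s] by (simp add: \<theta>1_def abs_mult)
    also have "\<dots> \<le> N * (1 * 1)" using N pq[of s] by (intro mult_left_mono mult_mono) auto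
    finally show ?thesis by simp
  qed
  have \<theta>2: "\<bar>\<theta>2 s\<bar> \<le> N + N * N" for s
  proof -
    have "\<bar>- N * sin s * (switch N s * (1 - switch N s))\<bar> = N * (\<bar>sin s\<bar> * (switch N s * (1 - switch N s)))"
      using N switch_bounds[of N s] by (simp add: abs_mult)
    also have "\<dots> \<le> N * (1 * 1)" using N pq[of s] by (intro mult_left_mono mult_mono) auto
    finally have 1: "\<bar>- N * sin s * (switch N s * (1 - switch N s))\<bar> \<le> N" by simp
    have "\<bar>N * cos s * (\<theta>1 s * (1 - 2 * switch N s))\<bar> = N * (\<bar>cos s\<bar> * (\<bar>\<theta>1 s\<bar> * \<bar>1 - 2 * switch N s\<bar>))"
      using N by (simp add: abs_mult)
    also have "\<dots> \<le> N * (1 * (N * 1))" using N pq[of s] \<theta>1[of s] by (intro mult_left_mono mult_mono) auto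
    finally show ?thesis using 1 unfolding \<theta>2_def by linarith
  qed
  \<comment> \<open>\<open>K / M\<close> bounds the terms in which a derivative falls on the switch.\<close>
  define K where "K = (N + N * N) * (C0 + C1) + 2 * (N * (C0 + C1))"
  have K: "0 \<le> K" using N \<phi>0(2) \<phi>1(2) by (simp add: K_def)
  define \<eta> where "\<eta> = min \<eta>0 \<eta>1"
  have \<eta>: "0 < \<eta>" "\<eta> \<le> \<eta>0" "\<eta> \<le> \<eta>1" using \<phi>0(6) \<phi>1(6) by (auto simp: \<eta>_def)
  have r01: "0 \<le> r0" "0 \<le> r1" using V0 V1 by (auto simp: mean_ge_def)
  define M where "M = max 1 (max (18 * K / \<eta>) (2 * ((r0 + r1) * N + K) / \<epsilon>))"
  have M: "1 \<le> M" "18 * K / \<eta> \<le> M" "2 * ((r0 + r1) * N + K) / \<epsilon> \<le> M" by (auto simp: M_def)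
  have M': "K / M * 9 \<le> \<eta> / 2" "(r0 + r1) * N / M + K / M \<le> \<epsilon> / 2"
    using M \<eta> \<epsilon> by (auto simp: field_simps)
  define \<theta> where "\<theta> x = switch N (x \<bullet> b i)" for x
  have \<theta>: "0 < \<theta> x" "\<theta> x < 1" for x by (auto simp: \<theta>_def switch_bounds)
  have s\<theta>: "smooth \<theta>" unfolding \<theta>_def[abs_def]
    by (intro smooth_compose_real[OF smooth_switch] smooth_inner)
  have sW: "smooth (\<lambda>x. W (x \<bullet> b i))"
    by (intro smooth_compose_real[OF W(3)] smooth_inner)
  have d\<theta>': "D1 \<theta> x v = \<theta>1 (x \<bullet> b i) * (v \<bullet> b i)"
    "D2 \<theta> x u v = \<theta>2 (x \<bullet> b i) * (v \<bullet> b i) * (u \<bullet> b i)" for x u v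
    unfolding \<theta>_def[abs_def] by (rule D1_ridge[OF d\<theta>] D2_ridge[OF d\<theta>])+
  have dW: "D2 (\<lambda>x. W (x \<bullet> b i)) x u v = (2 * \<theta> x - 1) * (v \<bullet> b i) * (u \<bullet> b i)" for x u v
    unfolding \<theta>_def by (rule D2_ridge[OF W(1,2)])
  define \<delta> where "\<delta> x = \<phi>1 x - \<phi>0 x" for x
  have s\<delta>: "smooth \<delta>" unfolding \<delta>_def[abs_def] by (intro smooth_intros \<phi>0 \<phi>1)
  have \<delta>0: "\<bar>\<delta> x\<bar> \<le> C0 + C1" for x using \<phi>0(3)[of x] \<phi>1(3)[of x] unfolding \<delta>_def by linarith
  have \<delta>1: "\<bar>D1 \<delta> x v\<bar> \<le> (C0 + C1) * frame_norm v" for x v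
    using \<phi>0(4)[of x v] \<phi>1(4)[of x v]
    unfolding \<delta>_def[abs_def] D1_diff[OF \<phi>1(1) \<phi>0(1)] distrib_right by linarith
  have \<delta>2: "D2 \<delta> x u v = D2 \<phi>1 x u v - D2 \<phi>0 x u v" for x u v
    unfolding \<delta>_def[abs_def] by (rule D2_diff[OF \<phi>1(1) \<phi>0(1)])
  define \<zeta> where "\<zeta> x = (t / 2) * W (x \<bullet> b i) + (1 / M\<^sup>2) * (\<phi>0 (M *\<^sub>R x) + \<theta> x * \<delta> (M *\<^sub>R x))" for x
  have s\<zeta>: "smooth \<zeta>" unfolding \<zeta>_def[abs_def] by (intro smooth_intros sW s\<theta> s\<delta> \<phi>0)
  have sM: "smooth (\<lambda>x. \<phi>0 (M *\<^sub>R x))" "smooth (\<lambda>x. \<delta> (M *\<^sub>R x))"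
    by (intro smooth_intros s\<delta> \<phi>0)+
  have s\<theta>\<delta>: "smooth (\<lambda>x. \<theta> x * \<delta> (M *\<^sub>R x))" by (intro smooth_intros s\<theta> sM)
  have sC: "smooth (\<lambda>x. \<phi>0 (M *\<^sub>R x) + \<theta> x * \<delta> (M *\<^sub>R x))" by (intro smooth_add s\<theta>\<delta> sM)
  have sA: "smooth (\<lambda>x. (t / 2) * W (x \<bullet> b i))" by (intro smooth_mult smooth_const sW)
  have sB: "smooth (\<lambda>x. (1 / M\<^sup>2) * (\<phi>0 (M *\<^sub>R x) + \<theta> x * \<delta> (M *\<^sub>R x)))"
    by (intro smooth_mult smooth_const sC)
  have d\<zeta>: "D1 \<zeta> x v = (t / 2) * (W' (x \<bullet> b i) * (v \<bullet> b i)) +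
      (1 / M\<^sup>2) * (M * D1 \<phi>0 (M *\<^sub>R x) v +
         (\<theta> x * (M * D1 \<delta> (M *\<^sub>R x) v) + \<theta>1 (x \<bullet> b i) * (v \<bullet> b i) * \<delta> (M *\<^sub>R x)))" for x v
    unfolding \<zeta>_def[abs_def]
    by (simp only: D1_add[OF sA sB] D1_cmult[OF sW] D1_cmult[OF sC]
        D1_add[OF sM(1) s\<theta>\<delta>] D1_mult[OF s\<theta> sM(2)]
        D1_scaleR_arg[OF \<phi>0(1)] D1_scaleR_arg[OF s\<delta>]
        D1_ridge[OF W(1,2)] d\<theta>')
  \<comment> \<open>The part of the Hessian in which a derivative falls on the switch.\<close>
  define E where "E x u v = (1 / M\<^sup>2) * (\<theta>2 (x \<bullet> b i) * (v \<bullet> b i) * (u \<bullet> b i) * \<delta> (M *\<^sub>R x))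
     + (1 / M) * (\<theta>1 (x \<bullet> b i) * (v \<bullet> b i) * D1 \<delta> (M *\<^sub>R x) u
       + \<theta>1 (x \<bullet> b i) * (u \<bullet> b i) * D1 \<delta> (M *\<^sub>R x) v)" for x u v
  have d2\<zeta>: "D2 \<zeta> x u v = (t / 2) * ((2 * \<theta> x - 1) * (v \<bullet> b i) * (u \<bullet> b i))
      + (1 - \<theta> x) * D2 \<phi>0 (M *\<^sub>R x) u v + \<theta> x * D2 \<phi>1 (M *\<^sub>R x) u v + E x u v" for x u v
  proof -
    have "D2 \<zeta> x u v = (t / 2) * ((2 * \<theta> x - 1) * (v \<bullet> b i) * (u \<bullet> b i)) + (1 / M\<^sup>2) *
      (M\<^sup>2 * D2 \<phi>0 (M *\<^sub>R x) u v + (\<theta> x * (M\<^sup>2 * D2 \<delta> (M *\<^sub>R x) u v)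
       + \<theta>1 (x \<bullet> b i) * (v \<bullet> b i) * (M * D1 \<delta> (M *\<^sub>R x) u)
       + (\<theta>1 (x \<bullet> b i) * (u \<bullet> b i) * (M * D1 \<delta> (M *\<^sub>R x) v) + \<theta>2 (x \<bullet> b i) * (v \<bullet> b i) * (u \<bullet> b i) * \<delta> (M *\<^sub>R x))))"
      unfolding \<zeta>_def[abs_def]
      by (simp only: D2_add[OF sA sB] D2_cmult[OF sW] D2_cmult[OF sC]
        D2_add[OF sM(1) s\<theta>\<delta>] D2_mult[OF s\<theta> sM(2)]
        D1_scaleR_arg[OF \<phi>0(1)] D1_scaleR_arg[OF s\<delta>]
        D2_scaleR_arg[OF \<phi>0(1)] D2_scaleR_arg[OF s\<delta>]
        dW d\<theta>')
    then show ?thesis using M(1) by (simp add: E_def \<delta>2 field_simps power2_eq_square)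
  qed
  have p: "0 \<le> frame_norm v" "\<bar>v \<bullet> b i\<bar> \<le> frame_norm v" for v by (simp_all add: frame_norm_nonneg inner_frame_le i)
  have E: "\<bar>E x u v\<bar> \<le> K / M * (frame_norm u * frame_norm v)" for x u v
  proof -
    have "\<bar>\<theta>2 (x \<bullet> b i) * (v \<bullet> b i) * (u \<bullet> b i) * \<delta> (M *\<^sub>R x)\<bar> \<le> (N + N * N) * frame_norm v * frame_norm u * (C0 + C1)"
      unfolding abs_mult using N \<theta>2 \<delta>0 p by (intro mult_mono) auto
    then have 1: "\<bar>(1 / M\<^sup>2) * (\<theta>2 (x \<bullet> b i) * (v \<bullet> b i) * (u \<bullet> b i) * \<delta> (M *\<^sub>R x))\<bar>
       \<le> (1 / M) * ((N + N * N) * frame_norm v * frame_norm u * (C0 + C1))"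
    proof -
      have "\<bar>1 / M\<^sup>2\<bar> \<le> 1 / M" using M(1) by (simp add: field_simps power2_eq_square)
      from mult_mono[OF this \<open>\<bar>\<theta>2 (x \<bullet> b i) * (v \<bullet> b i) * (u \<bullet> b i) * \<delta> (M *\<^sub>R x)\<bar> \<le> _\<close>] M(1)
      show ?thesis unfolding abs_mult[of "1 / M\<^sup>2"] by simp
    qed
    have *: "\<bar>\<theta>1 (x \<bullet> b i) * (v \<bullet> b i) * D1 \<delta> (M *\<^sub>R x) u\<bar> \<le> N * frame_norm v * ((C0 + C1) * frame_norm u)" for u v
      unfolding abs_mult using N \<theta>1 \<delta>1 p by (intro mult_mono) auto
    have "\<bar>(1 / M) * (\<theta>1 (x \<bullet> b i) * (v \<bullet> b i) * D1 \<delta> (M *\<^sub>R x) u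
       + \<theta>1 (x \<bullet> b i) * (u \<bullet> b i) * D1 \<delta> (M *\<^sub>R x) v)\<bar>
       = (1 / M) * \<bar>\<theta>1 (x \<bullet> b i) * (v \<bullet> b i) * D1 \<delta> (M *\<^sub>R x) u
       + \<theta>1 (x \<bullet> b i) * (u \<bullet> b i) * D1 \<delta> (M *\<^sub>R x) v\<bar>"
      using M(1) by (simp add: abs_mult)
    also have "\<dots> \<le> (1 / M) * (N * frame_norm v * ((C0 + C1) * frame_norm u) + N * frame_norm u * ((C0 + C1) * frame_norm v))"
      using M(1) by (intro mult_left_mono abs_add_le *) simp
    finally have "\<bar>E x u v\<bar> \<le> (1 / M) * ((N + N * N) * frame_norm v * frame_norm u * (C0 + C1))
       + (1 / M) * (N * frame_norm v * ((C0 + C1) * frame_norm u) + N * frame_norm u * ((C0 + C1) * frame_norm v))"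
      unfolding E_def using 1 by linarith
    also have "\<dots> = K / M * (frame_norm u * frame_norm v)" using M(1) by (simp add: K_def field_simps)
    finally show ?thesis .
  qed
  have adm: "admissible (H(i := H i + t / 2)) \<zeta>"
  proof (rule admissibleI[OF s\<zeta>])
    have ineq: "1 / M\<^sup>2 \<le> 1" "1 / M \<le> 1" using M(1) by (auto simp: field_simps)
    show "\<bar>\<zeta> x\<bar> \<le> \<bar>t\<bar> / 2 * CW + (C0 + (C0 + C1))" for x
    proof -
      have "\<bar>(t / 2) * W (x \<bullet> b i)\<bar> \<le> \<bar>t\<bar> / 2 * CW" using W(4)[of "x \<bullet> b i"] by (simp add: abs_mult mult_left_mono)
      moreover have "\<bar>\<theta> x * \<delta> (M *\<^sub>R x)\<bar> \<le> 1 * (C0 + C1)" unfolding abs_mult using \<theta>[of x] \<delta>0 by (intro mult_mono) auto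
      then have "\<bar>\<theta> x * \<delta> (M *\<^sub>R x)\<bar> \<le> C0 + C1" by simp
      then have "\<bar>\<phi>0 (M *\<^sub>R x) + \<theta> x * \<delta> (M *\<^sub>R x)\<bar> \<le> C0 + (C0 + C1)" by (rule abs_add_le[OF \<phi>0(3)])
      then have "\<bar>(1 / M\<^sup>2) * (\<phi>0 (M *\<^sub>R x) + \<theta> x * \<delta> (M *\<^sub>R x))\<bar> \<le> 1 * (C0 + (C0 + C1))"
        unfolding abs_mult using ineq by (intro mult_mono) auto
      ultimately have "\<bar>\<zeta> x\<bar> \<le> \<bar>t\<bar> / 2 * CW + 1 * (C0 + (C0 + C1))" unfolding \<zeta>_def by (rule abs_add_le)
      then show ?thesis by simp
    qed
    show "\<bar>D1 \<zeta> x v\<bar> \<le> (\<bar>t\<bar> / 2 * CW + (C0 + ((C0 + C1) + N * (C0 + C1)))) * frame_norm v" for x v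
    proof -
      have "\<bar>(t / 2) * (W' (x \<bullet> b i) * (v \<bullet> b i))\<bar> \<le> \<bar>t\<bar> / 2 * (CW * frame_norm v)"
        unfolding abs_mult using W(5)[of "x \<bullet> b i"] p by (intro mult_mono) auto
      moreover have "\<bar>(1 / M\<^sup>2) * (M * D1 \<phi>0 (M *\<^sub>R x) v +
         (\<theta> x * (M * D1 \<delta> (M *\<^sub>R x) v) + \<theta>1 (x \<bullet> b i) * (v \<bullet> b i) * \<delta> (M *\<^sub>R x)))\<bar>
        \<le> C0 * frame_norm v + ((C0 + C1) * frame_norm v + N * (C0 + C1) * frame_norm v)"
      proof -
        have a: "\<bar>(1 / M) * D1 \<phi>0 (M *\<^sub>R x) v\<bar> \<le> 1 * (C0 * frame_norm v)"
          unfolding abs_mult using ineq M(1) \<phi>0(4) by (intro mult_mono) auto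
        have b: "\<bar>\<theta> x * ((1 / M) * D1 \<delta> (M *\<^sub>R x) v)\<bar> \<le> 1 * (1 * ((C0 + C1) * frame_norm v))"
          unfolding abs_mult using ineq M(1) \<delta>1 \<theta>[of x] by (intro mult_mono) auto
        have c: "\<bar>(1 / M\<^sup>2) * (\<theta>1 (x \<bullet> b i) * (v \<bullet> b i) * \<delta> (M *\<^sub>R x))\<bar> \<le> 1 * (N * frame_norm v * (C0 + C1))"
          unfolding abs_mult using ineq M(1) \<delta>0 \<theta>1 p N \<phi>0(2) \<phi>1(2) by (intro mult_mono) auto
        have e: "(1 / M\<^sup>2) * (M * D1 \<phi>0 (M *\<^sub>R x) v +
         (\<theta> x * (M * D1 \<delta> (M *\<^sub>R x) v) + \<theta>1 (x \<bullet> b i) * (v \<bullet> b i) * \<delta> (M *\<^sub>R x)))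
          = (1 / M) * D1 \<phi>0 (M *\<^sub>R x) v + \<theta> x * ((1 / M) * D1 \<delta> (M *\<^sub>R x) v)
            + (1 / M\<^sup>2) * (\<theta>1 (x \<bullet> b i) * (v \<bullet> b i) * \<delta> (M *\<^sub>R x))"
          using M(1) by (simp add: field_simps power2_eq_square)
        have f: "N * frame_norm v * (C0 + C1) = N * (C0 + C1) * frame_norm v" by simp
        show ?thesis unfolding e using a b c f by linarith
      qed
      ultimately have "\<bar>D1 \<zeta> x v\<bar> \<le> \<bar>t\<bar> / 2 * (CW * frame_norm v)
         + (C0 * frame_norm v + ((C0 + C1) * frame_norm v + N * (C0 + C1) * frame_norm v))"
        unfolding d\<zeta> by (rule abs_add_le)
      also have "\<dots> = (\<bar>t\<bar> / 2 * CW + (C0 + ((C0 + C1) + N * (C0 + C1)))) * frame_norm v"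
        by (simp only: distrib_right mult.assoc)
      finally show ?thesis .
    qed
    show "\<bar>D2 \<zeta> x u v\<bar> \<le> (\<bar>t\<bar> / 2 + C0 + C1 + K / M) * (frame_norm u * frame_norm v)" for x u v
    proof -
      have "\<bar>(t / 2) * ((2 * \<theta> x - 1) * (v \<bullet> b i) * (u \<bullet> b i))\<bar> \<le> \<bar>t\<bar> / 2 * (1 * frame_norm v * frame_norm u)"
        unfolding abs_mult using \<theta>[of x] p by (intro mult_mono) (auto simp: abs_le_iff)
      moreover have "\<bar>(1 - \<theta> x) * D2 \<phi>0 (M *\<^sub>R x) u v\<bar> \<le> 1 * (C0 * (frame_norm u * frame_norm v))"
        unfolding abs_mult using \<theta>[of x] \<phi>0(5) by (intro mult_mono) auto
      moreover have "\<bar>\<theta> x * D2 \<phi>1 (M *\<^sub>R x) u v\<bar> \<le> 1 * (C1 * (frame_norm u * frame_norm v))"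
        unfolding abs_mult using \<theta>[of x] \<phi>1(5) by (intro mult_mono) auto
      moreover note E[of x u v]
      moreover have "(\<bar>t\<bar> / 2 + C0 + C1 + K / M) * (frame_norm u * frame_norm v) = \<bar>t\<bar> / 2 * (1 * frame_norm v * frame_norm u)
        + 1 * (C0 * (frame_norm u * frame_norm v)) + 1 * (C1 * (frame_norm u * frame_norm v)) + K / M * (frame_norm u * frame_norm v)"
        by (simp only: distrib_right mult_1 mult.commute[of "frame_norm v"])
      ultimately show ?thesis unfolding d2\<zeta> by linarith
    qed
    show "0 < \<eta> / 2" using \<eta> by simp
    fix x e assume e: "null_vector e"
    have "(1 - \<theta> x) * (\<eta> * (e \<bullet> b 0)\<^sup>2) \<le> (1 - \<theta> x) * (frame_form H e + D2 \<phi>0 (M *\<^sub>R x) e e)"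
      using \<theta>[of x] \<eta> by (intro mult_left_mono order_trans[OF _ \<phi>0(7)[OF e]] mult_right_mono) auto
    moreover have "\<theta> x * (\<eta> * (e \<bullet> b 0)\<^sup>2) \<le> \<theta> x * (frame_form H' e + D2 \<phi>1 (M *\<^sub>R x) e e)"
      using \<theta>[of x] \<eta> by (intro mult_left_mono order_trans[OF _ \<phi>1(7)[OF e]] mult_right_mono) auto
    moreover have "\<bar>E x e e\<bar> \<le> \<eta> / 2 * (e \<bullet> b 0)\<^sup>2"
    proof -
      have "\<bar>E x e e\<bar> \<le> K / M * (frame_norm e)\<^sup>2" using E[of x e e] by (simp add: power2_eq_square)
      also have "\<dots> \<le> K / M * (9 * (e \<bullet> b 0)\<^sup>2)" using K M(1) by (intro mult_left_mono frame_norm_null e) auto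
      also have "\<dots> = (K / M * 9) * (e \<bullet> b 0)\<^sup>2" by simp
      also have "\<dots> \<le> \<eta> / 2 * (e \<bullet> b 0)\<^sup>2" by (rule mult_right_mono[OF M'(1)]) simp
      finally show ?thesis .
    qed
    moreover have "frame_form (H(i := H i + t / 2)) e + D2 \<zeta> x e e
      = (1 - \<theta> x) * (frame_form H e + D2 \<phi>0 (M *\<^sub>R x) e e)
        + \<theta> x * (frame_form H' e + D2 \<phi>1 (M *\<^sub>R x) e e) + E x e e"
      unfolding H'_def frame_form_upd[OF i] d2\<zeta> by (simp add: algebra_simps power2_eq_square)
    moreover have "\<eta> / 2 * (e \<bullet> b 0)\<^sup>2 = (1 - \<theta> x) * (\<eta> * (e \<bullet> b 0)\<^sup>2) + \<theta> x * (\<eta> * (e \<bullet> b 0)\<^sup>2) - \<eta> / 2 * (e \<bullet> b 0)\<^sup>2"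
      by (simp add: algebra_simps)
    ultimately show "\<eta> / 2 * (e \<bullet> b 0)\<^sup>2 \<le> frame_form (H(i := H i + t / 2)) e + D2 \<zeta> x e e"
      by linarith
  qed
  define G0 where "G0 x = \<bar>H 1 + D2 \<phi>0 x (b 1) (b 1)\<bar>" for x
  define G1 where "G1 x = \<bar>H' 1 + D2 \<phi>1 x (b 1) (b 1)\<bar>" for x
  define G where "G x = \<bar>(H(i := H i + t / 2)) 1 + D2 \<zeta> x (b 1) (b 1)\<bar>" for x
  have cont: "continuous_on UNIV G0" "continuous_on UNIV G1" "continuous_on UNIV G"
    unfolding G0_def[abs_def] G1_def[abs_def] G_def[abs_def]
    by (intro continuous_intros smooth_continuous smooth_D2 \<phi>0 \<phi>1 s\<zeta>)+
  have fb: "frame_norm (b 1) = 1" by (rule frame_norm_frame) simp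
  have bd: "\<bar>H 1 + D2 \<phi>0 x (b 1) (b 1)\<bar> \<le> A" "\<bar>H' 1 + D2 \<phi>1 x (b 1) (b 1)\<bar> \<le> A" for x
    using \<phi>0(5)[of x "b 1" "b 1"] \<phi>1(5)[of x "b 1" "b 1"] \<phi>0(2) \<phi>1(2) unfolding fb A_def by linarith+
  have Gbd: "\<bar>G0 x\<bar> \<le> A" "\<bar>G1 x\<bar> \<le> A" for x using bd[of x] by (auto simp: G0_def G1_def)
  have c\<theta>: "continuous_on UNIV \<theta>" by (rule smooth_continuous[OF s\<theta>])
  have G_ge: "(1 - \<theta> x) * G0 (M *\<^sub>R x) + \<theta> x * G1 (M *\<^sub>R x) - A * (4 * \<theta> x * (1 - \<theta> x)) - K / M \<le> G x" for x
  proof -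
    let ?a = "H 1 + D2 \<phi>0 (M *\<^sub>R x) (b 1) (b 1)" and ?a' = "H' 1 + D2 \<phi>1 (M *\<^sub>R x) (b 1) (b 1)"
    have "(H(i := H i + t / 2)) 1 + D2 \<zeta> x (b 1) (b 1) = ((1 - \<theta> x) * ?a + \<theta> x * ?a') + E x (b 1) (b 1)"
      unfolding d2\<zeta> H'_def using i orthonormal[of 1 i] by (auto simp: algebra_simps)
    moreover have "\<bar>E x (b 1) (b 1)\<bar> \<le> K / M" using E[of x "b 1" "b 1"] unfolding fb by simp
    moreover have "(1 - \<theta> x) * \<bar>?a\<bar> + \<theta> x * \<bar>?a'\<bar> - A * (4 * \<theta> x * (1 - \<theta> x)) \<le> \<bar>(1 - \<theta> x) * ?a + \<theta> x * ?a'\<bar>"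
      using \<theta>[of x] by (intro abs_convex_combination_ge bd) auto
    ultimately show ?thesis unfolding G_def G0_def G1_def by linarith
  qed
  have "mean_ge (m * (pi / 2) + r0 + (m' * (pi / 2) + r1) + A * rN) G ((m + m') / 2 - \<epsilon>)"
    unfolding mean_ge_def
  proof (intro conjI allI impI)
    have rN: "0 \<le> rN" using two[OF norm_frame[OF i]] by (simp add: mean_ge_def)
    show "0 \<le> m * (pi / 2) + r0 + (m' * (pi / 2) + r1) + A * rN" using m r01 A rN by simp
    fix \<psi> D :: "'a \<Rightarrow> real" assume w: "weight \<psi> D"
    define I J where "I = (LBINT x. \<psi> x)" and "J = (LBINT x. D x)"
    have I: "0 \<le> I" using weight_integral_nonneg[OF w] by (simp add: I_def)
    have lip: "\<bar>\<theta> x - \<theta> y\<bar> \<le> N * norm (x - y)" for x y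
    proof -
      have "\<bar>\<theta> x - \<theta> y\<bar> \<le> N * \<bar>x \<bullet> b i - y \<bullet> b i\<bar>" unfolding \<theta>_def using N by (intro switch_Lipschitz) simp
      also have "\<dots> \<le> N * norm (x - y)"
        using N Cauchy_Schwarz_ineq2[of "x - y" "b i"] norm_frame[OF i] by (intro mult_left_mono) (auto simp: inner_diff_left)
      finally show ?thesis .
    qed
    note half = mean_ge_switch[OF norm_frame[OF i], of N, folded \<theta>_def]
    have 0: "(m / 2 - r0 * N / M) * I - (m * (pi / 2) + r0) * J \<le> (LBINT x. \<psi> x * ((1 - \<theta> x) * G0 (M *\<^sub>R x)))"
      unfolding I_def J_def
    proof (rule mean_ge_switched[OF V0[folded G0_def] cont(1) Gbd(1) m(1) M(1) _ _ _ _ _ half(2) w])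
      show "\<bar>(1 - \<theta> x) - (1 - \<theta> y)\<bar> \<le> N * norm (x - y)" for x y using lip[of x y] by linarith
    qed (use N \<theta> in \<open>auto intro!: continuous_intros c\<theta> simp: less_imp_le\<close>)
    have 1: "(m' / 2 - r1 * N / M) * I - (m' * (pi / 2) + r1) * J \<le> (LBINT x. \<psi> x * (\<theta> x * G1 (M *\<^sub>R x)))"
      unfolding I_def J_def
      by (rule mean_ge_switched[OF V1[folded G1_def] cont(2) Gbd(2) m(2) M(1) _ c\<theta> _ _ lip half(1) w]) (use N \<theta> in \<open>auto simp: less_imp_le\<close>)
    have 2: "(1 - \<epsilon>') * I - rN * J \<le> (LBINT x. \<psi> x * (1 - 4 * \<theta> x * (1 - \<theta> x)))"
      using mean_geD[OF two[OF norm_frame[OF i]] w] by (simp add: I_def J_def \<theta>_def)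
    have cM: "continuous_on UNIV (\<lambda>x. G0 (M *\<^sub>R x))" "continuous_on UNIV (\<lambda>x. G1 (M *\<^sub>R x))"
      by (rule continuous_on_compose2[OF cont(1)] continuous_on_compose2[OF cont(2)]; auto intro!: continuous_intros)+
    have int0: "integrable lborel (\<lambda>x. \<psi> x * ((1 - \<theta> x) * G0 (M *\<^sub>R x)))"
    proof (rule integrable_mult_bounded_continuous[OF weightD(1)[OF w]])
      show "\<bar>(1 - \<theta> x) * G0 (M *\<^sub>R x)\<bar> \<le> 1 * A" for x unfolding abs_mult using \<theta>[of x] Gbd by (intro mult_mono) auto
    qed (intro continuous_intros c\<theta> cM)
    have int1: "integrable lborel (\<lambda>x. \<psi> x * (\<theta> x * G1 (M *\<^sub>R x)))"
    proof (rule integrable_mult_bounded_continuous[OF weightD(1)[OF w]])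
      show "\<bar>\<theta> x * G1 (M *\<^sub>R x)\<bar> \<le> 1 * A" for x unfolding abs_mult using \<theta>[of x] Gbd by (intro mult_mono) auto
    qed (intro continuous_intros c\<theta> cM)
    have int2: "integrable lborel (\<lambda>x. \<psi> x * (1 - 4 * \<theta> x * (1 - \<theta> x)))"
    proof (rule integrable_mult_bounded_continuous[OF weightD(1)[OF w]])
      show "\<bar>1 - 4 * \<theta> x * (1 - \<theta> x)\<bar> \<le> 1 + 4 * 1 * 1" for x
      proof -
        have "\<bar>4 * \<theta> x * (1 - \<theta> x)\<bar> \<le> 4 * 1 * 1" unfolding abs_mult using \<theta>[of x] by (intro mult_mono) auto
        then show ?thesis by linarith
      qed
    qed (intro continuous_intros c\<theta>)
    obtain C2 where C2: "\<And>x u v. \<bar>D2 \<zeta> x u v\<bar> \<le> C2 * (frame_norm u * frame_norm v)"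
      using adm by (rule admissibleE) (rule that)
    have "\<bar>G x\<bar> \<le> \<bar>(H(i := H i + t / 2)) 1\<bar> + C2" for x
      using abs_add_le[OF order_refl C2[of x "b 1" "b 1"]] unfolding G_def fb abs_abs by simp
    then have intG: "integrable lborel (\<lambda>x. \<psi> x * G x)"
      by (rule integrable_mult_bounded_continuous[OF weightD(1)[OF w] cont(3)])
    define X0 X1 X2 Z where "X0 = (LBINT x. \<psi> x * ((1 - \<theta> x) * G0 (M *\<^sub>R x)))"
      and "X1 = (LBINT x. \<psi> x * (\<theta> x * G1 (M *\<^sub>R x)))"
      and "X2 = (LBINT x. \<psi> x * (1 - 4 * \<theta> x * (1 - \<theta> x)))" and "Z = (LBINT x. \<psi> x * G x)"
    have h2: "A * ((1 - \<epsilon>') * I - rN * J) \<le> A * X2"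
      unfolding X2_def using 2 A by (intro mult_left_mono)
    have h3: "X0 + X1 + A * X2 - (A + K / M) * I \<le> Z"
    proof -
      have "X0 + X1 + A * X2 - (A + K / M) * I
        = (LBINT x. \<psi> x * ((1 - \<theta> x) * G0 (M *\<^sub>R x)) + \<psi> x * (\<theta> x * G1 (M *\<^sub>R x)) + A * (\<psi> x * (1 - 4 * \<theta> x * (1 - \<theta> x))) - (A + K / M) * \<psi> x)"
        unfolding I_def X0_def X1_def X2_def using int0 int1 int2 weightD(1)[OF w] by simp
      also have "\<dots> \<le> Z"
        unfolding Z_def
      proof (rule integral_mono)
        show "integrable lborel (\<lambda>x. \<psi> x * ((1 - \<theta> x) * G0 (M *\<^sub>R x)) + \<psi> x * (\<theta> x * G1 (M *\<^sub>R x)) + A * (\<psi> x * (1 - 4 * \<theta> x * (1 - \<theta> x))) - (A + K / M) * \<psi> x)"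
          by (intro Bochner_Integration.integrable_add Bochner_Integration.integrable_diff integrable_mult_right int0 int1 int2 weightD(1)[OF w])
        fix x
        have "\<psi> x * ((1 - \<theta> x) * G0 (M *\<^sub>R x) + \<theta> x * G1 (M *\<^sub>R x) - A * (4 * \<theta> x * (1 - \<theta> x)) - K / M) \<le> \<psi> x * G x"
          using G_ge weightD(3)[OF w] by (intro mult_left_mono) auto
        then show "\<psi> x * ((1 - \<theta> x) * G0 (M *\<^sub>R x)) + \<psi> x * (\<theta> x * G1 (M *\<^sub>R x)) + A * (\<psi> x * (1 - 4 * \<theta> x * (1 - \<theta> x))) - (A + K / M) * \<psi> x \<le> \<psi> x * G x"
          by (simp add: algebra_simps)
      qed (rule intG)
      finally show ?thesis .
    qed
    have h4: "((r0 + r1) * N / M + K / M + A * \<epsilon>') * I \<le> \<epsilon> * I"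
      using add_mono[OF M'(2) \<epsilon>'(2)] I by (intro mult_right_mono) auto
    let ?R = "m * (pi / 2) + r0 + (m' * (pi / 2) + r1) + A * rN"
    have "((m + m') / 2 - \<epsilon>) * I - ?R * J = ((m + m') / 2) * I - \<epsilon> * I - ?R * J"
      by (simp only: left_diff_distrib)
    also have "\<dots> \<le> ((m + m') / 2) * I - ((r0 + r1) * N / M + K / M + A * \<epsilon>') * I - ?R * J"
      by (intro diff_right_mono diff_left_mono h4)
    also have "\<dots> = ((m / 2 - r0 * N / M) * I - (m * (pi / 2) + r0) * J) + ((m' / 2 - r1 * N / M) * I - (m' * (pi / 2) + r1) * J)
        + A * ((1 - \<epsilon>') * I - rN * J) - (A + K / M) * I"
      by (simp add: algebra_simps add_divide_distrib)
    also have "\<dots> \<le> X0 + X1 + A * X2 - (A + K / M) * I"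
      by (intro diff_right_mono add_mono 0[folded X0_def] 1[folded X1_def] h2)
    also note h3
    finally have "((m + m') / 2 - \<epsilon>) * I - ?R * J \<le> Z" .
    then show "((m + m') / 2 - \<epsilon>) * (LBINT x. \<psi> x) - (m * (pi / 2) + r0 + (m' * (pi / 2) + r1) + A * rN) * (LBINT x. D x)
      \<le> (LBINT x. \<psi> x * G x)" by (simp only: I_def J_def Z_def)
  qed
  with adm show ?thesis unfolding attains_def G_def by blast
qed

text \<open>
  Otherwise the supremum of the attained means is finite for every \<open>null_positive\<close> $H$, and it contradicts
  \<open>no_finite_separately_concave_majorant\<close>.
\<close>

lemma unbounded_hessian_mean:
  obtains H where "null_positive H" "\<And>m. attains H m"
proof (rule ccontr)
  assume "\<not> thesis"
  then have no: "\<And>H. null_positive H \<Longrightarrow> \<exists>m. \<not> attains H m" using that by blast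
  have bdd: "bdd_above {m. attains H m}" if H: "null_positive H" for H
  proof -
    obtain m where m: "\<not> attains H m" using no[OF H] by blast
    have "m' \<le> m" if "attains H m'" for m' using m attains_mono[OF that, of m] by linarith
    then show ?thesis by (intro bdd_aboveI) auto
  qed
  define B where "B H = Sup {m. attains H m}" for H
  have up: "m \<le> B H" if "null_positive H" "attains H m" for H m
    unfolding B_def using that by (intro cSup_upper bdd) auto
  have least: "B H \<le> a" if "null_positive H" "\<And>m. attains H m \<Longrightarrow> m \<le> a" for H a
    unfolding B_def using attains_self[OF that(1)] that(2) by (intro cSup_least) auto
  have least0: "B H \<le> a" if H: "null_positive H" and "\<And>m. attains H m \<Longrightarrow> 0 \<le> m \<Longrightarrow> m \<le> a" for H a
  proof (rule least[OF H])
    fix m assume "attains H m"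
    show "m \<le> a" using that(2)[OF attains_self[OF H]] that(2)[OF \<open>attains H m\<close>] by (cases "0 \<le> m") auto
  qed
  have mid: "(B H + B (H(i := H i + t))) / 2 \<le> B (H(i := H i + t / 2))"
    if "i < 3" "null_positive H" "null_positive (H(i := H i + t))" "null_positive (H(i := H i + t / 2))" for H i t
  proof -
    let ?b = "B (H(i := H i + t / 2))"
    have *: "m + m' \<le> 2 * ?b" if "attains H m" "0 \<le> m" "attains (H(i := H i + t)) m'" "0 \<le> m'" for m m'
    proof -
      have "(m + m') / 2 \<le> ?b"
      proof (rule field_le_epsilon)
        fix e :: real assume "0 < e"
        then have "attains (H(i := H i + t / 2)) ((m + m') / 2 - e)" using that \<open>i < 3\<close> by (intro attains_midpoint) auto
        from up[OF \<open>null_positive (H(i := H i + t / 2))\<close> this] show "(m + m') / 2 \<le> ?b + e" by argo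
      qed
      then show ?thesis by simp
    qed
    have "B H \<le> 2 * ?b - B (H(i := H i + t))"
    proof (rule least0[OF that(2)])
      fix m assume m: "attains H m" "0 \<le> m"
      have "B (H(i := H i + t)) \<le> 2 * ?b - m"
        by (rule least0[OF that(3)]) (use *[OF m] in fastforce)
      then show "m \<le> 2 * ?b - B (H(i := H i + t))" by simp
    qed
    then show ?thesis by simp
  qed
  define vec :: "real \<Rightarrow> real \<Rightarrow> real \<Rightarrow> nat \<Rightarrow> real" where "vec x y z = (\<lambda>i. if i = 0 then x else if i = 1 then y else z)" for x y z
  have pos: "null_positive (vec x y z) \<longleftrightarrow> 0 < x + y \<and> 0 < x + z" for x y z
    by (simp add: null_positive_def vec_def)
  have half: "s + (s' - s) / 2 = (s + s') / 2" for s s' :: real by (simp add: field_simps)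
  have upd: "(vec x y z)(0 := vec x y z 0 + (x' - x)) = vec x' y z" "(vec x y z)(0 := vec x y z 0 + (x' - x) / 2) = vec ((x + x') / 2) y z"
    "(vec x y z)(1 := vec x y z 1 + (x' - y)) = vec x x' z" "(vec x y z)(1 := vec x y z 1 + (x' - y) / 2) = vec x ((y + x') / 2) z" for x y z x'
    by (auto simp: vec_def fun_eq_iff half)
  show False
  proof (rule no_finite_separately_concave_majorant[of "\<lambda>x y z. B (vec x y z)"])
    show "\<bar>y\<bar> \<le> B (vec x y z)" if "0 < x + y" "0 < x + z" for x y z
      using up[OF _ attains_self, of "vec x y z"] that by (simp add: pos) (simp add: vec_def)
    show "B (vec (t * x) (t * y) (t * z)) = t * B (vec x y z)" if t: "0 < t" and "0 < x + y" "0 < x + z" for t x y z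
    proof -
      have p: "null_positive (vec x y z)" using that by (simp add: pos)
      have p': "null_positive (vec (t * x) (t * y) (t * z))" using that by (simp add: pos flip: distrib_left)
      have sc: "(\<lambda>i. s * vec x y z i) = vec (s * x) (s * y) (s * z)" for s x y z by (auto simp: vec_def)
      have 1: "t * m \<le> B (vec (t * x) (t * y) (t * z))" if "attains (vec x y z) m" for m
        using up[OF p'] attains_scale[OF that t] by (simp add: sc)
      have "B (vec x y z) \<le> B (vec (t * x) (t * y) (t * z)) / t"
        by (rule least[OF p]) (use 1 t in \<open>simp add: field_simps\<close>)
      moreover have "B (vec (t * x) (t * y) (t * z)) \<le> t * B (vec x y z)"
      proof (rule least[OF p'])
        fix m assume "attains (vec (t * x) (t * y) (t * z)) m"
        from attains_scale[OF this, of "1/t"] t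
        have "attains (vec (1 / t * (t * x)) (1 / t * (t * y)) (1 / t * (t * z))) (1 / t * m)" unfolding sc by simp
        then have "attains (vec x y z) (m / t)" using t by simp
        from up[OF p this] t show "m \<le> t * B (vec x y z)" by (simp add: field_simps)
      qed
      ultimately show ?thesis using t by (simp add: field_simps)
    qed
    show "(B (vec x y z) + B (vec x' y z)) / 2 \<le> B (vec ((x + x') / 2) y z)"
      if "0 < x + y" "0 < x + z" "0 < x' + y" "0 < x' + z" for x x' y z
    proof -
      have "0 < (x + x') / 2 + y" "0 < (x + x') / 2 + z" using that by (simp_all add: field_simps)
      then show ?thesis using mid[of 0 "vec x y z" "x' - x"] that unfolding upd pos by simp
    qed
    show "(B (vec x y z) + B (vec x y' z)) / 2 \<le> B (vec x ((y + y') / 2) z)"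
      if "0 < x + y" "0 < x + z" "0 < x + y'" for x y y' z
    proof -
      have "0 < x + (y + y') / 2" using that by (simp add: field_simps)
      then show ?thesis using mid[of 1 "vec x y z" "y' - y"] that unfolding upd pos by simp
    qed
    show "(B (vec x y z) + B (vec x y z')) / 2 \<le> B (vec x y ((z + z') / 2))"
      if z: "0 < x + y" "0 < x + z" "0 < x + z'" for x y z z'
    proof -
      have eq: "attains H m \<longleftrightarrow> attains H' m" if "H 0 = H' 0" "H 1 = H' 1" "H 2 = H' 2" for H H' m
      proof -
        have "frame_form H = frame_form H'" using that by (auto simp: frame_form_def eval_nat_numeral)
        then show ?thesis using that by (simp add: attains_def admissible_def)
      qed
      have Beq: "B H = B H'" if "H 0 = H' 0" "H 1 = H' 1" "H 2 = H' 2" for H H'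
      proof -
        have "{m. attains H m} = {m. attains H' m}" using eq[OF that] by blast
        then show ?thesis by (simp only: B_def)
      qed
      have e: "B ((vec x y z)(2 := vec x y z 2 + (z' - z))) = B (vec x y z')"
        "B ((vec x y z)(2 := vec x y z 2 + (z' - z) / 2)) = B (vec x y ((z + z') / 2))"
        by (rule Beq; simp add: vec_def half)+
      have "0 < x + (z + z') / 2" using z by (simp add: field_simps)
      then have "null_positive (vec x y z)" "null_positive ((vec x y z)(2 := vec x y z 2 + (z' - z)))"
        "null_positive ((vec x y z)(2 := vec x y z 2 + (z' - z) / 2))"
        using z by (simp_all add: null_positive_def vec_def half)
      from mid[OF _ this] show ?thesis unfolding e by simp
    qed
  qed
qed

end

section \<open>Second differences and distributional second derivatives\<close>

lemma D2_eq_0: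
  assumes "open U" "\<And>x. x \<in> U \<Longrightarrow> \<phi> x = 0" "x \<in> U"
  shows "D1 \<phi> x u = 0" "D2 \<phi> x u v = 0"
proof -
  have *: "D1 \<psi> y w = 0" if "\<And>x. x \<in> U \<Longrightarrow> \<psi> x = 0" "y \<in> U" for \<psi> :: "'a \<Rightarrow> real" and y w
  proof -
    have "(\<psi> has_derivative (\<lambda>_. 0)) (at y)"
      by (rule has_derivative_transform_within_open[OF has_derivative_const[of 0] assms(1) that(2)]) (use that in auto)
    from frechet_derivative_at[OF this] show ?thesis by metis
  qed
  show "D1 \<phi> x u = 0" by (rule *[OF assms(2,3)])
  show "D2 \<phi> x u v = 0" unfolding second_derivative_def
    by (rule *[OF *[OF assms(2)] assms(3)])
qed

lemma set_integral_test_function: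
  assumes "\<phi> \<in> test_functions \<Omega>"
  shows "(LINT x:\<Omega>|lborel. f x * D2 \<phi> x e e) = (LBINT x. f x * D2 \<phi> x e e)"
  unfolding set_lebesgue_integral_def
proof (rule Bochner_Integration.integral_cong[OF refl])
  fix x
  have "D2 \<phi> x e e = 0" if "x \<notin> \<Omega>"
  proof (rule D2_eq_0(2)[of "- closure {x. \<phi> x \<noteq> 0}"])
    show "\<phi> y = 0" if "y \<in> - closure {x. \<phi> x \<noteq> 0}" for y
      using that closure_subset[of "{x. \<phi> x \<noteq> 0}"] by blast
  qed (use assms that in \<open>auto simp: test_functions_def\<close>)
  then show "indicat_real \<Omega> x *\<^sub>R (f x * D2 \<phi> x e e) = f x * D2 \<phi> x e e"
    by (auto simp: indicator_def)
qed

definition second_difference :: "real \<Rightarrow> 'a::euclidean_space \<Rightarrow> ('a \<Rightarrow> real) \<Rightarrow> 'a \<Rightarrow> real" where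
  "second_difference h e f x = f (x + h *\<^sub>R e) + f (x - h *\<^sub>R e) - 2 * f x"

lemma second_difference_Taylor:
  assumes "smooth \<phi>"
  obtains s t where "\<bar>s\<bar> \<le> \<bar>h\<bar>" "\<bar>t\<bar> \<le> \<bar>h\<bar>"
    "second_difference h e \<phi> x = h\<^sup>2 / 2 * (D2 \<phi> (x + s *\<^sub>R e) e e + D2 \<phi> (x + t *\<^sub>R e) e e)"
proof -
  define g where "g m s = (if m = 0 then \<phi> (x + s *\<^sub>R e) else if m = 1 then D1 \<phi> (x + s *\<^sub>R e) e
     else D2 \<phi> (x + s *\<^sub>R e) e e)" for m :: nat and s
  have line: "((\<lambda>s. x + s *\<^sub>R e) has_derivative (\<lambda>s. s *\<^sub>R e)) (at s)" for s
    by (auto intro!: derivative_eq_intros)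
  have der: "(g m has_real_derivative g (Suc m) s) (at s)" if "m < 2" for m s
  proof -
    have lin: "D1 \<phi> y (r *\<^sub>R e) = D1 \<phi> y e * r"
      "D2 \<phi> y e (r *\<^sub>R e) = D2 \<phi> y e e * r" for y r
      using linear_scale[OF has_derivative_linear[OF smooth_has_derivative[OF assms]], of y r e]
        linear_scale[OF has_derivative_linear[OF smooth_D1_has_derivative[OF assms, of e]], of y r e] by (simp_all add: mult.commute)
    have "((\<lambda>s. \<phi> (x + s *\<^sub>R e)) has_derivative (\<lambda>r. D1 \<phi> (x + s *\<^sub>R e) (r *\<^sub>R e))) (at s)"
      by (rule has_derivative_compose[OF line smooth_has_derivative[OF assms]])
    moreover have "((\<lambda>s. D1 \<phi> (x + s *\<^sub>R e) e) has_derivative (\<lambda>r. D2 \<phi> (x + s *\<^sub>R e) e (r *\<^sub>R e))) (at s)"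
      by (rule has_derivative_compose[OF line smooth_D1_has_derivative[OF assms]])
    ultimately show ?thesis
      using that unfolding lin has_field_derivative_def g_def[abs_def]
      by (cases "m = 0") (simp_all add: less_2_cases_iff)
  qed
  have T: "\<exists>t. \<bar>t\<bar> \<le> \<bar>k\<bar> \<and> g 0 k = (\<Sum>m<2. g m 0 / fact m * k ^ m) + g 2 t / fact 2 * k ^ 2" for k
    by (rule Maclaurin_bi_le[OF refl]) (use der in blast)
  obtain s where s: "\<bar>s\<bar> \<le> \<bar>h\<bar>" "g 0 h = (\<Sum>m<2. g m 0 / fact m * h ^ m) + g 2 s / fact 2 * h ^ 2" using T by blast
  obtain t where t: "\<bar>t\<bar> \<le> \<bar>-h\<bar>" "g 0 (-h) = (\<Sum>m<2. g m 0 / fact m * (-h) ^ m) + g 2 t / fact 2 * (-h) ^ 2" using T by blast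
  have "second_difference h e \<phi> x = g 0 h + g 0 (-h) - 2 * g 0 0" by (simp add: second_difference_def g_def)
  also have "\<dots> = h\<^sup>2 / 2 * (g 2 s + g 2 t)"
    unfolding s(2) t(2) by (simp add: eval_nat_numeral algebra_simps)
  finally show thesis using s(1) t(1) that by (simp add: g_def)
qed

lemma second_difference_le:
  assumes "smooth \<phi>" "\<And>x. \<bar>D2 \<phi> x e e\<bar> \<le> C"
  shows "\<bar>second_difference h e \<phi> x\<bar> \<le> C * h\<^sup>2"
proof -
  obtain s t where *: "second_difference h e \<phi> x = h\<^sup>2 / 2 * (D2 \<phi> (x + s *\<^sub>R e) e e + D2 \<phi> (x + t *\<^sub>R e) e e)"
    by (rule second_difference_Taylor[OF assms(1), of h e x])
  have "\<bar>second_difference h e \<phi> x\<bar> = \<bar>h\<^sup>2 / 2\<bar> * \<bar>D2 \<phi> (x + s *\<^sub>R e) e e + D2 \<phi> (x + t *\<^sub>R e) e e\<bar>"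
    unfolding * by (rule abs_mult)
  also have "\<dots> \<le> h\<^sup>2 / 2 * (C + C)" by (intro mult_mono abs_add_le assms) auto
  finally show ?thesis by (simp add: mult.commute)
qed

abbreviation (input) second_quotient :: "nat \<Rightarrow> 'a::euclidean_space \<Rightarrow> ('a \<Rightarrow> real) \<Rightarrow> 'a \<Rightarrow> real"
  where "second_quotient n e f x \<equiv> (real (Suc n))\<^sup>2 * second_difference (1 / real (Suc n)) e f x"

lemma second_quotient_tendsto:
  assumes "smooth \<phi>"
  shows "(\<lambda>n. second_quotient n e \<phi> x) \<longlonglongrightarrow> D2 \<phi> x e e"
proof -
  have "\<forall>n. \<exists>s t. \<bar>s\<bar> \<le> \<bar>1 / real (Suc n)\<bar> \<and> \<bar>t\<bar> \<le> \<bar>1 / real (Suc n)\<bar> \<and> second_difference (1 / real (Suc n)) e \<phi> x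
     = (1 / real (Suc n))\<^sup>2 / 2 * (D2 \<phi> (x + s *\<^sub>R e) e e + D2 \<phi> (x + t *\<^sub>R e) e e)"
  proof
    fix n
    show "\<exists>s t. \<bar>s\<bar> \<le> \<bar>1 / real (Suc n)\<bar> \<and> \<bar>t\<bar> \<le> \<bar>1 / real (Suc n)\<bar> \<and> second_difference (1 / real (Suc n)) e \<phi> x
     = (1 / real (Suc n))\<^sup>2 / 2 * (D2 \<phi> (x + s *\<^sub>R e) e e + D2 \<phi> (x + t *\<^sub>R e) e e)"
      by (rule second_difference_Taylor[OF assms, of "1 / real (Suc n)" e x]) blast
  qed
  then obtain s t where st: "\<And>n. \<bar>s n\<bar> \<le> \<bar>1 / real (Suc n)\<bar>" "\<And>n. \<bar>t n\<bar> \<le> \<bar>1 / real (Suc n)\<bar>"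
    "\<And>n. second_difference (1 / real (Suc n)) e \<phi> x
     = (1 / real (Suc n))\<^sup>2 / 2 * (D2 \<phi> (x + s n *\<^sub>R e) e e + D2 \<phi> (x + t n *\<^sub>R e) e e)"
    by metis
  have z: "(\<lambda>n. 1 / real (Suc n)) \<longlonglongrightarrow> 0" by (rule LIMSEQ_Suc[OF lim_1_over_n])
  have s0: "s \<longlonglongrightarrow> 0" "t \<longlonglongrightarrow> 0"
    by (rule Lim_null_comparison[OF _ z], use st in \<open>auto intro: always_eventually\<close>)+
  have cont: "isCont (\<lambda>y. D2 \<phi> y e e) x"
    using smooth_continuous[OF smooth_D2[OF assms]] by (simp add: continuous_on_eq_continuous_at)
  have "(\<lambda>n. x + s n *\<^sub>R e) \<longlonglongrightarrow> x" "(\<lambda>n. x + t n *\<^sub>R e) \<longlonglongrightarrow> x"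
    using s0 by (auto intro!: tendsto_eq_intros)
  then have "(\<lambda>n. D2 \<phi> (x + s n *\<^sub>R e) e e) \<longlonglongrightarrow> D2 \<phi> x e e"
    "(\<lambda>n. D2 \<phi> (x + t n *\<^sub>R e) e e) \<longlonglongrightarrow> D2 \<phi> x e e"
    using isCont_tendsto_compose[OF cont] by blast+
  then have L: "(\<lambda>n. (D2 \<phi> (x + s n *\<^sub>R e) e e + D2 \<phi> (x + t n *\<^sub>R e) e e) / 2)
     \<longlonglongrightarrow> (D2 \<phi> x e e + D2 \<phi> x e e) / 2" by (intro tendsto_intros) auto
  have eq: "second_quotient n e \<phi> x
     = (D2 \<phi> (x + s n *\<^sub>R e) e e + D2 \<phi> (x + t n *\<^sub>R e) e e) / 2" for n
    unfolding st(3) by (simp add: field_simps power_divide)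
  show ?thesis unfolding eq using L by simp
qed

lemma continuous_integrable_lborel:
  fixes g :: "'a::euclidean_space \<Rightarrow> real"
  assumes "continuous_on UNIV g" "\<And>x. x \<notin> cball c R \<Longrightarrow> g x = 0"
  shows "integrable lborel g"
proof -
  have "integrable lborel (\<lambda>x. indicator (cball c R) x *\<^sub>R g x)"
    using assms(1) by (intro borel_integrable_compact) (auto intro: continuous_on_subset)
  moreover have "(\<lambda>x. indicator (cball c R) x *\<^sub>R g x) = g"
  proof
    show "indicator (cball c R) x *\<^sub>R g x = g x" for x using assms(2)[of x] by (auto simp: indicator_def)
  qed
  ultimately show ?thesis by (simp only:)
qed

lemma continuous_bounded_cball:
  fixes g :: "'a::euclidean_space \<Rightarrow> real"
  assumes "continuous_on UNIV g"
  obtains C where "0 \<le> C" "\<And>x. x \<in> cball c R \<Longrightarrow> \<bar>g x\<bar> \<le> C"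
proof -
  have "compact (g ` cball c R)" using assms by (intro compact_continuous_image) (auto intro: continuous_on_subset)
  then have "bounded (g ` cball c R)" by (rule compact_imp_bounded)
  then obtain C where C: "\<forall>y\<in>g ` cball c R. norm y \<le> C" unfolding bounded_iff by blast
  have "\<bar>g x\<bar> \<le> max 0 C" if "x \<in> cball c R" for x
  proof -
    have "norm (g x) \<le> C" using C that by blast
    then show ?thesis by simp
  qed
  then show thesis using that[of "max 0 C"] by simp
qed

lemma D2_vanishes:
  assumes "\<And>x. x \<notin> cball c R \<Longrightarrow> \<phi> x = 0" "x \<notin> cball c R"
  shows "D2 \<phi> x u v = 0"
  by (rule D2_eq_0(2)[of "- cball c R"]) (use assms in auto)

lemma D2_bounded:
  fixes \<phi> :: "'a::euclidean_space \<Rightarrow> real"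
  assumes "smooth \<phi>" "\<And>x. x \<notin> cball c R \<Longrightarrow> \<phi> x = 0"
  obtains C where "0 \<le> C" "\<And>x. \<bar>D2 \<phi> x u v\<bar> \<le> C"
proof -
  obtain C where C: "0 \<le> C" "\<And>x. x \<in> cball c R \<Longrightarrow> \<bar>D2 \<phi> x u v\<bar> \<le> C"
    using continuous_bounded_cball[OF smooth_continuous[OF smooth_D2[OF assms(1)]]] by metis
  have "\<bar>D2 \<phi> x u v\<bar> \<le> C" for x
    using C(1) C(2)[of x] D2_vanishes[of c R \<phi> x u v] assms(2) by (cases "x \<in> cball c R") auto
  with C that show thesis by blast
qed

lemma second_difference_vanishes:
  assumes "\<And>x. x \<notin> cball c R \<Longrightarrow> \<phi> x = 0" "x \<notin> cball c (R + norm e)" "0 \<le> h" "h \<le> 1"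
  shows "second_difference h e \<phi> x = 0"
proof -
  have "norm (h *\<^sub>R e) \<le> norm e" using assms(3,4) by (simp add: mult_left_le_one_le)
  moreover have "R + norm e < norm (x - c)" using assms(2) by (simp add: dist_norm norm_minus_commute)
  moreover have "norm (x - c) \<le> norm (x + h *\<^sub>R e - c) + norm (h *\<^sub>R e)" "norm (x - c) \<le> norm (x - h *\<^sub>R e - c) + norm (h *\<^sub>R e)"
    using norm_triangle_ineq4[of "x + h *\<^sub>R e - c" "h *\<^sub>R e"] norm_triangle_ineq[of "x - h *\<^sub>R e - c" "h *\<^sub>R e"] by (simp_all add: algebra_simps)
  ultimately have "R < norm (x + h *\<^sub>R e - c)" "R < norm (x - h *\<^sub>R e - c)" "R < norm (x - c)"
    using norm_ge_zero[of e] by linarith+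
  then have "x + h *\<^sub>R e \<notin> cball c R" "x - h *\<^sub>R e \<notin> cball c R" "x \<notin> cball c R"
    by (simp_all add: dist_norm norm_minus_commute[of c])
  then show ?thesis by (simp add: second_difference_def assms(1))
qed

lemma continuous_on_translate:
  fixes f :: "'a::euclidean_space \<Rightarrow> real"
  assumes "continuous_on UNIV f"
  shows "continuous_on UNIV (\<lambda>x. f (x + d))" "continuous_on UNIV (\<lambda>x. f (x - d))"
  by (rule continuous_on_compose2[OF assms]; auto intro!: continuous_intros)+

lemma continuous_on_second_difference:
  "continuous_on UNIV f \<Longrightarrow> continuous_on UNIV (second_difference h e f)"
  unfolding second_difference_def[abs_def]
  by (intro continuous_on_add continuous_on_diff continuous_on_mult continuous_on_const continuous_on_translate)

text \<open>
  Summation by parts: translation invariance of Lebesgue measure moves the second difference to the other factor.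
  Passing to the limit of second difference quotients then
  gives integration by parts without Fubini's theorem along lines.
\<close>

lemma integral_second_difference_swap:
  fixes f \<phi> :: "'a::euclidean_space \<Rightarrow> real"
  assumes f: "continuous_on UNIV f" and \<phi>: "continuous_on UNIV \<phi>" "\<And>x. x \<notin> cball c R \<Longrightarrow> \<phi> x = 0"
  shows "(LBINT x. f x * second_difference h e \<phi> x) = (LBINT x. second_difference h e f x * \<phi> x)"
proof -
  have tr: "(LBINT x. f x * \<phi> (x + d)) = (LBINT x. f (x - d) * \<phi> x)" for d
    using lborel_integral_translation[of "\<lambda>x. f (x - d) * \<phi> x" d] by simp
  have i0: "integrable lborel (\<lambda>x. f (x - d) * \<phi> x)" for d
    by (rule continuous_integrable_lborel[of _ c R])
       (use \<phi> in \<open>auto intro!: continuous_on_mult continuous_on_translate f\<close>)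
  have i1: "integrable lborel (\<lambda>x. f x * \<phi> (x + d))" for d
    using lborel_integrable_translation[OF i0[of d], of d] by simp
  have "(LBINT x. f x * second_difference h e \<phi> x)
    = (LBINT x. f x * \<phi> (x + h *\<^sub>R e) + f x * \<phi> (x + (- (h *\<^sub>R e))) - 2 * (f x * \<phi> (x + 0)))"
    by (intro Bochner_Integration.integral_cong refl) (simp add: second_difference_def algebra_simps)
  also have "\<dots> = (LBINT x. f x * \<phi> (x + h *\<^sub>R e)) + (LBINT x. f x * \<phi> (x + (- (h *\<^sub>R e)))) - 2 * (LBINT x. f x * \<phi> (x + 0))"
    using i1[of "h *\<^sub>R e"] i1[of "- (h *\<^sub>R e)"] i1[of 0] by simp
  also have "\<dots> = (LBINT x. f (x - h *\<^sub>R e) * \<phi> x) + (LBINT x. f (x - (- (h *\<^sub>R e))) * \<phi> x) - 2 * (LBINT x. f (x - 0) * \<phi> x)"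
    unfolding tr ..
  also have "\<dots> = (LBINT x. f (x - h *\<^sub>R e) * \<phi> x + f (x - (- (h *\<^sub>R e))) * \<phi> x - 2 * (f (x - 0) * \<phi> x))"
    using i0[of "h *\<^sub>R e"] i0[of "- (h *\<^sub>R e)"] i0[of 0] by simp
  also have "\<dots> = (LBINT x. second_difference h e f x * \<phi> x)"
    by (intro Bochner_Integration.integral_cong refl) (simp add: second_difference_def algebra_simps)
  finally show ?thesis .
qed

lemma tendsto_integral_second_difference_test:
  fixes f \<phi> :: "'a::euclidean_space \<Rightarrow> real"
  assumes f: "continuous_on UNIV f" and \<phi>: "smooth \<phi>" "\<And>x. x \<notin> cball c R \<Longrightarrow> \<phi> x = 0"
  shows "(\<lambda>n. LBINT x. f x * (second_quotient n e \<phi> x))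
    \<longlonglongrightarrow> (LBINT x. f x * D2 \<phi> x e e)"
proof -
  obtain C where C: "0 \<le> C" "\<And>x. \<bar>D2 \<phi> x e e\<bar> \<le> C" using D2_bounded[OF \<phi>] by metis
  let ?K = "cball c (R + norm e)"
  obtain F where F: "0 \<le> F" "\<And>x. x \<in> ?K \<Longrightarrow> \<bar>f x\<bar> \<le> F" using continuous_bounded_cball[OF f] by metis
  note cont = smooth_continuous[OF \<phi>(1)] smooth_continuous[OF smooth_D2[OF \<phi>(1)]]
  show ?thesis
  proof (rule integral_dominated_convergence[where w="\<lambda>x. F * C * indicator ?K x"])
    show "(\<lambda>x. f x * D2 \<phi> x e e) \<in> borel_measurable lborel"
      using f cont by (auto intro!: borel_measurable_continuous_onI continuous_intros)
    show "(\<lambda>x. f x * (second_quotient n e \<phi> x)) \<in> borel_measurable lborel" for n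
      using f continuous_on_second_difference[OF cont(1)] by (auto intro!: borel_measurable_continuous_onI continuous_intros)
    show "integrable lborel (\<lambda>x. F * C * indicator ?K x)"
      using emeasure_bounded_finite[of ?K] by (intro integrable_mult_right integrable_real_indicator) auto
    show "AE x in lborel. (\<lambda>n. f x * (second_quotient n e \<phi> x)) \<longlonglongrightarrow> f x * D2 \<phi> x e e"
      by (intro AE_I2 tendsto_mult tendsto_const second_quotient_tendsto \<phi>)
    show "AE x in lborel. norm (f x * (second_quotient n e \<phi> x)) \<le> F * C * indicator ?K x" for n
    proof (rule AE_I2)
      fix x
      show "norm (f x * (second_quotient n e \<phi> x)) \<le> F * C * indicator ?K x"
      proof (cases "x \<in> ?K")
        case True
        have "(real (Suc n))\<^sup>2 * \<bar>second_difference (1 / real (Suc n)) e \<phi> x\<bar> \<le> (real (Suc n))\<^sup>2 * (C * (1 / real (Suc n))\<^sup>2)"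
          by (intro mult_left_mono second_difference_le \<phi> C) simp
        then have "(real (Suc n))\<^sup>2 * \<bar>second_difference (1 / real (Suc n)) e \<phi> x\<bar> \<le> C" by (simp add: power_divide)
        with F True C have "\<bar>f x\<bar> * ((real (Suc n))\<^sup>2 * \<bar>second_difference (1 / real (Suc n)) e \<phi> x\<bar>) \<le> F * C"
          by (intro mult_mono) auto
        with True show ?thesis by (simp add: abs_mult)
      next
        case False
        have "second_difference (1 / real (Suc n)) e \<phi> x = 0" by (rule second_difference_vanishes[OF \<phi>(2) False]) auto
        with False show ?thesis by simp
      qed
    qed
  qed
qed

lemma tendsto_integral_second_difference_smooth:
  fixes S \<phi> :: "'a::euclidean_space \<Rightarrow> real"
  assumes S: "smooth S" "\<And>x. \<bar>D2 S x e e\<bar> \<le> C"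
    and \<phi>: "continuous_on UNIV \<phi>" "\<And>x. x \<notin> cball c R \<Longrightarrow> \<phi> x = 0"
  shows "(\<lambda>n. LBINT x. second_quotient n e S x * \<phi> x)
    \<longlonglongrightarrow> (LBINT x. D2 S x e e * \<phi> x)"
proof -
  have C: "0 \<le> C" using S(2)[of 0] by linarith
  note cont = smooth_continuous[OF S(1)] smooth_continuous[OF smooth_D2[OF S(1)]]
  show ?thesis
  proof (rule integral_dominated_convergence[where w="\<lambda>x. C * \<bar>\<phi> x\<bar>"])
    show "(\<lambda>x. D2 S x e e * \<phi> x) \<in> borel_measurable lborel"
      using \<phi> cont by (auto intro!: borel_measurable_continuous_onI continuous_intros)
    show "(\<lambda>x. second_quotient n e S x * \<phi> x) \<in> borel_measurable lborel" for n
      using \<phi> continuous_on_second_difference[OF cont(1)] by (auto intro!: borel_measurable_continuous_onI continuous_intros)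
    show "integrable lborel (\<lambda>x. C * \<bar>\<phi> x\<bar>)"
      using continuous_integrable_lborel[OF \<phi>] by auto
    show "AE x in lborel. (\<lambda>n. second_quotient n e S x * \<phi> x) \<longlonglongrightarrow> D2 S x e e * \<phi> x"
      by (intro AE_I2 tendsto_mult tendsto_const second_quotient_tendsto S)
    show "AE x in lborel. norm (second_quotient n e S x * \<phi> x) \<le> C * \<bar>\<phi> x\<bar>" for n
    proof (rule AE_I2)
      fix x
      have "(real (Suc n))\<^sup>2 * \<bar>second_difference (1 / real (Suc n)) e S x\<bar> \<le> (real (Suc n))\<^sup>2 * (C * (1 / real (Suc n))\<^sup>2)"
        by (intro mult_left_mono second_difference_le S) simp
      then have "(real (Suc n))\<^sup>2 * \<bar>second_difference (1 / real (Suc n)) e S x\<bar> \<le> C" by (simp add: power_divide)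
      then show "norm (second_quotient n e S x * \<phi> x) \<le> C * \<bar>\<phi> x\<bar>"
        by (simp add: abs_mult mult_right_mono)
    qed
  qed
qed

lemma integral_second_derivative_by_parts:
  fixes S \<phi> :: "'a::euclidean_space \<Rightarrow> real"
  assumes S: "smooth S" "\<And>x. \<bar>D2 S x e e\<bar> \<le> C"
    and \<phi>: "smooth \<phi>" "\<And>x. x \<notin> cball c R \<Longrightarrow> \<phi> x = 0"
  shows "(LBINT x. S x * D2 \<phi> x e e) = (LBINT x. D2 S x e e * \<phi> x)"
proof (rule LIMSEQ_unique)
  note cS = smooth_continuous[OF S(1)] and c\<phi> = smooth_continuous[OF \<phi>(1)]
  show "(\<lambda>n. LBINT x. S x * (second_quotient n e \<phi> x))
    \<longlonglongrightarrow> (LBINT x. S x * D2 \<phi> x e e)"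
    by (rule tendsto_integral_second_difference_test[OF cS \<phi>])
  have eq: "(LBINT x. S x * (second_quotient n e \<phi> x))
    = (LBINT x. second_quotient n e S x * \<phi> x)" for n
  proof -
    have "(LBINT x. S x * second_difference (1 / real (Suc n)) e \<phi> x) = (LBINT x. second_difference (1 / real (Suc n)) e S x * \<phi> x)"
      by (rule integral_second_difference_swap[OF cS c\<phi>]) (rule \<phi>(2))
    then show ?thesis
      using integral_mult_right_zero[of lborel "(real (Suc n))\<^sup>2" "\<lambda>x. S x * second_difference (1 / real (Suc n)) e \<phi> x"]
        integral_mult_right_zero[of lborel "(real (Suc n))\<^sup>2" "\<lambda>x. second_difference (1 / real (Suc n)) e S x * \<phi> x"]
      by (simp only: mult.assoc mult.left_commute[of "S _"])
  qed
  show "(\<lambda>n. LBINT x. S x * (second_quotient n e \<phi> x))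
    \<longlonglongrightarrow> (LBINT x. D2 S x e e * \<phi> x)"
    unfolding eq by (rule tendsto_integral_second_difference_smooth[OF S c\<phi>]) (rule \<phi>(2))
qed

text \<open>
  Only a lower bound on second differences of $f$ is available here, so the limit is taken on the
  test function, where the quotients converge boundedly.
\<close>

lemma integral_second_derivative_ge:
  fixes f \<phi> :: "'a::euclidean_space \<Rightarrow> real"
  assumes f: "continuous_on UNIV f" and \<phi>: "smooth \<phi>" "\<And>x. x \<notin> cball c R \<Longrightarrow> \<phi> x = 0" "\<And>x. 0 \<le> \<phi> x"
    and sd: "\<And>x h. \<phi> x \<noteq> 0 \<Longrightarrow> 0 < h \<Longrightarrow> h \<le> h0 \<Longrightarrow> - C * h\<^sup>2 \<le> second_difference h e f x" and "0 < h0"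
  shows "- C * (LBINT x. \<phi> x) \<le> (LBINT x. f x * D2 \<phi> x e e)"
proof (rule LIMSEQ_le_const[OF tendsto_integral_second_difference_test[OF f \<phi>(1,2)]])
  note c\<phi> = smooth_continuous[OF \<phi>(1)]
  obtain N :: nat where N: "1 / h0 < real N" using reals_Archimedean2 by blast
  show "\<exists>N. \<forall>n\<ge>N. - C * (LBINT x. \<phi> x) \<le> (LBINT x. f x * (second_quotient n e \<phi> x))"
  proof (intro exI allI impI)
    fix n assume n: "N \<le> n"
    define h where "h = 1 / real (Suc n)"
    have "1 / h0 < real (Suc n)" using N n by simp
    then have h: "0 < h" "h \<le> h0" using \<open>0 < h0\<close> by (auto simp: h_def field_simps)
    have hh: "(real (Suc n))\<^sup>2 * h\<^sup>2 = 1" by (simp add: h_def power_divide)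
    have "- C * (LBINT x. \<phi> x) = (LBINT x. - C * \<phi> x)" by simp
    also have "\<dots> \<le> (LBINT x. (real (Suc n))\<^sup>2 * (second_difference h e f x * \<phi> x))"
    proof (rule integral_mono)
      show "integrable lborel (\<lambda>x. - C * \<phi> x)" using continuous_integrable_lborel[OF c\<phi> \<phi>(2)] by auto
      show "integrable lborel (\<lambda>x. (real (Suc n))\<^sup>2 * (second_difference h e f x * \<phi> x))"
        by (rule continuous_integrable_lborel[of _ c R]) (use \<phi>(2) in \<open>auto intro!: continuous_intros c\<phi> continuous_on_second_difference f\<close>)
      fix x
      show "- C * \<phi> x \<le> (real (Suc n))\<^sup>2 * (second_difference h e f x * \<phi> x)"
      proof (cases "\<phi> x = 0")
        case False
        have "(real (Suc n))\<^sup>2 * (- C * h\<^sup>2) \<le> (real (Suc n))\<^sup>2 * second_difference h e f x"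
          by (intro mult_left_mono sd[OF False h]) simp
        moreover have "(real (Suc n))\<^sup>2 * (- C * h\<^sup>2) = - C"
          unfolding mult.left_commute[of "(real (Suc n))\<^sup>2"] hh by simp
        ultimately have "- C \<le> (real (Suc n))\<^sup>2 * second_difference h e f x" by (simp only:)
        from mult_right_mono[OF this \<phi>(3)[of x]] show ?thesis by (simp add: mult.assoc)
      qed simp
    qed
    also have "\<dots> = (real (Suc n))\<^sup>2 * (LBINT x. f x * second_difference h e \<phi> x)"
    proof -
      have "(LBINT x. f x * second_difference h e \<phi> x) = (LBINT x. second_difference h e f x * \<phi> x)"
        by (rule integral_second_difference_swap[OF f c\<phi>]) (rule \<phi>(2))
      then show ?thesis by (simp only: integral_mult_right_zero)
    qed
    also have "\<dots> = (LBINT x. f x * ((real (Suc n))\<^sup>2 * second_difference h e \<phi> x))"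
      by (subst integral_mult_right_zero[symmetric]) (simp only: mult.left_commute)
    finally show "- C * (LBINT x. \<phi> x) \<le> (LBINT x. f x * (second_quotient n e \<phi> x))"
      unfolding h_def .
  qed
qed

text \<open>
  A distribution bounded below by a constant is a measure. Concretely, choose $\zeta \ge 1$ on the smaller ball; for
  $|\varphi| \le 1$ the function $\zeta - \varphi$ is nonnegative, and testing with it bounds the integral for
  $\varphi$ by the one for $\zeta$.
\<close>

lemma hessian_measure_of_semiconvex:
  fixes f :: "'a::euclidean_space \<Rightarrow> real"
  assumes f: "continuous_on UNIV f" and \<rho>: "0 < \<rho>" and C: "0 \<le> C"
    and sd: "\<And>x h. x \<in> ball c \<rho> \<Longrightarrow> 0 < h \<Longrightarrow> h \<le> h0 \<Longrightarrow> - C * h\<^sup>2 \<le> second_difference h e f x" and "0 < h0"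
  obtains B where "\<And>\<phi>. \<phi> \<in> test_functions (ball c (\<rho> / 2)) \<Longrightarrow> (\<And>x. \<bar>\<phi> x\<bar> \<le> 1) \<Longrightarrow>
     (LBINT x. f x * D2 \<phi> x e e) \<le> B"
proof -
  \<comment> \<open>This factor lifts \<open>bump c \<rho>\<close> to at least \<open>1\<close> at distance \<open>\<rho> / 2\<close> from the centre.\<close>
  define k where "k = exp (4 / (3 * \<rho>\<^sup>2))"
  define \<zeta> where "\<zeta> x = k * bump c \<rho> x" for x
  have k: "0 < k" by (simp add: k_def)
  have s\<zeta>: "smooth \<zeta>" unfolding \<zeta>_def[abs_def] by (intro smooth_intros smooth_bump)
  have \<zeta>0: "0 \<le> \<zeta> x" for x using k bump_bounds[of c \<rho> x] by (simp add: \<zeta>_def)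
  have \<zeta>out: "\<zeta> x = 0" if "x \<notin> ball c \<rho>" for x using bump_eq_0[OF \<rho> that] by (simp add: \<zeta>_def)
  have \<zeta>1: "1 \<le> \<zeta> x" if "x \<in> ball c (\<rho> / 2)" for x
  proof -
    have "norm (x - c) \<le> \<rho> / 2" using that by (simp add: dist_norm norm_minus_commute)
    then have "(norm (x - c))\<^sup>2 \<le> (\<rho> / 2)\<^sup>2" by (rule power_mono) simp
    then have d: "3 * \<rho>\<^sup>2 / 4 \<le> \<rho>\<^sup>2 - (norm (x - c))\<^sup>2" by (simp add: power_divide)
    have p: "0 < 3 * \<rho>\<^sup>2 / 4" using \<rho> by simp
    have lt: "(norm (x - c))\<^sup>2 < \<rho>\<^sup>2" using less_le_trans[OF p d] by (simp only: diff_gt_0_iff_gt)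
    have "1 / (\<rho>\<^sup>2 - (norm (x - c))\<^sup>2) \<le> 1 / (3 * \<rho>\<^sup>2 / 4)"
      by (intro divide_left_mono mult_pos_pos d p less_le_trans[OF p d]) simp
    then have "1 / (\<rho>\<^sup>2 - (norm (x - c))\<^sup>2) \<le> 4 / (3 * \<rho>\<^sup>2)" by simp
    then have "1 \<le> exp (4 / (3 * \<rho>\<^sup>2)) * exp (- 1 / (\<rho>\<^sup>2 - (norm (x - c))\<^sup>2))" by (simp flip: exp_add)
    then show ?thesis using lt by (simp add: \<zeta>_def k_def bump_def flat_exp_def)
  qed
  show thesis
  proof (rule that)
    fix \<phi> assume \<phi>: "\<phi> \<in> test_functions (ball c (\<rho> / 2))" and \<phi>1: "\<And>x. \<bar>\<phi> x\<bar> \<le> 1"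
    have s\<phi>: "smooth \<phi>" using \<phi> by (simp add: test_functions_def)
    have \<phi>out: "\<phi> x = 0" if "x \<notin> ball c (\<rho> / 2)" for x
      using \<phi> that closure_subset[of "{x. \<phi> x \<noteq> 0}"] by (auto simp: test_functions_def)
    have le: "\<phi> x \<le> \<zeta> x" "- \<phi> x \<le> \<zeta> x" for x
      using \<phi>1[of x] \<zeta>1[of x] \<zeta>0[of x] \<phi>out[of x] by (cases "x \<in> ball c (\<rho> / 2)"; force)+
    have sub: "ball c (\<rho> / 2) \<subseteq> ball c \<rho>" using \<rho> by auto
    have out: "\<zeta> x - \<phi> x = 0" if "x \<notin> ball c \<rho>" for x
    proof -
      have "x \<notin> ball c (\<rho> / 2)" using sub that by blast
      then show ?thesis using \<zeta>out[OF that] \<phi>out[of x] by simp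
    qed
    have out': "\<zeta> x - \<phi> x = 0" "\<zeta> x = 0" "\<phi> x = 0" if "x \<notin> cball c \<rho>" for x
      using out[of x] \<zeta>out[of x] that by auto
    have i: "integrable lborel \<zeta>" "integrable lborel \<phi>"
      by (rule continuous_integrable_lborel[of _ c \<rho>]; use out' s\<zeta> s\<phi> in \<open>auto intro: smooth_continuous\<close>)+
    have i2: "integrable lborel (\<lambda>x. f x * D2 \<zeta> x e e)" "integrable lborel (\<lambda>x. f x * D2 \<phi> x e e)"
    proof -
      have c: "continuous_on UNIV (\<lambda>x. f x * D2 \<zeta> x e e)" "continuous_on UNIV (\<lambda>x. f x * D2 \<phi> x e e)"
        by (intro continuous_on_mult f smooth_continuous smooth_D2 s\<zeta> s\<phi>)+
      have "D2 \<zeta> x e e = 0" "D2 \<phi> x e e = 0" if "x \<notin> cball c \<rho>" for x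
        by (rule D2_vanishes[OF _ that], rule out', assumption)+
      then show "integrable lborel (\<lambda>x. f x * D2 \<zeta> x e e)" "integrable lborel (\<lambda>x. f x * D2 \<phi> x e e)"
        by (intro continuous_integrable_lborel[OF c(1), of c \<rho>] continuous_integrable_lborel[OF c(2), of c \<rho>]; simp)+
    qed
    have "- C * (LBINT x. \<zeta> x - \<phi> x) \<le> (LBINT x. f x * D2 (\<lambda>x. \<zeta> x - \<phi> x) x e e)"
    proof (rule integral_second_derivative_ge[OF f _ out'(1) _ _ \<open>0 < h0\<close>])
      show "smooth (\<lambda>x. \<zeta> x - \<phi> x)" by (intro smooth_intros s\<zeta> s\<phi>)
      show "0 \<le> \<zeta> x - \<phi> x" for x using le[of x] by simp
      show "- C * h\<^sup>2 \<le> second_difference h e f x" if "\<zeta> x - \<phi> x \<noteq> 0" "0 < h" "h \<le> h0" for x h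
        using that out[of x] by (intro sd) auto
    qed
    also have "(LBINT x. f x * D2 (\<lambda>x. \<zeta> x - \<phi> x) x e e)
      = (LBINT x. f x * D2 \<zeta> x e e) - (LBINT x. f x * D2 \<phi> x e e)"
      unfolding D2_diff[OF s\<zeta> s\<phi>] right_diff_distrib using i2 by simp
    finally have "(LBINT x. f x * D2 \<phi> x e e) \<le> (LBINT x. f x * D2 \<zeta> x e e) + C * (LBINT x. \<zeta> x - \<phi> x)"
      by simp
    also have "(LBINT x. \<zeta> x - \<phi> x) \<le> (LBINT x. 2 * \<zeta> x)"
    proof (rule integral_mono)
      show "\<zeta> x - \<phi> x \<le> 2 * \<zeta> x" for x using le(2)[of x] by simp
    qed (use i in auto)
    finally show "(LBINT x. f x * D2 \<phi> x e e) \<le> (LBINT x. f x * D2 \<zeta> x e e) + C * (LBINT x. 2 * \<zeta> x)"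
      using C by (simp add: mult_left_mono)
  qed
qed

section \<open>Polyconvex functions\<close>

text \<open>
  Two rows taken from the rank-one part are proportional: exchanging them changes only the sign of the permutation.
\<close>

lemma leibniz_rank_one_term_zero:
  fixes C :: "nat \<Rightarrow> nat \<Rightarrow> real" and u v :: "nat \<Rightarrow> real"
  assumes S: "S \<subseteq> {..<m}" "2 \<le> card S"
  shows "(\<Sum>p | p permutes {..<m}. of_int (sign p) * ((\<Prod>k\<in>S. u k * v (p k)) * (\<Prod>k\<in>{..<m} - S. C k (p k)))) = 0"
proof -
  define F where "F p = of_int (sign p) * ((\<Prod>k\<in>S. u k * v (p k)) * (\<Prod>k\<in>{..<m} - S. C k (p k)))" for p
  obtain i j where ij: "i \<in> S" "j \<in> S" "i \<noteq> j"
    using S(2) by (metis card_le_Suc0_iff_eq card.infinite not_less_eq_eq numeral_2_eq_2 zero_le)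
  define \<tau> where "\<tau> = Transposition.transpose i j"
  have \<tau>: "\<tau> permutes {..<m}" "\<tau> permutes S" unfolding \<tau>_def using ij S(1) by (auto intro!: permutes_swap_id)
  have flip: "F (p \<circ> \<tau>) = - F p" if p: "p permutes {..<m}" for p
  proof -
    have "sign (p \<circ> \<tau>) = - sign p"
      using p \<tau>(1) ij(3) by (subst sign_compose) (auto simp: \<tau>_def sign_swap_id permutation_permutes intro: permutation_permutes[THEN iffD2] exI[of _ "{..<m}"])
    moreover have "(\<Prod>k\<in>S. u k * v ((p \<circ> \<tau>) k)) = (\<Prod>k\<in>S. u k * v (p k))"
    proof -
      have "(\<Prod>k\<in>S. v (p (\<tau> k))) = (\<Prod>k\<in>S. v (p k))"
        using prod.permute[OF \<tau>(2), of "\<lambda>k. v (p k)"] by (simp add: o_def)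
      then show ?thesis by (simp add: prod.distrib)
    qed
    moreover have "(\<Prod>k\<in>{..<m} - S. C k ((p \<circ> \<tau>) k)) = (\<Prod>k\<in>{..<m} - S. C k (p k))"
    proof (rule prod.cong[OF refl])
      fix k assume "k \<in> {..<m} - S"
      then have "k \<noteq> i" "k \<noteq> j" using ij by auto
      then show "C k ((p \<circ> \<tau>) k) = C k (p k)" by (simp add: \<tau>_def Transposition.transpose_def)
    qed
    ultimately show ?thesis by (simp add: F_def)
  qed
  have "(\<Sum>p | p permutes {..<m}. F p) = (\<Sum>p | p permutes {..<m}. F (p \<circ> \<tau>))"
    by (rule sum_permutations_compose_right[OF \<tau>(1)])
  also have "\<dots> = (\<Sum>p | p permutes {..<m}. - F p)" by (rule sum.cong) (auto simp: flip)
  finally show ?thesis unfolding F_def[symmetric] by (simp add: sum_negf)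
qed

lemma leibniz_rank_one_affine:
  fixes C :: "nat \<Rightarrow> nat \<Rightarrow> real" and u v :: "nat \<Rightarrow> real" and m :: nat
  defines "P \<equiv> \<lambda>t. \<Sum>p | p permutes {..<m}. of_int (sign p) * (\<Prod>k<m. C k (p k) + t * (u k * v (p k)))"
  shows "P t = (1 - t) * P 0 + t * P 1"
proof -
  define D where "D S = (\<Sum>p | p permutes {..<m}. of_int (sign p) * ((\<Prod>k\<in>S. u k * v (p k)) * (\<Prod>k\<in>{..<m} - S. C k (p k))))" for S
  have exp: "P t = (\<Sum>S\<in>Pow {..<m}. t ^ card S * D S)" for t
  proof -
    have "(\<Prod>k<m. C k (p k) + t * (u k * v (p k)))
        = (\<Sum>S\<in>Pow {..<m}. t ^ card S * ((\<Prod>k\<in>S. u k * v (p k)) * (\<Prod>k\<in>{..<m} - S. C k (p k))))" for p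
    proof -
      have "(\<Prod>k<m. t * (u k * v (p k)) + C k (p k))
        = (\<Sum>S\<in>Pow {..<m}. (\<Prod>k\<in>S. t * (u k * v (p k))) * (\<Prod>k\<in>{..<m} - S. C k (p k)))"
        by (rule prod_add) simp
      then show ?thesis by (simp add: add.commute prod.distrib mult.assoc)
    qed
    then have "P t = (\<Sum>p | p permutes {..<m}. \<Sum>S\<in>Pow {..<m}. t ^ card S *
        (of_int (sign p) * ((\<Prod>k\<in>S. u k * v (p k)) * (\<Prod>k\<in>{..<m} - S. C k (p k)))))"
      unfolding P_def by (simp add: sum_distrib_left mult.left_commute)
    also have "\<dots> = (\<Sum>S\<in>Pow {..<m}. t ^ card S * D S)"
      unfolding D_def by (subst sum.swap) (simp add: sum_distrib_left)
    finally show ?thesis .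
  qed
  have "t ^ card S * D S = (1 - t) * (0 ^ card S * D S) + t * (1 ^ card S * D S)" if "S \<in> Pow {..<m}" for S
  proof -
    consider "card S = 0" | "card S = 1" | "2 \<le> card S" by linarith
    then show ?thesis
    proof cases
      case 3
      then have "D S = 0" unfolding D_def using that by (intro leibniz_rank_one_term_zero) auto
      then show ?thesis by simp
    qed (auto simp: algebra_simps)
  qed
  then have "P t = (\<Sum>S\<in>Pow {..<m}. (1 - t) * (0 ^ card S * D S) + t * (1 ^ card S * D S))"
    unfolding exp by (rule sum.cong[OF refl])
  then show ?thesis unfolding exp by (simp add: sum.distrib sum_distrib_left)
qed

lemma minors_rank_one_affine:
  "minors (x + t *\<^sub>R tensor_square a) = minors x + t *\<^sub>R (minors (x + tensor_square a) - minors x)"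
proof -
  have "minor (mat_of (x + t *\<^sub>R tensor_square a)) I J
    = minor (mat_of x) I J + t * (minor (mat_of (x + tensor_square a)) I J - minor (mat_of x) I J)" for I J :: "'a set"
  proof -
    define C where "C k l = mat_of x $ (sorted_list_of_set I ! k) $ (sorted_list_of_set J ! l)" for k l
    define u where "u k = a $ (sorted_list_of_set I ! k)" for k
    define v where "v l = a $ (sorted_list_of_set J ! l)" for l
    have "minor (mat_of (x + s *\<^sub>R tensor_square a)) I J
      = (\<Sum>p | p permutes {..<card I}. of_int (sign p) * (\<Prod>k<card I. C k (p k) + s * (u k * v (p k))))" for s
      by (simp add: minor_def plus_sym_mat.rep_eq scaleR_sym_mat.rep_eq tensor_square.rep_eq C_def u_def v_def)
    note rep = this
    show ?thesis
      using leibniz_rank_one_affine[where m="card I" and C=C and u=u and v=v and t=t] rep[of t] rep[of 0] rep[of 1]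
      by (simp add: algebra_simps)
  qed
  then show ?thesis by (simp add: minors_def vec_eq_iff split: prod.split)
qed

lemma ereal_convexD:
  assumes "ereal_convex g" "g v \<le> ereal a" "g w \<le> ereal c" "0 \<le> s" "0 \<le> t" "s + t = 1"
  shows "g (s *\<^sub>R v + t *\<^sub>R w) \<le> ereal (s * a + t * c)"
proof -
  have "g (s *\<^sub>R v + t *\<^sub>R w) \<le> ereal s * g v + ereal t * g w"
    using assms unfolding ereal_convex_def by blast
  also have "\<dots> \<le> ereal s * ereal a + ereal t * ereal c"
    using assms by (intro add_mono ereal_mult_left_mono) auto
  finally show ?thesis by simp
qed

text \<open>
  With $P = a \otimes a$ and $Q = b \otimes b$, the minors of $x + s P + t Q$ are $c_0 + s c_1 + t c_2 + s t\, c_3$. The points $(h,-h)$ and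
  $(-h,h)$ average to $c_0 - h^2 c_3$, whereas $(\rho,\rho)$ and $(-\rho,-\rho)$ average to $c_0 + \rho^2 c_3$.
  So $c_0$, the minors of $x$, is a convex combination of these with weight of order $h^2 / \rho^2$ on the
  far points, and convexity of $g$ together with the bound $K$ at the far points gives the claim.
\<close>

lemma polyconvex_second_difference_ge:
  fixes f :: "'n::{finite,linorder} sym_mat \<Rightarrow> real"
  assumes g: "ereal_convex g" and fg: "\<And>y. y \<in> U \<Longrightarrow> ereal (f y) = g (minors y)"
    and K: "\<And>y. y \<in> U \<Longrightarrow> \<bar>f y\<bar> \<le> K" and \<rho>: "0 < h" "h \<le> \<rho>"
    and U: "\<And>s t. \<bar>s\<bar> \<le> \<rho> \<Longrightarrow> \<bar>t\<bar> \<le> \<rho> \<Longrightarrow> x + s *\<^sub>R tensor_square a + t *\<^sub>R tensor_square b \<in> U"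
  shows "- (4 * K / \<rho>\<^sup>2) * h\<^sup>2 \<le> second_difference h (tensor_square a - tensor_square b) f x"
proof -
  define \<Phi> where "\<Phi> s t = minors (x + s *\<^sub>R tensor_square a + t *\<^sub>R tensor_square b)" for s t
  define c0 c1 c2 c3 where "c0 = \<Phi> 0 0" and "c1 = \<Phi> 1 0 - \<Phi> 0 0" and "c2 = \<Phi> 0 1 - \<Phi> 0 0" and "c3 = \<Phi> 1 1 - \<Phi> 1 0 - (\<Phi> 0 1 - \<Phi> 0 0)"
  have biaffine: "\<Phi> s t = c0 + s *\<^sub>R c1 + t *\<^sub>R c2 + (s * t) *\<^sub>R c3" for s t
  proof -
    have 1: "\<Phi> s t = \<Phi> 0 t + s *\<^sub>R (\<Phi> 1 t - \<Phi> 0 t)"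
      unfolding \<Phi>_def using minors_rank_one_affine[of "x + t *\<^sub>R tensor_square b" s a] by (simp add: add.assoc add.commute add.left_commute)
    have 2: "\<Phi> s t = \<Phi> s 0 + t *\<^sub>R (\<Phi> s 1 - \<Phi> s 0)" for s
      unfolding \<Phi>_def using minors_rank_one_affine[of "x + s *\<^sub>R tensor_square a" t b] by simp
    show ?thesis
      unfolding 1 2[of 0] 2[of 1] c0_def c1_def c2_def c3_def by (simp add: algebra_simps)
  qed
  have "0 < \<rho>" using \<rho> by simp
  define \<sigma> where "\<sigma> = h\<^sup>2 / \<rho>\<^sup>2"
  have \<sigma>: "0 \<le> \<sigma>" "\<sigma> \<le> 1" using \<rho> \<open>0 < \<rho>\<close> power_mono[of h \<rho> 2] by (auto simp: \<sigma>_def divide_le_eq_1)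
  have \<sigma>h: "\<sigma> * \<rho>\<^sup>2 = h\<^sup>2" using \<open>0 < \<rho>\<close> by (simp add: \<sigma>_def)
  have val: "g (\<Phi> s t) = ereal (f (x + s *\<^sub>R tensor_square a + t *\<^sub>R tensor_square b))" if "\<bar>s\<bar> \<le> \<rho>" "\<bar>t\<bar> \<le> \<rho>" for s t
    unfolding \<Phi>_def using fg[OF U[OF that]] by simp
  have valK: "g (\<Phi> s t) \<le> ereal K" if "\<bar>s\<bar> \<le> \<rho>" "\<bar>t\<bar> \<le> \<rho>" for s t
    unfolding val[OF that] using K[OF U[OF that]] by simp
  define fp fm where "fp = f (x + h *\<^sub>R tensor_square a + (- h) *\<^sub>R tensor_square b)"
    and "fm = f (x + (- h) *\<^sub>R tensor_square a + h *\<^sub>R tensor_square b)"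
  define w1 where "w1 = (1/2) *\<^sub>R \<Phi> h (- h) + (1/2) *\<^sub>R \<Phi> (- h) h"
  define wp where "wp = (1/2) *\<^sub>R \<Phi> \<rho> \<rho> + (1/2) *\<^sub>R \<Phi> (- \<rho>) (- \<rho>)"
  define wm where "wm = (1/2) *\<^sub>R \<Phi> \<rho> (- \<rho>) + (1/2) *\<^sub>R \<Phi> (- \<rho>) \<rho>"
  \<comment> \<open>Mixing in \<open>wm\<close> lowers the coefficient of \<open>c3\<close> from \<open>\<rho>\<^sup>2\<close> to \<open>(1 - \<sigma>) * \<rho>\<^sup>2\<close>, so that the weights become exactly \<open>1 - \<sigma>\<close> and \<open>\<sigma>\<close>.\<close>
  define w2 where "w2 = (1 - \<sigma> / 2) *\<^sub>R wp + (\<sigma> / 2) *\<^sub>R wm"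
  have b1: "g w1 \<le> ereal (1/2 * fp + 1/2 * fm)"
    unfolding w1_def by (rule ereal_convexD[OF g]) (use \<rho> in \<open>auto simp: val fp_def fm_def\<close>)
  have "g wp \<le> ereal (1/2 * K + 1/2 * K)" "g wm \<le> ereal (1/2 * K + 1/2 * K)"
    unfolding wp_def wm_def by (rule ereal_convexD[OF g]; use \<rho> valK in auto)+
  then have "g w2 \<le> ereal ((1 - \<sigma> / 2) * K + \<sigma> / 2 * K)"
    unfolding w2_def by (intro ereal_convexD[OF g]) (use \<sigma> in auto)
  then have b2: "g w2 \<le> ereal K" by (simp add: algebra_simps)
  have "g ((1 - \<sigma>) *\<^sub>R w1 + \<sigma> *\<^sub>R w2) \<le> ereal ((1 - \<sigma>) * (1/2 * fp + 1/2 * fm) + \<sigma> * K)"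
    using \<sigma> by (intro ereal_convexD[OF g b1 b2]) auto
  moreover have "(1 - \<sigma>) *\<^sub>R w1 + \<sigma> *\<^sub>R w2 = \<Phi> 0 0"
  proof -
    have 1: "w1 = c0 - h\<^sup>2 *\<^sub>R c3" unfolding w1_def biaffine by (simp add: vec_eq_iff field_simps power2_eq_square)
    have 2: "wp = c0 + \<rho>\<^sup>2 *\<^sub>R c3" "wm = c0 - \<rho>\<^sup>2 *\<^sub>R c3"
      unfolding wp_def wm_def biaffine by (simp_all add: vec_eq_iff field_simps power2_eq_square)
    have "(1 - \<sigma>) *\<^sub>R w1 + \<sigma> *\<^sub>R w2 = c0 + (- ((1 - \<sigma>) * h\<^sup>2) + \<sigma> * ((1 - \<sigma> / 2) * \<rho>\<^sup>2 - \<sigma> / 2 * \<rho>\<^sup>2)) *\<^sub>R c3"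
      unfolding w2_def 1 2 by (simp add: algebra_simps flip: scaleR_left_distrib)
    also have "- ((1 - \<sigma>) * h\<^sup>2) + \<sigma> * ((1 - \<sigma> / 2) * \<rho>\<^sup>2 - \<sigma> / 2 * \<rho>\<^sup>2) = 0"
      unfolding \<sigma>h[symmetric] by (simp add: algebra_simps)
    finally show ?thesis by (simp add: c0_def)
  qed
  ultimately have "f x \<le> (1 - \<sigma>) * (1/2 * fp + 1/2 * fm) + \<sigma> * K"
    using val[of 0 0] \<open>0 < \<rho>\<close> by simp
  moreover have "second_difference h (tensor_square a - tensor_square b) f x = fp + fm - 2 * f x"
    unfolding second_difference_def fp_def fm_def by (simp add: algebra_simps)
  moreover have "- K \<le> 1/2 * fp + 1/2 * fm"
    using K[OF U[of h "-h"]] K[OF U[of "-h" h]] \<rho> by (simp add: fp_def fm_def)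
  then have "\<sigma> * (- K) \<le> \<sigma> * (1/2 * fp + 1/2 * fm)" using \<sigma> by (intro mult_left_mono) auto
  moreover have "(1 - \<sigma>) * (1/2 * fp + 1/2 * fm) = 1/2 * fp + 1/2 * fm - \<sigma> * (1/2 * fp + 1/2 * fm)" by (simp add: field_simps)
  moreover have "- (4 * K / \<rho>\<^sup>2) * h\<^sup>2 = 4 * (\<sigma> * (- K))" by (simp add: \<sigma>_def)
  moreover have "\<sigma> * (- K) = - (\<sigma> * K)" by simp
  ultimately show ?thesis by linarith
qed

lemma locally_polyconvex_hessian_measure:
  fixes f :: "'n::{finite,linorder} sym_mat \<Rightarrow> real"
  assumes poly: "locally_polyconvex_at f \<xi>" and f: "continuous_on UNIV f" and \<kappa>: "0 < \<kappa>"
  obtains r B where "0 < r" "\<And>\<phi>. \<phi> \<in> test_functions (ball \<xi> r) \<Longrightarrow> (\<And>x. \<bar>\<phi> x\<bar> \<le> 1) \<Longrightarrow>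
    (LBINT x. f x * D2 \<phi> x (\<kappa> *\<^sub>R (tensor_square a - tensor_square b)) (\<kappa> *\<^sub>R (tensor_square a - tensor_square b))) \<le> B"
proof -
  obtain U and g :: "real ^ 'n minor_index \<Rightarrow> ereal" where U: "open U" "\<xi> \<in> U" "ereal_convex g" "\<And>x. x \<in> U \<Longrightarrow> ereal (f x) = g (minors x)"
    using poly unfolding locally_polyconvex_at_def by blast
  obtain R where R: "0 < R" "cball \<xi> R \<subseteq> U" using U(1,2) open_contains_cball by blast
  obtain K where K: "0 \<le> K" "\<And>x. x \<in> cball \<xi> R \<Longrightarrow> \<bar>f x\<bar> \<le> K" using continuous_bounded_cball[OF f] by metis
  define N where "N = norm (tensor_square a) + norm (tensor_square b) + 1"
  have N: "0 < N" by (simp add: N_def add_nonneg_pos)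
  define \<rho> where "\<rho> = R / (2 * N)"
  have \<rho>: "0 < \<rho>" using R N by (simp add: \<rho>_def)
  let ?e = "\<kappa> *\<^sub>R (tensor_square a - tensor_square b)"
  have sd: "- (4 * K / \<rho>\<^sup>2 * \<kappa>\<^sup>2) * h\<^sup>2 \<le> second_difference h ?e f x" if x: "x \<in> ball \<xi> (R / 2)" and h: "0 < h" "h \<le> \<rho> / \<kappa>" for x h
  proof -
    have "- (4 * K / \<rho>\<^sup>2) * (h * \<kappa>)\<^sup>2 \<le> second_difference (h * \<kappa>) (tensor_square a - tensor_square b) f x"
    proof (rule polyconvex_second_difference_ge[OF U(3), of "cball \<xi> R"])
      show "ereal (f y) = g (minors y)" if "y \<in> cball \<xi> R" for y using U(4) R(2) that by blast
      show "0 < h * \<kappa>" "h * \<kappa> \<le> \<rho>" using h \<kappa> by (auto simp: field_simps)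
      fix s t assume st: "\<bar>s\<bar> \<le> \<rho>" "\<bar>t\<bar> \<le> \<rho>"
      have "norm (s *\<^sub>R tensor_square a + t *\<^sub>R tensor_square b) \<le> \<bar>s\<bar> * norm (tensor_square a) + \<bar>t\<bar> * norm (tensor_square b)"
        by (rule norm_triangle_le) simp
      also have "\<dots> \<le> \<rho> * norm (tensor_square a) + \<rho> * norm (tensor_square b)"
        using st by (intro add_mono mult_right_mono) auto
      also have "\<dots> \<le> \<rho> * N" using \<rho> by (simp add: N_def algebra_simps)
      also have "\<dots> = R / 2" using N by (simp add: \<rho>_def)
      finally have "norm (s *\<^sub>R tensor_square a + t *\<^sub>R tensor_square b) \<le> R / 2" .
      moreover have "norm (x - \<xi>) < R / 2" using x by (simp add: dist_norm norm_minus_commute)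
      moreover have "norm (x + s *\<^sub>R tensor_square a + t *\<^sub>R tensor_square b - \<xi>) \<le> norm (x - \<xi>) + norm (s *\<^sub>R tensor_square a + t *\<^sub>R tensor_square b)"
        using norm_triangle_ineq[of "x - \<xi>" "s *\<^sub>R tensor_square a + t *\<^sub>R tensor_square b"] by (simp add: algebra_simps)
      ultimately show "x + s *\<^sub>R tensor_square a + t *\<^sub>R tensor_square b \<in> cball \<xi> R"
        by (simp add: dist_norm norm_minus_commute[of \<xi>])
    qed (rule K(2))
    then show ?thesis by (simp add: second_difference_def power_mult_distrib mult_ac)
  qed
  have pos: "0 < \<rho> / \<kappa>" "0 < R / 2" using \<rho> \<kappa> R by auto
  have C: "0 \<le> 4 * K / \<rho>\<^sup>2 * \<kappa>\<^sup>2" using K by simp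
  show thesis
  proof (rule hessian_measure_of_semiconvex[OF f pos(2) C sd pos(1)])
    fix B assume B: "\<And>\<phi>. \<phi> \<in> test_functions (ball \<xi> (R / 2 / 2)) \<Longrightarrow> (\<And>x. \<bar>\<phi> x\<bar> \<le> 1) \<Longrightarrow>
      (LBINT x. f x * D2 \<phi> x ?e ?e) \<le> B"
    show thesis by (rule that[OF _ B]) (use R in simp_all)
  qed
qed

section \<open>A null-convex function with wild Hessian\<close>

lemma D1_bounded:
  fixes \<phi> :: "'a::euclidean_space \<Rightarrow> real"
  assumes "smooth \<phi>" "\<And>x. x \<notin> cball c R \<Longrightarrow> \<phi> x = 0"
  obtains L where "0 \<le> L" "\<And>x v. \<bar>D1 \<phi> x v\<bar> \<le> L * norm v"
proof -
  have "\<exists>C. 0 \<le> C \<and> (\<forall>x. \<bar>D1 \<phi> x u\<bar> \<le> C)" for u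
  proof -
    obtain C where C: "0 \<le> C" "\<And>x. x \<in> cball c R \<Longrightarrow> \<bar>D1 \<phi> x u\<bar> \<le> C"
      using continuous_bounded_cball[OF smooth_continuous[OF smooth_D1[OF assms(1)]]] by metis
    have "\<bar>D1 \<phi> x u\<bar> \<le> C" for x
    proof (cases "x \<in> cball c R")
      case False
      have "D1 \<phi> x u = 0"
        by (rule D2_eq_0(1)[of "- cball c R"]) (use assms(2) False in auto)
      with C show ?thesis by simp
    qed (rule C)
    with C show ?thesis by blast
  qed
  then obtain C where C: "\<And>u. 0 \<le> C u" "\<And>u x. \<bar>D1 \<phi> x u\<bar> \<le> C u" by metis
  show thesis
  proof (rule that)
    show "0 \<le> (\<Sum>u\<in>Basis. C u)" by (intro sum_nonneg C)
    fix x v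
    have lin: "linear (D1 \<phi> x)" by (rule has_derivative_linear[OF smooth_has_derivative[OF assms(1)]])
    have "D1 \<phi> x v = D1 \<phi> x (\<Sum>u\<in>Basis. (v \<bullet> u) *\<^sub>R u)" by (simp add: euclidean_representation)
    also have "\<dots> = (\<Sum>u\<in>Basis. (v \<bullet> u) * D1 \<phi> x u)"
      by (simp add: linear_sum[OF lin] linear_scale[OF lin])
    also have "\<bar>\<dots>\<bar> \<le> (\<Sum>u\<in>Basis. norm v * C u)"
    proof (rule order_trans[OF sum_abs sum_mono])
      fix u :: 'a assume "u \<in> Basis"
      then show "\<bar>(v \<bullet> u) * D1 \<phi> x u\<bar> \<le> norm v * C u"
        unfolding abs_mult using C Basis_le_norm by (intro mult_mono) auto
    qed
    finally show "\<bar>D1 \<phi> x v\<bar> \<le> (\<Sum>u\<in>Basis. C u) * norm v"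
      by (simp add: sum_distrib_left mult.commute)
  qed
qed

lemma derivative_bound_imp_Lipschitz:
  fixes \<phi> :: "'a::euclidean_space \<Rightarrow> real"
  assumes "\<And>x. (\<phi> has_derivative \<phi>' x) (at x)" "\<And>x v. \<bar>\<phi>' x v\<bar> \<le> L * norm v"
  shows "\<bar>\<phi> x - \<phi> y\<bar> \<le> L * norm (x - y)"
proof -
  have "norm (\<phi> x - \<phi> y) \<le> L * norm (x - y)"
    by (rule differentiable_bound[of UNIV \<phi> \<phi>']) (use assms in \<open>auto intro: onorm_le\<close>)
  then show ?thesis by simp
qed

lemma weight_of_smooth:
  fixes \<phi> :: "'a::euclidean_space \<Rightarrow> real"
  assumes "smooth \<phi>" "\<And>x. x \<notin> cball c R \<Longrightarrow> \<phi> x = 0" "\<And>x. 0 \<le> \<phi> x"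
  obtains D where "weight \<phi> D"
proof -
  obtain L where L: "0 \<le> L" "\<And>x v. \<bar>D1 \<phi> x v\<bar> \<le> L * norm v"
    using D1_bounded[OF assms(1,2)] by metis
  have lip: "\<bar>\<phi> x - \<phi> y\<bar> \<le> L * norm (x - y)" for x y
    by (rule derivative_bound_imp_Lipschitz[OF smooth_has_derivative[OF assms(1)] L(2)])
  have "weight \<phi> (\<lambda>x. L * indicator (cball c R) x)"
    unfolding weight_def
  proof (intro conjI allI)
    show "integrable lborel \<phi>"
      by (rule continuous_integrable_lborel[OF smooth_continuous[OF assms(1)]]) (rule assms(2))
    show "integrable lborel (\<lambda>x. L * indicator (cball c R) x)"
      using emeasure_bounded_finite[of "cball c R"] by (intro integrable_mult_right integrable_real_indicator) auto
    fix x y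
    show "\<phi> x - norm y * (L * indicator (cball c R) x) \<le> \<phi> (x + y)"
      using lip[of x "x + y"] assms(2)[of x] assms(3)[of "x + y"] by (cases "x \<in> cball c R") (auto simp: mult.commute)
  qed (use assms L in auto)
  with that show thesis by blast
qed

lemma integral_bump_pos: "0 < \<rho> \<Longrightarrow> 0 < (LBINT x. bump c \<rho> x)"
proof -
  assume \<rho>: "0 < \<rho>"
  have i: "integrable lborel (bump c \<rho>)"
    by (rule continuous_integrable_lborel[OF smooth_continuous[OF smooth_bump], of c \<rho>])
       (rule bump_eq_0[OF \<rho>], use ball_subset_cball in blast)
  have "0 \<le> (LBINT x. bump c \<rho> x)" by (simp add: bump_bounds)
  moreover have "(LBINT x. bump c \<rho> x) \<noteq> 0"
  proof
    assume "(LBINT x. bump c \<rho> x) = 0"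
    then have ae: "AE x in lborel. bump c \<rho> x = 0"
      using integral_nonneg_eq_0_iff_AE[OF i] by (simp add: bump_bounds)
    have "AE x in lborel. x \<notin> ball c \<rho>"
    proof (rule AE_mp[OF ae], rule AE_I2, rule impI)
      fix x assume "bump c \<rho> x = 0"
      then show "x \<notin> ball c \<rho>" using bump_pos_iff[OF \<rho>, of c x] by (auto simp: dist_commute)
    qed
    moreover have "{x \<in> space lborel. \<not> x \<notin> ball c \<rho>} = ball c \<rho>" by auto
    ultimately have "emeasure lborel (ball c \<rho>) = 0"
      using AE_iff_measurable[of "ball c \<rho>" lborel "\<lambda>x. x \<notin> ball c \<rho>"] by (metis borel_open open_ball sets_lborel)
    then show False using content_ball_pos[OF \<rho>, of c] by (simp add: measure_def)
  qed
  ultimately show ?thesis by linarith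
qed

text \<open>
  The factor $2\,\mathrm{logistic}(s) - 1$ is a smooth substitute for the sign of $s$.
\<close>

lemma logistic_sign:
  "\<bar>2 * logistic s - 1\<bar> \<le> 1" "\<bar>s\<bar> - 2 \<le> s * (2 * logistic s - 1)"
proof -
  show "\<bar>2 * logistic s - 1\<bar> \<le> 1" using logistic_bounds[of s] by (simp add: abs_le_iff)
  have *: "t - 2 \<le> t * (2 * logistic t - 1)" if "0 \<le> t" for t
  proof -
    have "t * logistic (- t) \<le> 1"
    proof -
      have "t \<le> 1 + exp t" using exp_ge_add_one_self[of t] by linarith
      moreover have "0 < 1 + exp t" using exp_gt_zero[of t] by linarith
      ultimately show ?thesis by (simp add: logistic_def divide_le_eq_1)
    qed
    then show ?thesis by (simp add: logistic_minus algebra_simps)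
  qed
  show "\<bar>s\<bar> - 2 \<le> s * (2 * logistic s - 1)"
  proof (cases "0 \<le> s")
    case False
    then show ?thesis using *[of "- s"] by (simp add: logistic_minus algebra_simps)
  qed (use * in auto)
qed

context null_frame
begin

text \<open>
  Some test function below $\psi$ sees a second derivative of $S + F$ of mass about $k \int \psi$, no matter
  which $S$ with $|\partial_{11} S| \le C$ is added; the bound $K$ on the integral of
  $|\partial_{11} \tau|$ controls how much a later uniformly small change of $F$ can spoil.
\<close>

definition detects :: "real \<Rightarrow> nat \<Rightarrow> ('a \<Rightarrow> real) \<Rightarrow> ('a \<Rightarrow> real) \<Rightarrow> real \<Rightarrow> bool" where
  "detects C k F \<psi> K \<longleftrightarrow> (\<exists>\<tau>. smooth \<tau> \<and> (\<forall>x. \<bar>\<tau> x\<bar> \<le> \<psi> x) \<and> (LBINT x. \<bar>D2 \<tau> x (b 1) (b 1)\<bar>) \<le> K \<and>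
     (\<forall>S. smooth S \<and> (\<forall>x. \<bar>D2 S x (b 1) (b 1)\<bar> \<le> C) \<longrightarrow>
        real k * (LBINT x. \<psi> x) - 1 \<le> (LBINT x. (S x + F x) * D2 \<tau> x (b 1) (b 1))))"

text \<open>
  One step of a gliding hump. Here $C$ bounds $\partial_{11}$ of the sum of the earlier terms and $K$ the integrals of
  $|\partial_{11} \tau|$ for the earlier test functions $\tau$; $C'$ and $K'$ are the increments of these bounds caused by $F$.
  The condition with $A$ makes the gradient of $F$ smaller than the $k$-th power of the reciprocal of a Lipschitz constant of that gradient,
  which yields Hoelder continuity of the derivative of the sum for every exponent less than one.
\<close>

definition stage :: "(nat \<Rightarrow> real) \<Rightarrow> (nat \<Rightarrow> 'a \<Rightarrow> real) \<Rightarrow> nat \<Rightarrow> real \<Rightarrow> real \<Rightarrow> ('a \<Rightarrow> real) \<Rightarrow> real \<Rightarrow> real \<Rightarrow> bool" where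
  "stage H \<psi> k C K F C' K' \<longleftrightarrow> smooth F \<and> 0 \<le> C' \<and> 0 \<le> K' \<and>
     (\<forall>x. \<bar>F x\<bar> \<le> (1/2) ^ k / (1 + K)) \<and>
     (\<forall>x. \<bar>D2 F x (b 1) (b 1)\<bar> \<le> C') \<and>
     (\<forall>x e. null_vector e \<longrightarrow> - ((1/2) ^ k * frame_form H e) \<le> D2 F x e e) \<and>
     (\<exists>A\<ge>1. \<forall>x y v. \<bar>D1 F x v\<bar> \<le> (1/2) ^ k / A ^ k * norm v \<and>
        \<bar>D1 F x v - D1 F y v\<bar> \<le> A * norm (x - y) * norm v) \<and>
     (\<forall>j\<le>k. detects C k F (\<psi> j) K')"

lemma stageD:
  assumes "stage H \<psi> k C K F C' K'"
  shows "smooth F" "0 \<le> C'" "0 \<le> K'" "\<bar>F x\<bar> \<le> (1/2) ^ k / (1 + K)"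
    "\<bar>D2 F x (b 1) (b 1)\<bar> \<le> C'"
    "null_vector e \<Longrightarrow> - ((1/2) ^ k * frame_form H e) \<le> D2 F x e e"
    "\<exists>A\<ge>1. \<forall>x y v. \<bar>D1 F x v\<bar> \<le> (1/2) ^ k / A ^ k * norm v \<and>
        \<bar>D1 F x v - D1 F y v\<bar> \<le> A * norm (x - y) * norm v"
    "j \<le> k \<Longrightarrow> detects C k F (\<psi> j) K'"
  using assms unfolding stage_def by blast+

text \<open>
  Take $F(x) = 2^{-k} M^{-2} \varphi(M x)$ where $\varphi$ attains a mean $m$ so large that the factor $2^{-k}$ and the
  contribution of $S$ are overcome, and let the test function be $\psi$ times a smooth substitute for the sign of
  $H_1 + \partial_{11} \varphi(M x)$.
\<close>

lemma stage_exists: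
  assumes H: "\<And>m. attains H m" and "0 \<le> C" "0 \<le> K"
    and \<psi>: "\<And>j. smooth (\<psi> j)" "\<And>j x. x \<notin> cball (c j) (\<rho> j) \<Longrightarrow> \<psi> j x = 0" "\<And>j x. 0 \<le> \<psi> j x"
  obtains F C' K' where "stage H \<psi> k C K F C' K'"
proof -
  \<comment> \<open>The summand \<open>2\<close> pays for replacing the sign by \<open>logistic\<close>, and \<open>\<bar>H 1\<bar>\<close> for the constant \<open>H 1\<close>, which is not part of the Hessian of \<open>F\<close>.\<close>
  define m where "m = 2 ^ k * (C + real k) + 2 + \<bar>H 1\<bar>"
  obtain \<phi> r where adm: "admissible H \<phi>" and V: "mean_ge r (\<lambda>x. \<bar>H 1 + D2 \<phi> x (b 1) (b 1)\<bar>) m"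
    using H[of m] unfolding attains_def by blast
  from adm obtain B \<eta> where \<phi>: "smooth \<phi>" "0 \<le> B" "\<And>x. \<bar>\<phi> x\<bar> \<le> B"
    "\<And>x v. \<bar>D1 \<phi> x v\<bar> \<le> B * frame_norm v"
    "\<And>x u v. \<bar>D2 \<phi> x u v\<bar> \<le> B * (frame_norm u * frame_norm v)"
    "0 < \<eta>" "\<And>x e. null_vector e \<Longrightarrow> \<eta> * (e \<bullet> b 0)\<^sup>2 \<le> frame_form H e + D2 \<phi> x e e"
    by (rule admissibleE) (rule that)
  have r: "0 \<le> r" using V by (simp add: mean_ge_def)
  have "\<forall>j. \<exists>D. weight (\<psi> j) D" using weight_of_smooth[OF \<psi>] by metis
  then obtain D where D: "\<And>j. weight (\<psi> j) (D j)" by metis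
  define A where "A = max 1 (9 * B)"
  have A: "1 \<le> A" "9 * B \<le> A" by (auto simp: A_def)
  have Ak: "1 \<le> A ^ k" using A(1) by (rule one_le_power)
  define J where "J = (\<Sum>j\<le>k. LBINT x. D j x)"
  have D0: "0 \<le> (LBINT x. D j x)" for j by (rule weight_integral_nonneg[OF D])
  have J: "0 \<le> J" "\<And>j. j \<le> k \<Longrightarrow> (LBINT x. D j x) \<le> J"
    unfolding J_def using D0 by (auto intro: sum_nonneg member_le_sum)
  \<comment> \<open>The summands serve, in turn, the bound on \<open>F\<close>, the bound on its gradient, and the error in the mean.\<close>
  define M where "M = 1 + (1 + K) * B + 3 * B * A ^ k + r * J"
  have M: "1 \<le> M" "(1 + K) * B \<le> M" "3 * B * A ^ k \<le> M" "r * J \<le> M"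
    using \<phi>(2) \<open>0 \<le> K\<close> Ak r J by (auto simp: M_def)
  define a :: real where "a = (1/2) ^ k"
  have a: "0 < a" "a \<le> 1" "a * 2 ^ k = 1" by (auto simp: a_def power_le_one power_one_over)
  define F where "F x = (a / M\<^sup>2) * \<phi> (M *\<^sub>R x)" for x
  have sM: "smooth (\<lambda>x. \<phi> (M *\<^sub>R x))" by (rule smooth_scaleR_arg[OF \<phi>(1)])
  have sF: "smooth F" unfolding F_def[abs_def] by (intro smooth_mult smooth_const sM)
  have dF: "D1 F x v = (a / M) * D1 \<phi> (M *\<^sub>R x) v" for x v
    unfolding F_def[abs_def] D1_cmult[OF sM] D1_scaleR_arg[OF \<phi>(1)]
    using M(1) by (simp add: power2_eq_square)
  have d2F: "D2 F x u v = a * D2 \<phi> (M *\<^sub>R x) u v" for x u v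
    unfolding F_def[abs_def] D2_cmult[OF sM] D2_scaleR_arg[OF \<phi>(1)]
    using M(1) by simp
  have fb: "frame_norm (b 1) = 1" by (rule frame_norm_frame) simp
  have d2Fb: "\<bar>D2 F x (b 1) (b 1)\<bar> \<le> B" for x
  proof -
    have "\<bar>D2 F x (b 1) (b 1)\<bar> = a * \<bar>D2 \<phi> (M *\<^sub>R x) (b 1) (b 1)\<bar>"
      using a by (simp add: d2F abs_mult)
    also have "\<dots> \<le> 1 * (B * (1 * 1))" using a \<phi>(5)[of "M *\<^sub>R x" "b 1" "b 1"] unfolding fb by (intro mult_mono) auto
    finally show ?thesis by simp
  qed
  define s where "s x = H 1 + D2 \<phi> x (b 1) (b 1)" for x
  define g where "g x = 2 * logistic (s x) - 1" for x
  have ss: "smooth s" unfolding s_def[abs_def]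
    by (intro smooth_add smooth_const smooth_D2 \<phi>(1))
  have sg: "smooth g" unfolding g_def[abs_def]
    by (intro smooth_diff smooth_mult smooth_const smooth_compose_real[OF smooth_logistic ss])
  define \<tau> where "\<tau> j x = \<psi> j x * g (M *\<^sub>R x)" for j x
  have s\<tau>: "smooth (\<tau> j)" for j unfolding \<tau>_def[abs_def] by (intro smooth_mult \<psi>(1) smooth_scaleR_arg[OF sg])
  have \<tau>le: "\<bar>\<tau> j x\<bar> \<le> \<psi> j x" for j x
  proof -
    have "\<psi> j x * \<bar>g (M *\<^sub>R x)\<bar> \<le> \<psi> j x * 1" unfolding g_def by (intro mult_left_mono logistic_sign \<psi>)
    then show ?thesis using \<psi>(3)[of j x] by (simp add: \<tau>_def abs_mult)
  qed
  have \<tau>out: "\<tau> j x = 0" if "x \<notin> cball (c j) (\<rho> j)" for j x using \<psi>(2)[OF that] by (simp add: \<tau>_def)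
  define K' where "K' = (\<Sum>j\<le>k. LBINT x. \<bar>D2 (\<tau> j) x (b 1) (b 1)\<bar>)"
  have K'j: "(LBINT x. \<bar>D2 (\<tau> j) x (b 1) (b 1)\<bar>) \<le> K'" if "j \<le> k" for j
    unfolding K'_def using that by (intro member_le_sum) auto
  have main: "real k * (LBINT x. \<psi> j x) - 1 \<le> (LBINT x. (S x + F x) * D2 (\<tau> j) x (b 1) (b 1))"
    if j: "j \<le> k" and S: "smooth S" "\<And>x. \<bar>D2 S x (b 1) (b 1)\<bar> \<le> C" for j S
  proof -
    define I where "I = (LBINT x. \<psi> j x)"
    have sSF: "smooth (\<lambda>x. S x + F x)" by (intro smooth_add S(1) sF)
    have d2: "D2 (\<lambda>x. S x + F x) x u v = D2 S x u v + D2 F x u v" for x u v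
      by (rule D2_add[OF S(1) sF])
    have "\<bar>D2 (\<lambda>x. S x + F x) x (b 1) (b 1)\<bar> \<le> C + B" for x
      unfolding d2 by (intro abs_add_le S d2Fb)
    then have parts: "(LBINT x. (S x + F x) * D2 (\<tau> j) x (b 1) (b 1))
      = (LBINT x. D2 (\<lambda>x. S x + F x) x (b 1) (b 1) * \<tau> j x)"
      by (rule integral_second_derivative_by_parts[OF sSF _ s\<tau>]) (rule \<tau>out)
    define G where "G x = \<bar>s x\<bar>" for x
    have cG: "continuous_on UNIV (\<lambda>x. G (M *\<^sub>R x))"
      unfolding G_def by (intro continuous_intros smooth_continuous[OF smooth_scaleR_arg[OF ss]])
    have bG: "\<bar>G (M *\<^sub>R x)\<bar> \<le> \<bar>H 1\<bar> + B" for x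
      using abs_add_le[OF order_refl \<phi>(5)[of "M *\<^sub>R x" "b 1" "b 1"], of "H 1"] unfolding G_def s_def fb by simp
    have i\<psi>: "integrable lborel (\<psi> j)" by (rule weightD(1)[OF D])
    have iG: "integrable lborel (\<lambda>x. \<psi> j x * G (M *\<^sub>R x))"
      by (rule integrable_mult_bounded_continuous[OF i\<psi> cG bG])
    have "mean_ge (r / M) (\<lambda>x. G (M *\<^sub>R x)) m"
      unfolding G_def using M(1)
      by (intro mean_ge_scaleR_arg V[folded s_def] continuous_intros smooth_continuous[OF ss]) auto
    from mean_geD[OF this D]
    have VG: "m * I - r / M * (LBINT x. D j x) \<le> (LBINT x. \<psi> j x * G (M *\<^sub>R x))" unfolding I_def .
    have err: "r / M * (LBINT x. D j x) \<le> 1"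
    proof -
      have "r * (LBINT x. D j x) \<le> M" using mult_left_mono[OF J(2)[OF j] r] M(4) by linarith
      then show ?thesis using M(1) by (simp add: field_simps)
    qed
    have pt: "a * (\<psi> j x * G (M *\<^sub>R x)) - (a * (2 + \<bar>H 1\<bar>) + C) * \<psi> j x
      \<le> D2 (\<lambda>x. S x + F x) x (b 1) (b 1) * \<tau> j x" for x
    proof -
      let ?y = "M *\<^sub>R x"
      have g1: "\<bar>g ?y\<bar> \<le> 1" unfolding g_def by (rule logistic_sign)
      have "\<bar>D2 S x (b 1) (b 1) * g ?y\<bar> \<le> C * 1" unfolding abs_mult using S(2) g1 \<open>0 \<le> C\<close> by (intro mult_mono) auto
      moreover have "\<bar>H 1 * g ?y\<bar> \<le> \<bar>H 1\<bar> * 1" unfolding abs_mult using g1 by (intro mult_mono) auto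
      moreover have "G ?y - 2 \<le> s ?y * g ?y" unfolding G_def g_def by (rule logistic_sign)
      ultimately have 1: "- C \<le> D2 S x (b 1) (b 1) * g ?y" "G ?y - (2 + \<bar>H 1\<bar>) \<le> s ?y * g ?y - H 1 * g ?y"
        by linarith+
      have "a * (G ?y - (2 + \<bar>H 1\<bar>)) \<le> a * (s ?y * g ?y - H 1 * g ?y)" using 1(2) a by (intro mult_left_mono) auto
      then have "a * (G ?y - (2 + \<bar>H 1\<bar>)) - C \<le> D2 S x (b 1) (b 1) * g ?y + a * (s ?y * g ?y - H 1 * g ?y)"
        using 1(1) by linarith
      from mult_left_mono[OF this \<psi>(3)[of j x]] show ?thesis
        unfolding d2 d2F \<tau>_def s_def by (simp add: algebra_simps)
    qed
    have "real k * I - 1 \<le> a * (m * I - 1) - (a * (2 + \<bar>H 1\<bar>) + C) * I"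
    proof -
      have "a * m = (a * 2 ^ k) * (C + real k) + a * (2 + \<bar>H 1\<bar>)" unfolding m_def by (simp add: algebra_simps)
      then have "a * m - (a * (2 + \<bar>H 1\<bar>) + C) = real k" using a(3) by simp
      then have "real k * I = a * (m * I) - (a * (2 + \<bar>H 1\<bar>) + C) * I" by (metis left_diff_distrib mult.assoc)
      then show ?thesis using a(2) by (simp add: right_diff_distrib)
    qed
    also have "\<dots> \<le> a * (LBINT x. \<psi> j x * G (M *\<^sub>R x)) - (a * (2 + \<bar>H 1\<bar>) + C) * I"
      using VG err a by (intro diff_right_mono mult_left_mono) auto
    also have "\<dots> = (LBINT x. a * (\<psi> j x * G (M *\<^sub>R x)) - (a * (2 + \<bar>H 1\<bar>) + C) * \<psi> j x)"
      unfolding I_def using iG i\<psi> by simp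
    also have "\<dots> \<le> (LBINT x. D2 (\<lambda>x. S x + F x) x (b 1) (b 1) * \<tau> j x)"
    proof (rule integral_mono[OF _ _ pt])
      show "integrable lborel (\<lambda>x. a * (\<psi> j x * G (M *\<^sub>R x)) - (a * (2 + \<bar>H 1\<bar>) + C) * \<psi> j x)"
        by (intro Bochner_Integration.integrable_diff integrable_mult_right iG i\<psi>)
      show "integrable lborel (\<lambda>x. D2 (\<lambda>x. S x + F x) x (b 1) (b 1) * \<tau> j x)"
        by (rule continuous_integrable_lborel[of _ "c j" "\<rho> j"])
           (simp_all add: \<tau>out continuous_on_mult smooth_continuous smooth_D2 sSF s\<tau>)
    qed
    finally show ?thesis unfolding parts I_def .
  qed
  have "stage H \<psi> k C K F B K'"
    unfolding stage_def
  proof (intro conjI allI impI)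
    show "smooth F" "0 \<le> B" by fact+
    show "0 \<le> K'" unfolding K'_def by (intro sum_nonneg) simp
    show "\<bar>F x\<bar> \<le> (1/2) ^ k / (1 + K)" for x
    proof -
      have "B / M\<^sup>2 \<le> 1 / (1 + K)"
      proof -
        have "(1 + K) * B \<le> M * M" using M(1,2) mult_mono[of 1 M "(1 + K) * B" M] \<phi>(2) \<open>0 \<le> K\<close> by simp
        then show ?thesis using M(1) \<open>0 \<le> K\<close> by (simp add: field_simps power2_eq_square)
      qed
      then have "a * (B / M\<^sup>2) \<le> a * (1 / (1 + K))" using a by (intro mult_left_mono) auto
      moreover have "\<bar>F x\<bar> = a / M\<^sup>2 * \<bar>\<phi> (M *\<^sub>R x)\<bar>" using a by (simp add: F_def abs_mult)
      moreover have "a / M\<^sup>2 * \<bar>\<phi> (M *\<^sub>R x)\<bar> \<le> a / M\<^sup>2 * B" using a by (intro mult_left_mono \<phi>(3)) auto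
      ultimately show ?thesis by (simp add: a_def)
    qed
    show "\<bar>D2 F x (b 1) (b 1)\<bar> \<le> B" for x by (rule d2Fb)
    show "- ((1/2) ^ k * frame_form H e) \<le> D2 F x e e" if "null_vector e" for x e
    proof -
      have "0 \<le> \<eta> * (e \<bullet> b 0)\<^sup>2" using \<phi>(6) by simp
      then have "- frame_form H e \<le> D2 \<phi> (M *\<^sub>R x) e e" using \<phi>(7)[OF that, of "M *\<^sub>R x"] by linarith
      from mult_left_mono[OF this, of a] a show ?thesis by (simp add: d2F a_def)
    qed
    show "\<exists>A\<ge>1. \<forall>x y v. \<bar>D1 F x v\<bar> \<le> (1/2) ^ k / A ^ k * norm v \<and>
        \<bar>D1 F x v - D1 F y v\<bar> \<le> A * norm (x - y) * norm v"
    proof (intro exI[of _ A] conjI A(1) allI)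
      fix x y v
      have "\<bar>D1 F x v\<bar> = a / M * \<bar>D1 \<phi> (M *\<^sub>R x) v\<bar>"
        using a M(1) by (simp add: dF abs_mult)
      also have "\<dots> \<le> a / M * (B * (3 * norm v))"
        using a M(1) \<phi>(2) by (intro mult_left_mono order_trans[OF \<phi>(4)] mult_left_mono frame_norm_le) auto
      also have "\<dots> = a * ((3 * B) / M) * norm v" by simp
      also have "\<dots> \<le> a * (1 / A ^ k) * norm v"
      proof -
        have "(3 * B) / M \<le> 1 / A ^ k" using M(1,3) Ak by (simp add: field_simps)
        then show ?thesis using a by (intro mult_right_mono mult_left_mono) auto
      qed
      finally show "\<bar>D1 F x v\<bar> \<le> (1/2) ^ k / A ^ k * norm v" by (simp add: a_def)
      have "\<bar>D1 F x v - D1 F y v\<bar> \<le> (A * norm v) * norm (x - y)"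
      proof (rule derivative_bound_imp_Lipschitz[OF smooth_D1_has_derivative[OF sF]])
        fix z w
        have "\<bar>D2 F z v w\<bar> = a * \<bar>D2 \<phi> (M *\<^sub>R z) v w\<bar>" using a by (simp add: d2F abs_mult)
        also have "\<dots> \<le> 1 * (B * (frame_norm v * frame_norm w))" using a \<phi>(2,5) by (intro mult_mono) (auto simp: frame_norm_nonneg)
        also have "\<dots> \<le> 1 * (B * ((3 * norm v) * (3 * norm w)))"
          using \<phi>(2) by (intro mult_left_mono mult_mono frame_norm_le) (auto simp: frame_norm_nonneg)
        also have "\<dots> = 9 * B * (norm v * norm w)" by simp
        also have "\<dots> \<le> A * (norm v * norm w)" by (rule mult_right_mono[OF A(2)]) simp
        finally show "\<bar>D2 F z v w\<bar> \<le> A * norm v * norm w" by (simp add: mult.assoc)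
      qed
      then show "\<bar>D1 F x v - D1 F y v\<bar> \<le> A * norm (x - y) * norm v" by (simp add: mult_ac)
    qed
    fix j assume j: "j \<le> k"
    show "detects C k F (\<psi> j) K'"
      unfolding detects_def by (intro exI[of _ "\<tau> j"] conjI allI impI s\<tau> \<tau>le K'j j main) auto
  qed
  with that show thesis by blast
qed

end

subsection \<open>Summation of the stages\<close>

lemma geometric_tail:
  fixes u :: "nat \<Rightarrow> real"
  assumes "\<And>n. \<bar>u n\<bar> \<le> (1/2) ^ n * c"
  shows "summable u" "\<bar>suminf u - (\<Sum>i<n. u i)\<bar> \<le> 2 * (1/2) ^ n * c"
proof -
  have g: "summable (\<lambda>n. (1/2) ^ n * c :: real)" by (intro summable_mult2 summable_geometric) simp
  show s: "summable u" by (rule summable_comparison_test'[OF g]) (use assms in auto)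
  have sn: "summable (\<lambda>i. \<bar>u (i + n)\<bar>)"
    by (rule summable_comparison_test'[OF summable_ignore_initial_segment[OF g, of n]]) (use assms in auto)
  have "suminf u - (\<Sum>i<n. u i) = (\<Sum>i. u (i + n))" using suminf_split_initial_segment[OF s, of n] by simp
  also have "\<bar>\<dots>\<bar> \<le> (\<Sum>i. \<bar>u (i + n)\<bar>)" by (rule summable_rabs[OF sn])
  also have "\<dots> \<le> (\<Sum>i. (1/2) ^ (i + n) * c)" using assms by (intro suminf_le sn summable_ignore_initial_segment[OF g])
  also have "\<dots> = (\<Sum>i. (1/2) ^ i * ((1/2) ^ n * c))" by (simp add: power_add mult.assoc)
  also have "\<dots> = 2 * ((1/2) ^ n * c)"
    by (subst suminf_mult2[symmetric]) (simp_all add: suminf_geometric summable_geometric)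
  finally show "\<bar>suminf u - (\<Sum>i<n. u i)\<bar> \<le> 2 * (1/2) ^ n * c" by simp
qed

lemma interpolate_le:
  fixes a X Y \<alpha> :: real
  assumes "0 \<le> a" "a \<le> X" "a \<le> Y" "0 < \<alpha>" "\<alpha> < 1"
  shows "a \<le> X powr (1 - \<alpha>) * Y powr \<alpha>"
proof (cases "a = 0")
  case False
  then have "a = a powr (1 - \<alpha>) * a powr \<alpha>" using assms by (simp flip: powr_add)
  also have "\<dots> \<le> X powr (1 - \<alpha>) * Y powr \<alpha>" using assms by (intro mult_mono powr_mono2) auto
  finally show ?thesis .
qed simp

text \<open>
  The increments of the $n$-th derivative are bounded both by $2 \cdot 2^{-n} A_n^{-n}$ and by $A_n |x - y|$. The geometric
  mean with exponents $1 - \alpha$, $\alpha$ is $|x - y|^\alpha$ times a geometric sequence times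
  $A_n^{\alpha - n (1 - \alpha)}$, and the last power is at most $1$ for all but finitely many $n$.
\<close>

lemma series_Holder_derivative:
  fixes F :: "nat \<Rightarrow> 'a::euclidean_space \<Rightarrow> real"
  assumes F: "\<And>n x. (F n has_derivative F' n x) (at x)" "\<And>n x. \<bar>F n x\<bar> \<le> (1/2) ^ n"
    and A: "\<And>n. 1 \<le> A n" "\<And>n x v. \<bar>F' n x v\<bar> \<le> (1/2) ^ n / A n ^ n * norm v"
      "\<And>n x y v. \<bar>F' n x v - F' n y v\<bar> \<le> A n * norm (x - y) * norm v"
  shows "((\<lambda>x. \<Sum>n. F n x) has_derivative (\<lambda>v. \<Sum>n. F' n x v)) (at x)"
    and "0 < \<alpha> \<Longrightarrow> \<alpha> < 1 \<Longrightarrow> \<exists>c>0. \<forall>x y v. \<bar>(\<Sum>n. F' n x v) - (\<Sum>n. F' n y v)\<bar> \<le> c * norm (x - y) powr \<alpha> * norm v"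
proof -
  have F'b: "\<bar>F' n x v\<bar> \<le> (1/2) ^ n * norm v" for n x v
  proof -
    have "(1/2) ^ n / A n ^ n \<le> (1/2) ^ n / (1::real)" using one_le_power[OF A(1)[of n], of n] by (intro divide_left_mono) auto
    then have "(1/2) ^ n / A n ^ n * norm v \<le> (1/2) ^ n * norm v" by (intro mult_right_mono) auto
    with A(2)[of n x v] show ?thesis by linarith
  qed
  have sF': "summable (\<lambda>n. F' n x v)" for x v by (rule geometric_tail(1)[of _ "norm v"]) (rule F'b)
  have sF: "summable (\<lambda>n. F n x)" for x by (rule geometric_tail(1)[of _ 1]) (use F(2) in simp)
  have "\<exists>g. \<forall>x\<in>UNIV. (\<lambda>n. F n x) sums (g x) \<and> (g has_derivative (\<lambda>v. \<Sum>n. F' n x v)) (at x within UNIV)"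
  proof (rule has_derivative_series[where f'=F' and x=0 and l="\<Sum>n. F n 0"])
    show "\<forall>\<^sub>F n in sequentially. \<forall>x\<in>UNIV. \<forall>h. norm ((\<Sum>i<n. F' i x h) - (\<Sum>n. F' n x h)) \<le> e * norm h" if "0 < e" for e
    proof -
      have "(\<lambda>n. 2 * (1/2) ^ n :: real) \<longlonglongrightarrow> 2 * 0" by (intro tendsto_intros LIMSEQ_realpow_zero) auto
      then have "\<forall>\<^sub>F n in sequentially. 2 * (1/2) ^ n < e" using that by (intro order_tendstoD) auto
      then show ?thesis
      proof eventually_elim
        case (elim n)
        have "\<bar>(\<Sum>i<n. F' i x h) - (\<Sum>n. F' n x h)\<bar> \<le> e * norm h" for x h
        proof -
          have "\<bar>(\<Sum>i<n. F' i x h) - (\<Sum>n. F' n x h)\<bar> \<le> 2 * (1/2) ^ n * norm h"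
            using geometric_tail(2)[of "\<lambda>n. F' n x h" "norm h" n] F'b by (simp add: abs_minus_commute)
          also have "\<dots> \<le> e * norm h" using elim by (intro mult_right_mono) auto
          finally show ?thesis .
        qed
        then show ?case by simp
      qed
    qed
    show "(\<lambda>n. F n 0) sums (\<Sum>n. F n 0)" by (rule summable_sums[OF sF])
  qed (use F(1) in auto)
  then obtain g where g: "\<And>x. (\<lambda>n. F n x) sums (g x)" "\<And>x. (g has_derivative (\<lambda>v. \<Sum>n. F' n x v)) (at x)" by auto
  have "g = (\<lambda>x. \<Sum>n. F n x)" using g(1) sums_unique by blast
  with g(2) show "((\<lambda>x. \<Sum>n. F n x) has_derivative (\<lambda>v. \<Sum>n. F' n x v)) (at x)" by simp
  assume \<alpha>: "0 < \<alpha>" "\<alpha> < 1"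
  define q where "q = (1/2 :: real) powr (1 - \<alpha>)"
  have q: "0 < q" "q < 1" using \<alpha> powr_less_mono2[of "1 - \<alpha>" "1 / 2" 1] by (auto simp: q_def)
  obtain N :: nat where N: "\<alpha> / (1 - \<alpha>) < real N" using reals_Archimedean2 by blast
  define c where "c n = 2 * q ^ n * (if n < N then A n else 1)" for n
  have c0: "0 \<le> c n" for n using q A(1)[of n] by (auto simp: c_def)
  have sc: "summable c"
  proof (rule summable_comparison_test_ev)
    show "\<forall>\<^sub>F n in sequentially. norm (c n) \<le> 2 * q ^ n"
      using eventually_ge_at_top[of N] by eventually_elim (use q in \<open>auto simp: c_def\<close>)
    show "summable (\<lambda>n. 2 * q ^ n)" using q by (intro summable_mult summable_geometric) auto
  qed
  have bnd: "\<bar>F' n x v - F' n y v\<bar> \<le> c n * (norm (x - y) powr \<alpha> * norm v)" for n x y v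
  proof -
    define a where "a = A n"
    have a: "1 \<le> a" using A(1) by (simp add: a_def)
    define X where "X = 2 * ((1/2) ^ n / a ^ n) * norm v"
    define Y where "Y = a * norm (x - y) * norm v"
    have "\<bar>F' n x v - F' n y v\<bar> \<le> X"
      using A(2)[of n x v] A(2)[of n y v] unfolding X_def a_def by linarith
    moreover have "\<bar>F' n x v - F' n y v\<bar> \<le> Y" using A(3) by (simp add: Y_def a_def)
    ultimately have "\<bar>F' n x v - F' n y v\<bar> \<le> X powr (1 - \<alpha>) * Y powr \<alpha>"
      using \<alpha> by (intro interpolate_le) auto
    also have "X powr (1 - \<alpha>) = 2 powr (1 - \<alpha>) * (q ^ n / a powr (real n * (1 - \<alpha>))) * norm v powr (1 - \<alpha>)"
    proof -
      have "((1/2) ^ n) powr (1 - \<alpha>) = q ^ n"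
        unfolding q_def by (simp add: powr_powr mult.commute flip: powr_realpow)
      moreover have "(a ^ n) powr (1 - \<alpha>) = a powr (real n * (1 - \<alpha>))"
        using a by (simp add: powr_powr flip: powr_realpow)
      ultimately show ?thesis using a unfolding X_def by (simp add: powr_mult powr_divide del: power_one_over)
    qed
    also have "Y powr \<alpha> = a powr \<alpha> * norm (x - y) powr \<alpha> * norm v powr \<alpha>"
      using a by (simp add: Y_def powr_mult)
    also have "2 powr (1 - \<alpha>) * (q ^ n / a powr (real n * (1 - \<alpha>))) * norm v powr (1 - \<alpha>) * (a powr \<alpha> * norm (x - y) powr \<alpha> * norm v powr \<alpha>)
      = (2 powr (1 - \<alpha>) * (q ^ n * a powr (\<alpha> - real n * (1 - \<alpha>)))) * (norm (x - y) powr \<alpha> * (norm v powr (1 - \<alpha>) * norm v powr \<alpha>))"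
      by (simp add: powr_diff)
    also have "norm v powr (1 - \<alpha>) * norm v powr \<alpha> = norm v" using \<alpha> by (simp flip: powr_add)
    also have "(2 powr (1 - \<alpha>) * (q ^ n * a powr (\<alpha> - real n * (1 - \<alpha>)))) \<le> c n"
    proof -
      have "a powr (\<alpha> - real n * (1 - \<alpha>)) \<le> (if n < N then a else 1)"
      proof (cases "n < N")
        case True
        have "0 \<le> real n * (1 - \<alpha>)" using \<alpha> by simp
        then have "a powr (\<alpha> - real n * (1 - \<alpha>)) \<le> a powr 1" using a \<alpha> by (intro powr_mono) linarith+
        with True a show ?thesis by simp
      next
        case False
        then have "\<alpha> / (1 - \<alpha>) < real n" using N by linarith
        then have "\<alpha> - real n * (1 - \<alpha>) \<le> 0" using \<alpha> by (simp add: field_simps)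
        then have "a powr (\<alpha> - real n * (1 - \<alpha>)) \<le> a powr 0" using a by (intro powr_mono) auto
        with False a show ?thesis by simp
      qed
      moreover have "2 powr (1 - \<alpha>) \<le> 2 powr (1::real)" using \<alpha> by (intro powr_mono) auto
      ultimately have "2 powr (1 - \<alpha>) * (q ^ n * a powr (\<alpha> - real n * (1 - \<alpha>))) \<le> 2 * (q ^ n * (if n < N then a else 1))"
        using q by (intro mult_mono) auto
      then show ?thesis unfolding c_def mult.assoc a_def[symmetric] .
    qed
    finally show ?thesis by (simp add: mult_right_mono)
  qed
  show "\<exists>c>0. \<forall>x y v. \<bar>(\<Sum>n. F' n x v) - (\<Sum>n. F' n y v)\<bar> \<le> c * norm (x - y) powr \<alpha> * norm v"
  proof (intro exI[of _ "suminf c + 1"] conjI allI)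
    show "0 < suminf c + 1" using suminf_nonneg[OF sc c0] by simp
    fix x y v :: 'a
    let ?d = "norm (x - y) powr \<alpha> * norm v"
    have s2: "summable (\<lambda>n. c n * ?d)" by (rule summable_mult2[OF sc])
    have s1: "summable (\<lambda>n. \<bar>F' n x v - F' n y v\<bar>)"
      by (rule summable_comparison_test'[OF s2]) (use bnd in auto)
    have "\<bar>(\<Sum>n. F' n x v) - (\<Sum>n. F' n y v)\<bar> = \<bar>\<Sum>n. F' n x v - F' n y v\<bar>" by (simp add: suminf_diff[OF sF' sF'])
    also have "\<dots> \<le> (\<Sum>n. \<bar>F' n x v - F' n y v\<bar>)" by (rule summable_rabs[OF s1])
    also have "\<dots> \<le> (\<Sum>n. c n * ?d)" by (rule suminf_le[OF bnd s1 s2])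
    also have "\<dots> = suminf c * ?d" by (rule suminf_mult2[OF sc, symmetric])
    also have "\<dots> \<le> (suminf c + 1) * ?d" by (intro mult_right_mono) auto
    finally show "\<bar>(\<Sum>n. F' n x v) - (\<Sum>n. F' n y v)\<bar> \<le> (suminf c + 1) * norm (x - y) powr \<alpha> * norm v" by (simp add: mult.assoc)
  qed
qed

lemma smooth_convex_along:
  fixes S :: "'a::euclidean_space \<Rightarrow> real"
  assumes S: "smooth S" "\<And>x. 0 \<le> D2 S x (x1 - x0) (x1 - x0)" and uv: "0 \<le> u" "0 \<le> v" "u + v = 1"
  shows "S (u *\<^sub>R x0 + v *\<^sub>R x1) \<le> u * S x0 + v * S x1"
proof -
  let ?e = "x1 - x0"
  have line: "((\<lambda>s. x0 + s *\<^sub>R ?e) has_derivative (\<lambda>s. s *\<^sub>R ?e)) (at s)" for s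
    by (auto intro!: derivative_eq_intros)
  have lin: "D1 S y (r *\<^sub>R ?e) = D1 S y ?e * r"
    "D2 S y ?e (r *\<^sub>R ?e) = D2 S y ?e ?e * r" for y r
    using linear_scale[OF has_derivative_linear[OF smooth_has_derivative[OF S(1)]], of y r ?e]
      linear_scale[OF has_derivative_linear[OF smooth_D1_has_derivative[OF S(1), of ?e]], of y r ?e] by (simp_all add: mult.commute)
  have "convex_on UNIV (\<lambda>s. S (x0 + s *\<^sub>R ?e))"
  proof (rule f''_ge0_imp_convex[where f'="\<lambda>s. D1 S (x0 + s *\<^sub>R ?e) ?e" and f''="\<lambda>s. D2 S (x0 + s *\<^sub>R ?e) ?e ?e"])
    show "((\<lambda>s. S (x0 + s *\<^sub>R ?e)) has_real_derivative D1 S (x0 + s *\<^sub>R ?e) ?e) (at s)" for s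
      using has_derivative_compose[OF line smooth_has_derivative[OF S(1)]] unfolding lin has_field_derivative_def by simp
    show "((\<lambda>s. D1 S (x0 + s *\<^sub>R ?e) ?e) has_real_derivative D2 S (x0 + s *\<^sub>R ?e) ?e ?e) (at s)" for s
      using has_derivative_compose[OF line smooth_D1_has_derivative[OF S(1), of ?e]] unfolding lin has_field_derivative_def by simp
  qed (use S(2) in auto)
  then have "S (x0 + (u *\<^sub>R 0 + v *\<^sub>R 1) *\<^sub>R ?e) \<le> u * S (x0 + 0 *\<^sub>R ?e) + v * S (x0 + 1 *\<^sub>R ?e)"
    using uv unfolding convex_on_def by blast
  moreover have "x0 + (u *\<^sub>R 0 + v *\<^sub>R 1) *\<^sub>R ?e = u *\<^sub>R x0 + v *\<^sub>R x1"
  proof -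
    have "x0 = (u + v) *\<^sub>R x0" using uv by simp
    then show ?thesis by (simp add: algebra_simps)
  qed
  ultimately show ?thesis by simp
qed

lemma countable_family_of_bumps:
  obtains c :: "nat \<Rightarrow> 'a::euclidean_space" and \<rho> :: "nat \<Rightarrow> real"
  where "\<And>j. 0 < \<rho> j" "\<And>\<Omega>. open \<Omega> \<Longrightarrow> \<Omega> \<noteq> {} \<Longrightarrow> \<exists>j. cball (c j) (\<rho> j) \<subseteq> \<Omega>"
proof -
  obtain D :: "'a set" where D: "countable D" "\<And>X. open X \<Longrightarrow> X \<noteq> {} \<Longrightarrow> \<exists>d\<in>D. d \<in> X"
    using countable_dense_setE by blast
  have ne: "D \<noteq> {}" using D(2)[of UNIV] by auto
  define P where "P = D \<times> (UNIV :: nat set)"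
  have P: "countable P" "P \<noteq> {}" using D(1) ne by (auto simp: P_def)
  define c where "c j = fst (from_nat_into P j)" for j
  define \<rho> where "\<rho> j = 1 / real (Suc (snd (from_nat_into P j)))" for j
  show thesis
  proof (rule that)
    show "0 < \<rho> j" for j by (simp add: \<rho>_def)
    fix \<Omega> :: "'a set" assume "open \<Omega>" "\<Omega> \<noteq> {}"
    then obtain x \<epsilon> where x: "0 < \<epsilon>" "ball x \<epsilon> \<subseteq> \<Omega>" using openE by blast
    obtain n where n: "1 / real (Suc n) < \<epsilon> / 2" using nat_approx_posE[of "\<epsilon> / 2"] x(1) by auto
    have "open (ball x (\<epsilon> / 2))" "ball x (\<epsilon> / 2) \<noteq> {}" using x(1) by auto
    then obtain d where d: "d \<in> D" "d \<in> ball x (\<epsilon> / 2)" using D(2) by blast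
    have "(d, n) \<in> P" using d by (simp add: P_def)
    then obtain j where j: "from_nat_into P j = (d, n)" using from_nat_into_surj[OF P(1)] by metis
    have "cball d (1 / real (Suc n)) \<subseteq> ball x \<epsilon>"
    proof
      fix y assume "y \<in> cball d (1 / real (Suc n))"
      then show "y \<in> ball x \<epsilon>" using d(2) n dist_triangle[of x y d] unfolding mem_ball mem_cball by linarith
    qed
    then show "\<exists>j. cball (c j) (\<rho> j) \<subseteq> \<Omega>" using x(2) by (intro exI[of _ j]) (auto simp: c_def \<rho>_def j)
  qed
qed

context null_frame
begin

lemma null_vector_scaleR: "null_vector e \<Longrightarrow> null_vector (t *\<^sub>R e)"
  unfolding null_vector_def by (simp add: power_mult_distrib flip: distrib_left)

lemma smooth_frame_form: "smooth (frame_form H)"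
proof -
  have "smooth (\<lambda>x. \<Sum>i<3. H i * ((x \<bullet> b i) * (x \<bullet> b i)))" by (intro smooth_intros)
  then show ?thesis by (simp add: frame_form_def[abs_def] power2_eq_square)
qed

lemma derivatives_frame_form:
  "D1 (frame_form H) x v = (\<Sum>i<3. 2 * H i * (x \<bullet> b i) * (v \<bullet> b i))"
  "D2 (frame_form H) x u v = (\<Sum>i<3. 2 * H i * (u \<bullet> b i) * (v \<bullet> b i))"
proof -
  have 1: "(frame_form H has_derivative (\<lambda>v. \<Sum>i<3. 2 * H i * (x \<bullet> b i) * (v \<bullet> b i))) (at x)" for x
    unfolding frame_form_def[abs_def] by (auto intro!: derivative_eq_intros simp: algebra_simps)
  have 2: "((\<lambda>x. \<Sum>i<3. 2 * H i * (x \<bullet> b i) * (u \<bullet> b i)) has_derivative (\<lambda>v. \<Sum>i<3. 2 * H i * (u \<bullet> b i) * (v \<bullet> b i))) (at x)" for x u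
    by (auto intro!: derivative_eq_intros simp: algebra_simps)
  note * = D2_eqI[OF 1 2]
  show "D1 (frame_form H) x v = (\<Sum>i<3. 2 * H i * (x \<bullet> b i) * (v \<bullet> b i))" by (simp add: *(1))
  show "D2 (frame_form H) x u v = (\<Sum>i<3. 2 * H i * (u \<bullet> b i) * (v \<bullet> b i))" by (rule *(2))
qed

lemma derivative_frame_form_Lipschitz:
  obtains L where "0 \<le> L" "\<And>x y v. \<bar>D1 (frame_form H) x v - D1 (frame_form H) y v\<bar> \<le> L * norm (x - y) * norm v"
proof (rule that)
  show "0 \<le> (\<Sum>i<3. 2 * \<bar>H i\<bar>)" by (intro sum_nonneg) auto
  fix x y v
  have "D1 (frame_form H) x v - D1 (frame_form H) y v
    = (\<Sum>i<3. 2 * H i * ((x - y) \<bullet> b i) * (v \<bullet> b i))"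
    unfolding derivatives_frame_form sum_subtractf[symmetric] by (intro sum.cong refl) (simp add: algebra_simps inner_diff_left)
  also have "\<bar>\<dots>\<bar> \<le> (\<Sum>i<3. 2 * \<bar>H i\<bar> * norm (x - y) * norm v)"
  proof (rule order_trans[OF sum_abs sum_mono])
    fix i :: nat assume "i \<in> {..<3}"
    then have "norm (b i) = 1" using norm_frame by simp
    then have "\<bar>(x - y) \<bullet> b i\<bar> \<le> norm (x - y)" "\<bar>v \<bullet> b i\<bar> \<le> norm v"
      using Cauchy_Schwarz_ineq2[of "x - y" "b i"] Cauchy_Schwarz_ineq2[of v "b i"] by auto
    then show "\<bar>2 * H i * ((x - y) \<bullet> b i) * (v \<bullet> b i)\<bar> \<le> 2 * \<bar>H i\<bar> * norm (x - y) * norm v"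
      unfolding abs_mult by (intro mult_mono) auto
  qed
  finally show "\<bar>D1 (frame_form H) x v - D1 (frame_form H) y v\<bar> \<le> (\<Sum>i<3. 2 * \<bar>H i\<bar>) * norm (x - y) * norm v"
    by (simp add: sum_distrib_right)
qed

text \<open>
  The function is the quadratic form of \<open>unbounded_hessian_mean\<close> plus the sum of recursively chosen stages. The
  second derivative of the form is twice the form, which pays for the costs $2^{-n}$ of all stages. For the lower bound, stage
  $n$ contributes at least $n \int \psi - 1$, and the terms after it change the
  integral by at most $2$.
\<close>

lemma wild_null_convex_function:
  obtains f :: "'a \<Rightarrow> real" and f' where
    "\<And>x y u v. null_vector (y - x) \<Longrightarrow> 0 \<le> u \<Longrightarrow> 0 \<le> v \<Longrightarrow> u + v = 1 \<Longrightarrow> f (u *\<^sub>R x + v *\<^sub>R y) \<le> u * f x + v * f y"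
    "\<And>x. (f has_derivative f' x) (at x)"
    "\<And>\<alpha> R. 0 < \<alpha> \<Longrightarrow> \<alpha> < 1 \<Longrightarrow> 0 < R \<Longrightarrow>
       \<exists>c>0. \<forall>x y v. norm (x - y) \<le> R \<longrightarrow> \<bar>f' x v - f' y v\<bar> \<le> c * norm (x - y) powr \<alpha> * norm v"
    "\<And>\<Omega> B. open \<Omega> \<Longrightarrow> \<Omega> \<noteq> {} \<Longrightarrow>
       \<exists>\<tau>\<in>test_functions \<Omega>. (\<forall>x. \<bar>\<tau> x\<bar> \<le> 1) \<and> B < (LBINT x. f x * D2 \<tau> x (b 1) (b 1))"
proof -
  obtain H where H: "null_positive H" "\<And>m. attains H m" by (rule unbounded_hessian_mean) (rule that)
  obtain c :: "nat \<Rightarrow> 'a" and \<rho> where c\<rho>: "\<And>j. 0 < \<rho> j" "\<And>\<Omega>. open \<Omega> \<Longrightarrow> \<Omega> \<noteq> {} \<Longrightarrow> \<exists>j. cball (c j) (\<rho> j) \<subseteq> \<Omega>"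
    by (rule countable_family_of_bumps) (rule that)
  define \<psi> where "\<psi> j = bump (c j) (\<rho> j)" for j
  have \<psi>: "smooth (\<psi> j)" "\<And>x. x \<notin> cball (c j) (\<rho> j) \<Longrightarrow> \<psi> j x = 0" "\<And>x. 0 \<le> \<psi> j x" for j
  proof -
    show "smooth (\<psi> j)" "0 \<le> \<psi> j x" for x unfolding \<psi>_def by (rule smooth_bump bump_bounds)+
    show "\<psi> j x = 0" if "x \<notin> cball (c j) (\<rho> j)" for x
      unfolding \<psi>_def using that ball_subset_cball by (intro bump_eq_0[OF c\<rho>(1)]) blast
  qed
  define C0 where "C0 = 2 * \<bar>H 1\<bar>"
  \<comment> \<open>The state \<open>X n\<close> consists of the function chosen last, its accumulated bound \<open>C\<close> and its accumulated bound \<open>K\<close>.\<close>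
  have "\<exists>X. \<forall>n. (0 \<le> fst (snd (X n)) \<and> 0 \<le> snd (snd (X n)) \<and> (n = 0 \<longrightarrow> fst (snd (X n)) = C0)) \<and>
     stage H \<psi> n (fst (snd (X n))) (snd (snd (X n))) (fst (X (Suc n)))
       (fst (snd (X (Suc n))) - fst (snd (X n))) (snd (snd (X (Suc n))) - snd (snd (X n)))"
  proof (rule dependent_nat_choice)
    show "\<exists>X :: ('a \<Rightarrow> real) \<times> real \<times> real. 0 \<le> fst (snd X) \<and> 0 \<le> snd (snd X) \<and> ((0::nat) = 0 \<longrightarrow> fst (snd X) = C0)"
      by (intro exI[of _ "((\<lambda>_. 0), C0, 0)"]) (simp add: C0_def)
    fix X :: "('a \<Rightarrow> real) \<times> real \<times> real" and n :: nat
    assume X: "0 \<le> fst (snd X) \<and> 0 \<le> snd (snd X) \<and> (n = 0 \<longrightarrow> fst (snd X) = C0)"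
    have X0: "0 \<le> fst (snd X)" "0 \<le> snd (snd X)" using X by blast+
    have "\<exists>F C' K'. stage H \<psi> n (fst (snd X)) (snd (snd X)) F C' K'"
      by (rule stage_exists[where H=H and \<psi>=\<psi> and k=n and c=c and \<rho>=\<rho>, OF H(2) X0 \<psi>(1) \<psi>(2) \<psi>(3)]) blast+
    then obtain F C' K' where st: "stage H \<psi> n (fst (snd X)) (snd (snd X)) F C' K'" by blast
    then have "0 \<le> C'" "0 \<le> K'" by (rule stageD)+
    have e: "r + t - r = t" for r t :: real by simp
    show "\<exists>Y. (0 \<le> fst (snd Y) \<and> 0 \<le> snd (snd Y) \<and> (Suc n = 0 \<longrightarrow> fst (snd Y) = C0)) \<and>
       stage H \<psi> n (fst (snd X)) (snd (snd X)) (fst Y) (fst (snd Y) - fst (snd X)) (snd (snd Y) - snd (snd X))"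
      unfolding fst_conv snd_conv
    proof (rule exI[of _ "(F, fst (snd X) + C', snd (snd X) + K')"], unfold fst_conv snd_conv e, intro conjI)
      show "0 \<le> fst (snd X) + C'" "0 \<le> snd (snd X) + K'" using X \<open>0 \<le> C'\<close> \<open>0 \<le> K'\<close> by (intro add_nonneg_nonneg; blast)+
      show "stage H \<psi> n (fst (snd X)) (snd (snd X)) F C' K'" by (rule st)
    qed simp
  qed
  then obtain X where X: "\<And>n. 0 \<le> fst (snd (X n))" "\<And>n. 0 \<le> snd (snd (X n))" "fst (snd (X 0)) = C0"
     "\<And>n. stage H \<psi> n (fst (snd (X n))) (snd (snd (X n))) (fst (X (Suc n)))
       (fst (snd (X (Suc n))) - fst (snd (X n))) (snd (snd (X (Suc n))) - snd (snd (X n)))" by blast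
  define F C K where "F n = fst (X (Suc n))" and "C n = fst (snd (X n))" and "K n = snd (snd (X n))" for n
  have C: "0 \<le> C n" "C 0 = C0" and K: "0 \<le> K n" for n using X by (auto simp: C_def K_def)
  have st: "stage H \<psi> n (C n) (K n) (F n) (C (Suc n) - C n) (K (Suc n) - K n)" for n
    using X(4) by (simp add: F_def C_def K_def)
  have "K n \<le> K (Suc n)" for n using stageD(3)[OF st[of n]] by linarith
  then have Kmono: "K n \<le> K m" if "n \<le> m" for n m using that by (rule lift_Suc_mono_le)
  note sF = stageD(1)[OF st]
  note Fb = stageD(4)[OF st]
  have Fb1: "\<bar>F n x\<bar> \<le> (1/2) ^ n" for n x
  proof -
    have "(1/2) ^ n / (1 + K n) \<le> (1/2) ^ n / (1 :: real)" using K[of n] by (intro divide_left_mono) auto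
    with Fb[of n x] show ?thesis by simp
  qed
  note F2 = stageD(5)[OF st] and Fnull = stageD(6)[OF st]
  have "\<forall>n. \<exists>A\<ge>1. \<forall>x y v. \<bar>D1 (F n) x v\<bar> \<le> (1/2) ^ n / A ^ n * norm v \<and>
        \<bar>D1 (F n) x v - D1 (F n) y v\<bar> \<le> A * norm (x - y) * norm v"
    using stageD(7)[OF st] by (rule allI)
  then obtain A where A: "\<And>n. 1 \<le> A n" "\<And>n x v. \<bar>D1 (F n) x v\<bar> \<le> (1/2) ^ n / A n ^ n * norm v"
    "\<And>n x y v. \<bar>D1 (F n) x v - D1 (F n) y v\<bar> \<le> A n * norm (x - y) * norm v"
    by metis
  define g where "g x = (\<Sum>n. F n x)" for x
  define g' where "g' x v = (\<Sum>n. D1 (F n) x v)" for x v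
  have g: "(g has_derivative g' x) (at x)" for x
    unfolding g_def[abs_def] g'_def[abs_def]
    by (rule series_Holder_derivative(1)[OF smooth_has_derivative[OF sF] Fb1 A])
  have gH: "\<exists>c>0. \<forall>x y v. \<bar>g' x v - g' y v\<bar> \<le> c * norm (x - y) powr \<alpha> * norm v" if "0 < \<alpha>" "\<alpha> < 1" for \<alpha>
    unfolding g'_def by (rule series_Holder_derivative(2)[OF smooth_has_derivative[OF sF] Fb1 A that])
  have sumF: "summable (\<lambda>n. F n x)" for x by (rule geometric_tail(1)[of _ 1]) (use Fb1 in simp)
  define S where "S n x = frame_form H x + (\<Sum>i<n. F i x)" for n x
  have sS: "smooth (S n)" for n unfolding S_def[abs_def] by (intro smooth_add smooth_sum smooth_frame_form sF)
  have S_Suc: "S (Suc n) = (\<lambda>x. S n x + F n x)" for n by (auto simp: S_def)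
  have S2: "D2 (S n) x u v = D2 (frame_form H) x u v + (\<Sum>i<n. D2 (F i) x u v)" for n x u v
  proof (induction n)
    case 0
    show ?case by (simp add: S_def)
  next
    case (Suc n)
    then show ?case unfolding S_Suc by (simp add: D2_add[OF sS sF])
  qed
  define f where "f x = frame_form H x + g x" for x
  define f' where "f' x v = D1 (frame_form H) x v + g' x v" for x v
  have f: "(f has_derivative f' x) (at x)" for x
    unfolding f_def[abs_def] f'_def[abs_def]
    by (rule has_derivative_add[OF smooth_has_derivative[OF smooth_frame_form] g])
  have cf: "continuous_on UNIV f" by (intro continuous_at_imp_continuous_on ballI) (rule has_derivative_continuous[OF f])
  have Sf: "(\<lambda>n. S n x) \<longlonglongrightarrow> f x" for x
    unfolding S_def f_def g_def by (intro tendsto_intros summable_LIMSEQ sumF)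
  show thesis
  proof (rule that[of f f'])
    show "f (u *\<^sub>R x + v *\<^sub>R y) \<le> u * f x + v * f y" if e: "null_vector (y - x)" and uv: "0 \<le> u" "0 \<le> v" "u + v = 1" for x y u v
    proof (rule LIMSEQ_le[OF Sf])
      show "(\<lambda>n. u * S n x + v * S n y) \<longlonglongrightarrow> u * f x + v * f y" by (intro tendsto_intros Sf)
      have Q: "0 \<le> frame_form H (y - x)"
      proof -
        have "0 \<le> H 0 + H 1" "0 \<le> H 0 + H 2" using H(1) unfolding null_positive_def by linarith+
        then show ?thesis unfolding frame_form_null[OF e] by (metis add_nonneg_nonneg mult_nonneg_nonneg zero_le_power2)
      qed
      have "0 \<le> D2 (S n) z (y - x) (y - x)" for n z
      proof -
        have "D2 (frame_form H) z (y - x) (y - x) = 2 * frame_form H (y - x)"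
          unfolding derivatives_frame_form frame_form_def by (simp add: sum_distrib_left power2_eq_square mult.assoc)
        moreover have "- (\<Sum>i<n. (1/2) ^ i * frame_form H (y - x)) \<le> (\<Sum>i<n. D2 (F i) z (y - x) (y - x))"
          unfolding sum_negf[symmetric] by (intro sum_mono Fnull e)
        moreover have "(\<Sum>i<n. (1/2) ^ i * frame_form H (y - x)) = (\<Sum>i<n. (1/2) ^ i) * frame_form H (y - x)"
          by (simp add: sum_distrib_right)
        moreover have "(\<Sum>i<n. (1/2) ^ i :: real) \<le> 2" by (simp add: sum_gp_strict)
        then have "(\<Sum>i<n. (1/2) ^ i) * frame_form H (y - x) \<le> 2 * frame_form H (y - x)" using Q by (intro mult_right_mono)
        ultimately show ?thesis unfolding S2 by linarith
      qed
      then show "\<exists>N. \<forall>n\<ge>N. S n (u *\<^sub>R x + v *\<^sub>R y) \<le> u * S n x + v * S n y"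
        using smooth_convex_along[OF sS _ uv] by blast
    qed
    show "(f has_derivative f' x) (at x)" for x by (rule f)
    show "\<exists>c>0. \<forall>x y v. norm (x - y) \<le> R \<longrightarrow> \<bar>f' x v - f' y v\<bar> \<le> c * norm (x - y) powr \<alpha> * norm v"
      if \<alpha>: "0 < \<alpha>" "\<alpha> < 1" and R: "0 < R" for \<alpha> R
    proof -
      obtain c where c: "0 < c" "\<And>x y v. \<bar>g' x v - g' y v\<bar> \<le> c * norm (x - y) powr \<alpha> * norm v" using gH[OF \<alpha>] by blast
      obtain L where L: "0 \<le> L" "\<And>x y v. \<bar>D1 (frame_form H) x v - D1 (frame_form H) y v\<bar> \<le> L * norm (x - y) * norm v"
        by (rule derivative_frame_form_Lipschitz[of H]) (rule that)
      show ?thesis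
      proof (intro exI[of _ "c + L * R powr (1 - \<alpha>)"] conjI allI impI)
        show "0 < c + L * R powr (1 - \<alpha>)" using c L by (intro add_pos_nonneg) auto
        fix x y v :: 'a assume xy: "norm (x - y) \<le> R"
        have "norm (x - y) = norm (x - y) powr (1 - \<alpha>) * norm (x - y) powr \<alpha>"
          using \<alpha> by (cases "x = y") (simp_all flip: powr_add)
        also have "\<dots> \<le> R powr (1 - \<alpha>) * norm (x - y) powr \<alpha>" using xy \<alpha> by (intro mult_right_mono powr_mono2) auto
        finally have "L * norm (x - y) * norm v \<le> L * (R powr (1 - \<alpha>) * norm (x - y) powr \<alpha>) * norm v"
          using L by (intro mult_right_mono mult_left_mono) auto
        with L(2)[where x=x and y=y and v=v] c(2)[where x=x and y=y and v=v]
        have "\<bar>f' x v - f' y v\<bar> \<le> L * (R powr (1 - \<alpha>) * norm (x - y) powr \<alpha>) * norm v + c * norm (x - y) powr \<alpha> * norm v"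
          unfolding f'_def by linarith
        then show "\<bar>f' x v - f' y v\<bar> \<le> (c + L * R powr (1 - \<alpha>)) * norm (x - y) powr \<alpha> * norm v"
          by (simp add: algebra_simps)
      qed
    qed
    fix \<Omega> :: "'a set" and B :: real assume \<Omega>: "open \<Omega>" "\<Omega> \<noteq> {}"
    obtain j where j: "cball (c j) (\<rho> j) \<subseteq> \<Omega>" using c\<rho>(2)[OF \<Omega>] by blast
    define I where "I = (LBINT x. \<psi> j x)"
    have I: "0 < I" unfolding I_def \<psi>_def by (rule integral_bump_pos[OF c\<rho>(1)])
    obtain n0 :: nat where n0: "(B + 3) / I < real n0" using reals_Archimedean2 by blast
    define n where "n = max n0 j"
    have "(B + 3) / I < real n" using n0 by (simp add: n_def)
    then have n: "B + 3 < real n * I" "j \<le> n" using I by (auto simp: field_simps n_def)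
    have C_S: "\<bar>D2 (S m) x (b 1) (b 1)\<bar> \<le> C m" for m x
    proof (induction m)
      case 0
      have "D2 (frame_form H) x (b 1) (b 1) = (\<Sum>i<(3::nat). if i = 1 then 2 * H 1 else 0)"
        unfolding derivatives_frame_form by (intro sum.cong refl) (use orthonormal[of 1] in auto)
      then show ?case by (simp add: S2 C C0_def abs_mult)
    next
      case (Suc m)
      then show ?case unfolding S_Suc D2_add[OF sS sF] using F2[of m x] by linarith
    qed
    have "detects (C n) n (F n) (\<psi> j) (K (Suc n) - K n)" by (rule stageD(8)[OF st n(2)])
    then obtain \<tau> where \<tau>: "smooth \<tau>" "\<And>x. \<bar>\<tau> x\<bar> \<le> \<psi> j x"
        "(LBINT x. \<bar>D2 \<tau> x (b 1) (b 1)\<bar>) \<le> K (Suc n) - K n"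
        "\<And>S. smooth S \<Longrightarrow> (\<And>x. \<bar>D2 S x (b 1) (b 1)\<bar> \<le> C n) \<Longrightarrow>
           real n * (LBINT x. \<psi> j x) - 1 \<le> (LBINT x. (S x + F n x) * D2 \<tau> x (b 1) (b 1))"
      unfolding detects_def by blast
    have \<tau>out: "\<tau> x = 0" if "x \<notin> cball (c j) (\<rho> j)" for x using \<tau>(2)[of x] \<psi>(2)[OF that] by simp
    let ?d = "\<lambda>x. D2 \<tau> x (b 1) (b 1)"
    have cd: "continuous_on UNIV ?d" by (rule smooth_continuous[OF smooth_D2[OF \<tau>(1)]])
    have dout: "?d x = 0" if "x \<notin> cball (c j) (\<rho> j)" for x by (rule D2_vanishes[OF \<tau>out that])
    have int: "integrable lborel (\<lambda>x. h x * ?d x)" if "continuous_on UNIV h" for h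
    proof (rule continuous_integrable_lborel[of _ "c j" "\<rho> j"])
      show "continuous_on UNIV (\<lambda>x. h x * ?d x)" by (rule continuous_on_mult[OF that cd])
      show "h x * ?d x = 0" if "x \<notin> cball (c j) (\<rho> j)" for x unfolding dout[OF that] by (rule mult_zero_right)
    qed
    have "\<bar>f x - S (Suc n) x\<bar> \<le> 2 / (1 + K (Suc n))" for x
    proof -
      have t: "\<bar>if i \<le> n then 0 else F i x\<bar> \<le> (1/2) ^ i * (1 / (1 + K (Suc n)))" for i
      proof (cases "i \<le> n")
        case False
        have "\<bar>F i x\<bar> \<le> (1/2) ^ i / (1 + K i)" by (rule Fb)
        also have "\<dots> \<le> (1/2) ^ i / (1 + K (Suc n))" using Kmono[of "Suc n" i] K[of "Suc n"] False by (intro divide_left_mono mult_pos_pos) auto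
        finally show ?thesis using False by simp
      qed (use K[of "Suc n"] in auto)
      have "f x - S (Suc n) x = (\<Sum>i. F i x) - (\<Sum>i<Suc n. F i x)" by (simp add: f_def S_def g_def)
      also have "\<dots> = (\<Sum>i. F (i + Suc n) x)" using suminf_split_initial_segment[OF sumF, of x "Suc n"] by linarith
      also have "\<dots> = (\<Sum>i. (\<lambda>i. if i \<le> n then 0 else F i x) (i + Suc n))" by simp
      also have "\<dots> = (\<Sum>i. if i \<le> n then 0 else F i x) - (\<Sum>i<Suc n. if i \<le> n then 0 else F i x)"
        using suminf_split_initial_segment[OF geometric_tail(1)[OF t], of "Suc n"] by linarith
      also have "(\<Sum>i<Suc n. if i \<le> n then 0 else F i x) = (\<Sum>i<0. if i \<le> n then 0 else F i x)" by (simp add: sum.neutral)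
      finally have "\<bar>f x - S (Suc n) x\<bar> \<le> 2 * (1/2) ^ 0 * (1 / (1 + K (Suc n)))"
        using geometric_tail(2)[OF t, of 0] by simp
      then show ?thesis by simp
    qed
    then have "\<bar>(f x - S (Suc n) x) * ?d x\<bar> \<le> 2 / (1 + K (Suc n)) * \<bar>?d x\<bar>" for x
      unfolding abs_mult by (intro mult_right_mono) auto
    then have tail: "- (2 / (1 + K (Suc n)) * \<bar>?d x\<bar>) \<le> (f x - S (Suc n) x) * ?d x" for x
      by (meson abs_le_D2 minus_le_iff order_trans)
    have "real n * I - 1 \<le> (LBINT x. S (Suc n) x * ?d x)"
      unfolding S_Suc I_def by (rule \<tau>(4)[OF sS C_S])
    moreover have "- 2 \<le> (LBINT x. (f x - S (Suc n) x) * ?d x)"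
    proof -
      have k: "0 \<le> K n" "0 \<le> K (Suc n)" by (rule K)+
      have "2 / (1 + K (Suc n)) * (LBINT x. \<bar>?d x\<bar>) \<le> 2 / (1 + K (Suc n)) * (1 + K (Suc n))"
        using \<tau>(3) k by (intro mult_left_mono) auto
      also have "\<dots> = 2"
      proof -
        have "1 + K (Suc n) \<noteq> 0" using k by linarith
        from nonzero_mult_div_cancel_right[OF this, of 2] show ?thesis by (simp only: times_divide_eq_left)
      qed
      finally have "- 2 \<le> - (2 / (1 + K (Suc n)) * (LBINT x. \<bar>?d x\<bar>))" by linarith
      also have "\<dots> = (LBINT x. - (2 / (1 + K (Suc n)) * \<bar>?d x\<bar>))" by simp
      also have "\<dots> \<le> (LBINT x. (f x - S (Suc n) x) * ?d x)"
      proof (rule integral_mono[OF _ _ tail])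
        show "integrable lborel (\<lambda>x. - (2 / (1 + K (Suc n)) * \<bar>?d x\<bar>))"
          using int[of "\<lambda>_. 1"] by (intro Bochner_Integration.integrable_minus integrable_mult_right integrable_abs) auto
        show "integrable lborel (\<lambda>x. (f x - S (Suc n) x) * ?d x)"
          by (intro int continuous_on_diff cf smooth_continuous[OF sS])
      qed
      finally show ?thesis .
    qed
    moreover have "(LBINT x. f x * ?d x) = (LBINT x. S (Suc n) x * ?d x) + (LBINT x. (f x - S (Suc n) x) * ?d x)"
    proof -
      have "(LBINT x. S (Suc n) x * ?d x + (f x - S (Suc n) x) * ?d x) = (LBINT x. S (Suc n) x * ?d x) + (LBINT x. (f x - S (Suc n) x) * ?d x)"
        by (intro Bochner_Integration.integral_add int continuous_on_diff cf smooth_continuous[OF sS])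
      then show ?thesis by (simp add: left_diff_distrib)
    qed
    ultimately have "B < (LBINT x. f x * ?d x)" using n(1) by linarith
    moreover have "\<tau> \<in> test_functions \<Omega>"
    proof -
      have sub: "closure {x. \<tau> x \<noteq> 0} \<subseteq> cball (c j) (\<rho> j)" by (intro closure_minimal subsetI) (use \<tau>out in blast)+
      then have "compact (closure {x. \<tau> x \<noteq> 0})"
        using compact_closure bounded_subset[OF bounded_cball] closure_subset by (metis subset_trans)
      with sub j \<tau>(1) show ?thesis by (auto simp: test_functions_def)
    qed
    moreover have "\<bar>\<tau> x\<bar> \<le> 1" for x using \<tau>(2)[of x] bump_bounds(2)[of "c j" "\<rho> j" x] by (simp add: \<psi>_def)
    ultimately show "\<exists>\<tau>\<in>test_functions \<Omega>. (\<forall>x. \<bar>\<tau> x\<bar> \<le> 1) \<and> B < (LBINT x. f x * D2 \<tau> x (b 1) (b 1))"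
      by blast
  qed
qed

end

section \<open>Symmetric matrices\<close>

lemma inner_tensor_square: "tensor_square a \<bullet> tensor_square c = (a \<bullet> c)\<^sup>2"
proof -
  have "tensor_square a \<bullet> tensor_square c = (\<Sum>i\<in>UNIV. \<Sum>j\<in>UNIV. (a $ i * a $ j) * (c $ i * c $ j))"
    by (simp add: inner_sym_mat.rep_eq tensor_square.rep_eq inner_vec_def)
  also have "\<dots> = (\<Sum>i\<in>UNIV. a $ i * c $ i) * (\<Sum>j\<in>UNIV. a $ j * c $ j)"
    unfolding sum_product by (intro sum.cong refl) (simp add: mult_ac)
  finally show ?thesis by (simp add: inner_vec_def power2_eq_square)
qed

text \<open>
  With the matrix units $E_{ij}$ these are $(E_{pp} + E_{qq})/\sqrt 2$, $(E_{pp} - E_{qq})/\sqrt 2$ and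
  $(E_{pq} + E_{qp})/\sqrt 2$. Writing them with squares of vectors reduces all inner products to
  \<open>inner_tensor_square\<close>.
\<close>

definition matrix_frame :: "'n::finite \<Rightarrow> 'n \<Rightarrow> nat \<Rightarrow> 'n sym_mat" where
  "matrix_frame p q i = (1 / sqrt 2) *\<^sub>R
     (let P = tensor_square (axis p 1); Q = tensor_square (axis q 1); R = tensor_square (axis p 1 + axis q 1)
      in if i = 0 then P + Q else if i = 1 then P - Q else R - P - Q)"

lemma inner_tensor_square_frame:
  assumes "p \<noteq> q"
  shows "tensor_square a \<bullet> matrix_frame p q 0 = (1 / sqrt 2) * ((a $ p)\<^sup>2 + (a $ q)\<^sup>2)"
    "tensor_square a \<bullet> matrix_frame p q 1 = (1 / sqrt 2) * ((a $ p)\<^sup>2 - (a $ q)\<^sup>2)"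
    "tensor_square a \<bullet> matrix_frame p q 2 = (1 / sqrt 2) * (2 * (a $ p) * (a $ q))"
  by (simp_all add: matrix_frame_def Let_def inner_add_right inner_diff_right inner_tensor_square inner_axis power2_sum)

lemma null_frame_matrix_frame:
  assumes "p \<noteq> q"
  shows "null_frame (matrix_frame p q)"
proof
  fix i j :: nat assume "i < 3" "j < 3"
  then have ij: "i = 0 \<or> i = 1 \<or> i = 2" "j = 0 \<or> j = 1 \<or> j = 2" by auto
  have ax: "axis p (1::real) $ p = 1" "axis p (1::real) $ q = 0" "axis q (1::real) $ q = 1" "axis q (1::real) $ p = 0"
    using assms by (auto simp: axis_def)
  have s2: "1 / sqrt 2 * (1 / sqrt 2) = (1 / 2 :: real)" by simp
  have *: "matrix_frame p q i \<bullet> matrix_frame p q j = (1 / sqrt 2) *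
     (let P = tensor_square (axis p 1); Q = tensor_square (axis q 1); R = tensor_square (axis p 1 + axis q 1)
      in (if i = 0 then P + Q else if i = 1 then P - Q else R - P - Q) \<bullet> matrix_frame p q j)"
    by (subst matrix_frame_def) (simp add: Let_def)
  show "matrix_frame p q i \<bullet> matrix_frame p q j = (if i = j then 1 else 0)"
    unfolding * Let_def using ij
    by (elim disjE) (simp_all add: inner_add_left inner_diff_left inner_tensor_square_frame[OF assms] inner_tensor_square_frame[OF assms, unfolded One_nat_def] ax)
qed

theorem corollary1p5:
  assumes "CARD('n::{finite,linorder}) \<ge> 2"
  shows "\<exists>f :: 'n sym_mat \<Rightarrow> real.
    rank_one_convex f \<and>
    C1_function f \<and>
    locally_Holder (total_derivative f) \<and>
    (\<forall>\<Omega>. open \<Omega> \<and> \<Omega> \<noteq> {} \<longrightarrow>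
      (\<exists>e. (SUP \<phi> \<in> {\<phi> \<in> test_functions \<Omega>. \<forall>x. \<bar>\<phi> x\<bar> \<le> 1}.
              ereal (LINT x:\<Omega>|lborel. f x * second_derivative \<phi> x e e)) = \<infinity>)) \<and>
    (\<forall>\<xi>. \<not> locally_polyconvex_at f \<xi>)"
proof -
  obtain p q :: 'n where pq: "p \<noteq> q"
    using assms card_le_Suc0_iff_eq[of "UNIV :: 'n set"] by (auto simp: not_less_eq_eq numeral_2_eq_2)
  let ?b = "matrix_frame p q"
  interpret null_frame ?b by (rule null_frame_matrix_frame[OF pq])
  obtain f :: "'n sym_mat \<Rightarrow> real" and f' where
    conv: "\<And>x y u v. null_vector (y - x) \<Longrightarrow> 0 \<le> u \<Longrightarrow> 0 \<le> v \<Longrightarrow> u + v = 1 \<Longrightarrow> f (u *\<^sub>R x + v *\<^sub>R y) \<le> u * f x + v * f y"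
    and der: "\<And>x. (f has_derivative f' x) (at x)"
    and hol: "\<And>\<alpha> R. 0 < \<alpha> \<Longrightarrow> \<alpha> < 1 \<Longrightarrow> 0 < R \<Longrightarrow>
       \<exists>c>0. \<forall>x y v. norm (x - y) \<le> R \<longrightarrow> \<bar>f' x v - f' y v\<bar> \<le> c * norm (x - y) powr \<alpha> * norm v"
    and wild: "\<And>\<Omega> B. open \<Omega> \<Longrightarrow> \<Omega> \<noteq> {} \<Longrightarrow>
       \<exists>\<tau>\<in>test_functions \<Omega>. (\<forall>x. \<bar>\<tau> x\<bar> \<le> 1) \<and> B < (LBINT x. f x * D2 \<tau> x (?b 1) (?b 1))"
    by (rule wild_null_convex_function) (rule that)
  \<comment> \<open>The identity \<open>(x\<^sup>2 + y\<^sup>2)\<^sup>2 = (x\<^sup>2 - y\<^sup>2)\<^sup>2 + (2 * x * y)\<^sup>2\<close>.\<close>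
  have null: "null_vector (t *\<^sub>R tensor_square a)" for t a
  proof (rule null_vector_scaleR)
    show "null_vector (tensor_square a)"
      unfolding null_vector_def inner_tensor_square_frame[OF pq] power_mult_distrib distrib_left[symmetric]
      by (simp add: algebra_simps power2_eq_square)
  qed
  have td: "blinfun_apply (total_derivative f x) = f' x" for x
  proof -
    have "D1 f x = f' x" using frechet_derivative_at[OF der] by metis
    then show ?thesis unfolding total_derivative_def
      using has_derivative_bounded_linear[OF der] by (simp add: bounded_linear_Blinfun_apply)
  qed
  have tdH: "\<exists>c>0. \<forall>x y. norm (x - y) \<le> R \<longrightarrow> norm (total_derivative f x - total_derivative f y) \<le> c * norm (x - y) powr \<alpha>"
    if H: "0 < \<alpha>" "\<alpha> < 1" "0 < R" for \<alpha> R
  proof -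
    obtain c where c: "0 < c" "\<And>x y v. norm (x - y) \<le> R \<Longrightarrow> \<bar>f' x v - f' y v\<bar> \<le> c * norm (x - y) powr \<alpha> * norm v"
      using hol[OF H] by blast
    have "norm (total_derivative f x - total_derivative f y) \<le> c * norm (x - y) powr \<alpha>" if "norm (x - y) \<le> R" for x y
      by (rule norm_blinfun_bound) (use c that in \<open>auto simp: blinfun.diff_left td\<close>)
    with c(1) show ?thesis by blast
  qed
  have cf: "continuous_on UNIV f" by (intro continuous_at_imp_continuous_on ballI) (rule has_derivative_continuous[OF der])
  have "rank_one_convex f"
    unfolding rank_one_convex_def
  proof (intro allI impI)
    fix x y :: "'n sym_mat" assume "x - y \<in> {t *\<^sub>R tensor_square a | t a. True}"
    then obtain t a where xy: "x - y = t *\<^sub>R tensor_square a" by blast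
    show "convex_on (closed_segment x y) f"
      unfolding convex_on_def
    proof (intro conjI ballI allI impI convex_closed_segment)
      fix z w u v assume "z \<in> closed_segment x y" "w \<in> closed_segment x y" and uv: "0 \<le> u" "0 \<le> v" "u + v = (1::real)"
      then obtain s s' where s: "z = (1 - s) *\<^sub>R x + s *\<^sub>R y" "w = (1 - s') *\<^sub>R x + s' *\<^sub>R y" by (auto simp: in_segment)
      have "w - z = (s - s') *\<^sub>R (x - y)" unfolding s by (simp add: algebra_simps)
      then have "null_vector (w - z)" using null unfolding xy by simp
      from conv[OF this uv] show "f (u *\<^sub>R z + v *\<^sub>R w) \<le> u * f z + v * f w" .
    qed
  qed
  moreover have "C1_function f"
    unfolding C1_function_def
  proof (intro conjI allI)
    show "f differentiable (at x)" for x using der by (auto simp: differentiable_def)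
    obtain c where c: "0 < c" "\<And>x y. norm (x - y) \<le> 1 \<Longrightarrow> norm (total_derivative f x - total_derivative f y) \<le> c * norm (x - y) powr (1/2)"
      using tdH[of "1/2" 1] by auto
    show "continuous_on UNIV (total_derivative f)"
      unfolding continuous_on_iff
    proof (intro ballI allI impI)
      fix x :: "'n sym_mat" and e :: real assume e: "0 < e"
      define d where "d = min 1 ((e / (2 * c))\<^sup>2)"
      have d: "0 < d" using e c by (simp add: d_def)
      have "dist (total_derivative f y) (total_derivative f x) < e" if "dist y x < d" for y
      proof -
        have n: "norm (y - x) \<le> 1" "norm (y - x) \<le> (e / (2 * c))\<^sup>2" using that by (auto simp: d_def dist_norm)
        have "norm (y - x) powr (1/2) = sqrt (norm (y - x))" by (simp add: powr_half_sqrt)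
        also have "\<dots> \<le> sqrt ((e / (2 * c))\<^sup>2)" using n(2) by (rule real_sqrt_le_mono)
        also have "\<dots> = e / (2 * c)" using e c by simp
        finally have "c * norm (y - x) powr (1/2) \<le> c * (e / (2 * c))" using c by (intro mult_left_mono) auto
        also have "\<dots> = e / 2" using c by simp
        finally show ?thesis using c(2)[OF n(1)] e by (simp add: dist_norm)
      qed
      with d show "\<exists>d>0. \<forall>y\<in>UNIV. dist y x < d \<longrightarrow> dist (total_derivative f y) (total_derivative f x) < e" by blast
    qed
  qed
  moreover have "locally_Holder (total_derivative f)"
    unfolding locally_Holder_def
  proof (intro allI impI, elim conjE)
    fix K :: "'n sym_mat set" and \<alpha> :: real assume K: "compact K" and \<alpha>: "0 < \<alpha>" "\<alpha> < 1"
    obtain R where R: "0 < R" "\<And>x. x \<in> K \<Longrightarrow> norm x \<le> R"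
      using compact_imp_bounded[OF K] unfolding bounded_pos by blast
    obtain c where c: "0 < c" "\<And>x y. norm (x - y) \<le> 2 * R \<Longrightarrow> norm (total_derivative f x - total_derivative f y) \<le> c * norm (x - y) powr \<alpha>"
      using tdH[OF \<alpha>, of "2 * R"] R(1) by auto
    have "norm (x - y) \<le> 2 * R" if "x \<in> K" "y \<in> K" for x y
      using norm_triangle_ineq4[of x y] R(2)[OF that(1)] R(2)[OF that(2)] by linarith
    with c show "\<exists>c>0. \<forall>x\<in>K. \<forall>y\<in>K. norm (total_derivative f x - total_derivative f y) \<le> c * norm (x - y) powr \<alpha>" by blast
  qed
  moreover have "\<exists>e. (SUP \<phi> \<in> {\<phi> \<in> test_functions \<Omega>. \<forall>x. \<bar>\<phi> x\<bar> \<le> 1}.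
              ereal (LINT x:\<Omega>|lborel. f x * D2 \<phi> x e e)) = \<infinity>" if H: "open \<Omega>" "\<Omega> \<noteq> {}" for \<Omega>
  proof (intro exI[of _ "?b 1"] SUP_PInfty)
    fix n :: nat
    obtain \<tau> where \<tau>: "\<tau> \<in> test_functions \<Omega>" "\<forall>x. \<bar>\<tau> x\<bar> \<le> 1" "real n < (LBINT x. f x * D2 \<tau> x (?b 1) (?b 1))"
      using wild[OF H] by blast
    then show "\<exists>\<phi>\<in>{\<phi> \<in> test_functions \<Omega>. \<forall>x. \<bar>\<phi> x\<bar> \<le> 1}. ereal (real n) \<le> ereal (LINT x:\<Omega>|lborel. f x * D2 \<phi> x (?b 1) (?b 1))"
      by (intro bexI[of _ \<tau>]) (simp_all add: set_integral_test_function)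
  qed
  moreover have "\<not> locally_polyconvex_at f \<xi>" for \<xi>
  proof
    assume poly: "locally_polyconvex_at f \<xi>"
    have b1: "?b 1 = (1 / sqrt 2) *\<^sub>R (tensor_square (axis p 1) - tensor_square (axis q 1))"
      by (simp add: matrix_frame_def)
    have s2: "0 < 1 / sqrt 2" by simp
    show False
    proof (rule locally_polyconvex_hessian_measure[OF poly cf s2, of "axis p 1" "axis q 1", folded b1])
      fix r B
      assume r: "0 < r" and B: "\<And>\<phi>. \<phi> \<in> test_functions (ball \<xi> r) \<Longrightarrow> (\<And>x. \<bar>\<phi> x\<bar> \<le> 1) \<Longrightarrow>
        (LBINT x. f x * D2 \<phi> x (?b 1) (?b 1)) \<le> B"
      have "open (ball \<xi> r)" "ball \<xi> r \<noteq> {}" using r by auto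
      from wild[OF this, of B] obtain \<tau> where "\<tau> \<in> test_functions (ball \<xi> r)" "\<forall>x. \<bar>\<tau> x\<bar> \<le> 1"
        "B < (LBINT x. f x * D2 \<tau> x (?b 1) (?b 1))" by blast
      with B[of \<tau>] show False by force
    qed
  qed
  ultimately show ?thesis by blast
qed

end
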